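(* Let $\Omega\subset\mathbb{R}^n$ be a bounded, connected, open set, $v$ a weight on $\Omega$ with $v\in L^1(\Omega)$, and $Q$ a matrix function on $\Omega$ with $|Q(x)|_{\mathrm{op}}\le k\,v(x)$ for a.e. $x\in\Omega$ and some $k>0$. Let $N\in\mathbb{N}$, $f,F\in L^2(v,\Omega)$, $\mathbf G,\mathbf H,\mathbf g\in L^2(v,\Omega,\mathbb{R}^N)$, and let $\mathbf R,\mathbf S,\mathbf T$ be $N$-tuples of degenerate subunit vector fields. Suppose that $\int_\Omega(\mathbf G\cdot\mathbf S\varphi+F\varphi)\,v\,dx\ge0$ for every nonnegative $\varphi\in Q\mathrm{Lip}_0(v,\Omega)$. Suppose that for some $\sigma>1$ there is a constant $C$ such that $\big(\int_\Omega|\varphi|^{2\sigma}v\,dx\big)^{\frac1{2\sigma}}\le C\big(\int_\Omega|\sqrt Q\nabla\varphi|^2dx\big)^{\frac12}$ for all $\varphi\in Q\mathrm{Lip}_0(v,\Omega)$. Suppose also that $\rho$ is an admissible quasimetric on $\Omega$ and that the local Poincaré inequality holds on $\Omega$ with respect to $\rho$. If for some $q>2\sigma'$, $\mathbf H,\mathbf G\in L^q(v,\Omega,\mathbb{R}^N)$ and $F\in L^{q/2}(v,\Omega)$, then the Dirichlet problem $$-v^{-1}\operatorname{div}(Q\nabla u)+\mathbf H\cdot\mathbf Ru+\mathbf S'\mathbf Gu+Fu=f+\mathbf T'\mathbf g\ \text{in }\Omega,\qquad u=0\ \text{on }\partial\Omega,$$ has a unique degenerate weak solution $u\in QH^{1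,2}_0(v,\Omega)$.
   Context: $\sigma'=\sigma/(\sigma-1)$. A weight is a nonnegative measurable function $v$ with $0<v(x)<\infty$ a.e. A matrix function $Q$ on $\Omega$ is a map whose values are real, symmetric, positive semidefinite $n\times n$ matrices, with measurable entries finite a.e., and with $Q(x)$ invertible for a.e. $x$; $\sqrt Q$ is the positive semidefinite square root and $|\cdot|_{\mathrm{op}}$ the operator norm. Function spaces. $L^p(v,\Omega)$ has norm $(\int_\Omega|f|^pv\,dx)^{1/p}$; $\mathbf f\in L^p(v,\Omega,\mathbb{R}^N)$ means $|\mathbf f|\in L^p(v,\Omega)$. $QL^2(\Omega)$ is the space of measurable $\mathbf f:\Omega\to\mathbb{R}^n$ with $\|\mathbf f\|_{QL^2(\Omega)}=(\int_\Omega|\sqrt Q\mathbf f|^2dx)^{1/2}<\infty$. $\mathrm{Lip}_{\mathrm{loc}}(\Omega)$: functions Lipschitz on compact subsets of $\Omega$; $\mathrm{Lip}_0(\Omega)$: Lipschitz functions with compact support in $\Omega$. $Q\mathrm{Lip}_{\mathrm{loc}}(v,\Omega)$ (resp. $Q\mathrm{Lip}_0(v,\Omega)$) is the set of $\varphi$ in $\mathrm{Lip}_{\mathrm{loc}}(\Omega)$ (resp. $\mathrm{Lip}_0(\Omega)$) with $\|\varphi\|_{QH^{1,2}(v,\Omega)}=\|\varphi\|_{L^2(v,\Omega)}+\|\nabla\varphi\|_{QL^2(\Omega)}<\infty$. $QH^{1,2}(v,\Omega)$ (resp. $QH^{1,2}_0(v,\Omega)$) is the closure of $\{(\varphi,\nabla\varphi)\}$,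 $\varphi\in Q\mathrm{Lip}_{\mathrm{loc}}(v,\Omega)$ (resp. $Q\mathrm{Lip}_0(v,\Omega)$), in $L^2(v,\Omega)\oplus QL^2(\Omega)$. Elements are pairs $(u,\mathbf g)$ with norm $\|u\|_{L^2(v,\Omega)}+\|\mathbf g\|_{QL^2(\Omega)}$; one writes $\nabla u:=\mathbf g$ by convention (it need not be a weak derivative nor be determined by $u$) and often just $u$ for the pair. Vector fields. A vector field is $V=\mathbf v\cdot\nabla$ with $\mathbf v:\Omega\to\mathbb{R}^n$ measurable, acting by $Vu=\mathbf v\cdot\nabla u$. It is degenerate subunit if there is a constant $C(V)$ with $\|Vu\|_{L^2(v,\Omega)}\le C(V)\|u\|_{QH^{1,2}(v,\Omega)}$ for all $u\in QH^{1,2}(v,\Omega)$. For $\mathbf R=(R_1,\dots,R_N)$, $\mathbf H\cdot\mathbf Ru=\sum_iH_iR_iu$; similarly $\mathbf G\cdot\mathbf S\varphi=\sum_iG_iS_i\varphi$, $\mathbf g\cdot\mathbf T\varphi=\sum_ig_iT_i\varphi$. With $S_i=\mathbf s_i\cdot\nabla$, the formal adjoint is $S_i'u=-v^{-1}\operatorname{div}(\mathbf s_iuv)$, and $\mathbf S'\mathbf Gu=\sum_iS_i'(G_iu)$; $\mathbf T'\mathbf g=\sum_iT_i'g_i$ likewise. Degenerate weak solution: a pair $(u,\nabla u)\in QH^{1,2}_0(v,\Omega)$ such that for all $\varphi\in Q\mathrm{Lip}_0(v,\Omega)$, $$\int_\Omega Q\nabla u\cdot\nabla\varphi\,dx+\int_\Omega\mathbf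 H\cdot\mathbf Ru\,\varphi\,v\,dx+\int_\Omega u\,\mathbf G\cdot\mathbf S\varphi\,v\,dx+\int_\Omega Fu\varphi\,v\,dx=\int_\Omega f\varphi\,v\,dx+\int_\Omega\mathbf g\cdot\mathbf T\varphi\,v\,dx.$$ Quasimetric. A quasimetric on $\Omega$ is $\rho:\Omega\times\Omega\to[0,\infty)$, symmetric, with $\rho(x,y)=0$ iff $x=y$, and $\rho(x,y)\le\kappa(\rho(x,z)+\rho(z,y))$ for some constant $\kappa>0$; $B_\rho(x,r)=\{y\in\Omega:\rho(x,y)<r\}$. Call it admissible if: (i) $\rho$-balls are open in the standard topology; (ii) for each $x\in\Omega$ there is $\delta(x)>0$ such that $\overline{B_\rho(x,r)}\subset\Omega$ for $0<r<\delta(x)$; (iii) there is a function $\mathcal G:(0,\infty)\to(0,\infty)$ such that for every compact $K\subset\Omega$ there is $\delta>0$ such that if $0<s<r<\delta$ and $x\in K$, there are at most $\mathcal G(r/s)$ points $x_i\in B_\rho(x,r)$ such that the balls $B_\rho(x_i,s)$ are disjoint. Local Poincaré inequality on $\Omega$: there is $c\ge1$ such that for every compact $K\subset\Omega$ and $\epsilon>0$ there is $\delta>0$ so that for $0<r<\delta$, $x\in K$, and all $\varphi\in Q\mathrm{Lip}_0(v,\Omega)$, $$\Big(\int_{B_\rho(x,r)}|\varphi-\varphi_{v,B_\rho}|^2v\,dy\Big)^{\frac12}\le\epsilon\Big[\Big(\int_{B_\rho(x,cr)}|\sqrt Q\nabla\varphi|^2dy\Big)^{\frac12}+\Big(\int_{B_\rho(x,cr)}|\varphi|^2v\,dy\Big)^{\frac12}\Big],$$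 where $\varphi_{v,B_\rho}=v(B)^{-1}\int_B\varphi\,v\,dy$, $B=B_\rho(x,r)$, $v(B)=\int_Bv\,dy$. *)

theory Defs
  imports "HOL-Analysis.Analysis"
begin

text \<open>
  Functions on \<open>\<Omega>\<close> are represented by total functions on \<open>real ^ 'n\<close> whose values outside \<open>\<Omega>\<close> play
  no role; measurability and integrals refer to Lebesgue measure on \<open>\<Omega>\<close>.  The spaces
  below consist of actual functions rather than of classes modulo null sets, so equality in them is
  to be read as almost everywhere equality.
\<close>

section \<open>Weights and matrix functions\<close>

definition weight_on :: "(real ^ 'n) set \<Rightarrow> (real ^ 'n \<Rightarrow> real) \<Rightarrow> bool" where
  "weight_on \<Omega> v \<longleftrightarrow>
     v \<in> borel_measurable (lebesgue_on \<Omega>) \<and> (\<forall>x\<in>\<Omega>. 0 \<le> v x) \<and>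
     (AE x in lebesgue_on \<Omega>. 0 < v x)"

definition psd_matrix :: "real ^ 'n ^ 'n \<Rightarrow> bool" where
  "psd_matrix A \<longleftrightarrow> transpose A = A \<and> (\<forall>x. 0 \<le> x \<bullet> (A *v x))"

definition psd_sqrt :: "real ^ 'n ^ 'n \<Rightarrow> real ^ 'n ^ 'n" where
  "psd_sqrt A = (THE B. psd_matrix B \<and> B ** B = A)"

definition matrix_op_norm :: "real ^ 'n ^ 'n \<Rightarrow> real" where
  "matrix_op_norm A = onorm (\<lambda>x. A *v x)"

definition matrix_function_on :: "(real ^ 'n) set \<Rightarrow> (real ^ 'n \<Rightarrow> real ^ 'n ^ 'n) \<Rightarrow> bool" where
  "matrix_function_on \<Omega> Q \<longleftrightarrow>
     (\<forall>x\<in>\<Omega>. psd_matrix (Q x)) \<and>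
     (\<forall>i j. (\<lambda>x. Q x $ i $ j) \<in> borel_measurable (lebesgue_on \<Omega>)) \<and>
     (AE x in lebesgue_on \<Omega>. invertible (Q x))"


section \<open>Function spaces\<close>

definition weighted_Lp ::
  "real \<Rightarrow> (real ^ 'n \<Rightarrow> real) \<Rightarrow> (real ^ 'n) set \<Rightarrow> (real ^ 'n \<Rightarrow> 'b::euclidean_space) set" where
  "weighted_Lp p v \<Omega> =
     {f. f \<in> borel_measurable (lebesgue_on \<Omega>) \<and>
         integrable (lebesgue_on \<Omega>) (\<lambda>x. norm (f x) powr p * v x)}"

definition weighted_Lp_norm ::
  "real \<Rightarrow> (real ^ 'n \<Rightarrow> real) \<Rightarrow> (real ^ 'n) set \<Rightarrow> (real ^ 'n \<Rightarrow> 'b::euclidean_space) \<Rightarrow> real" where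
  "weighted_Lp_norm p v \<Omega> f =
     (LINT x|lebesgue_on \<Omega>. norm (f x) powr p * v x) powr (1 / p)"

definition QL2 ::
  "(real ^ 'n \<Rightarrow> real ^ 'n ^ 'n) \<Rightarrow> (real ^ 'n) set \<Rightarrow> (real ^ 'n \<Rightarrow> real ^ 'n) set" where
  "QL2 Q \<Omega> =
     {w. w \<in> borel_measurable (lebesgue_on \<Omega>) \<and>
         integrable (lebesgue_on \<Omega>) (\<lambda>x. (norm (psd_sqrt (Q x) *v w x))\<^sup>2)}"

definition QL2_norm ::
  "(real ^ 'n \<Rightarrow> real ^ 'n ^ 'n) \<Rightarrow> (real ^ 'n) set \<Rightarrow> (real ^ 'n \<Rightarrow> real ^ 'n) \<Rightarrow> real" where
  "QL2_norm Q \<Omega> w = sqrt (LINT x|lebesgue_on \<Omega>. (norm (psd_sqrt (Q x) *v w x))\<^sup>2)"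

text \<open>
  The vector of partial derivatives.  A locally Lipschitz function has them almost everywhere
  (Rademacher); on the exceptional null set the value of \<^const>\<open>deriv\<close> is an
  irrelevant fixed constant.
\<close>
definition grad :: "(real ^ 'n \<Rightarrow> real) \<Rightarrow> real ^ 'n \<Rightarrow> real ^ 'n" where
  "grad \<phi> x = (\<chi> i. deriv (\<lambda>t. \<phi> (x + t *\<^sub>R axis i 1)) 0)"

definition Lip_loc :: "(real ^ 'n) set \<Rightarrow> (real ^ 'n \<Rightarrow> real) set" where
  "Lip_loc \<Omega> = {\<phi>. \<forall>K. compact K \<and> K \<subseteq> \<Omega> \<longrightarrow> (\<exists>L. L-lipschitz_on K \<phi>)}"

definition Lip0 :: "(real ^ 'n) set \<Rightarrow> (real ^ 'n \<Rightarrow> real) set" where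
  "Lip0 \<Omega> = {\<phi>. (\<exists>L. L-lipschitz_on \<Omega> \<phi>) \<and>
     compact (closure (support_on \<Omega> \<phi>)) \<and> closure (support_on \<Omega> \<phi>) \<subseteq> \<Omega>}"

definition QLip_loc ::
  "(real ^ 'n \<Rightarrow> real ^ 'n ^ 'n) \<Rightarrow> (real ^ 'n \<Rightarrow> real) \<Rightarrow> (real ^ 'n) set \<Rightarrow>
    (real ^ 'n \<Rightarrow> real) set" where
  "QLip_loc Q v \<Omega> = {\<phi> \<in> Lip_loc \<Omega>. \<phi> \<in> weighted_Lp 2 v \<Omega> \<and> grad \<phi> \<in> QL2 Q \<Omega>}"

definition QLip0 ::
  "(real ^ 'n \<Rightarrow> real ^ 'n ^ 'n) \<Rightarrow> (real ^ 'n \<Rightarrow> real) \<Rightarrow> (real ^ 'n) set \<Rightarrow>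
    (real ^ 'n \<Rightarrow> real) set" where
  "QLip0 Q v \<Omega> = {\<phi> \<in> Lip0 \<Omega>. \<phi> \<in> weighted_Lp 2 v \<Omega> \<and> grad \<phi> \<in> QL2 Q \<Omega>}"

definition QH_norm ::
  "(real ^ 'n \<Rightarrow> real ^ 'n ^ 'n) \<Rightarrow> (real ^ 'n \<Rightarrow> real) \<Rightarrow> (real ^ 'n) set \<Rightarrow>
    (real ^ 'n \<Rightarrow> real) \<Rightarrow> (real ^ 'n \<Rightarrow> real ^ 'n) \<Rightarrow> real" where
  "QH_norm Q v \<Omega> u Du = weighted_Lp_norm 2 v \<Omega> u + QL2_norm Q \<Omega> Du"

text \<open>The closure of \<open>{(\<phi>, \<nabla>\<phi>). \<phi> \<in> A}\<close> in \<open>L\<^sup>2(v, \<Omega>) \<oplus> QL\<^sup>2(\<Omega>)\<close>.\<close>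
definition QH_closure ::
  "(real ^ 'n \<Rightarrow> real ^ 'n ^ 'n) \<Rightarrow> (real ^ 'n \<Rightarrow> real) \<Rightarrow> (real ^ 'n) set \<Rightarrow>
    (real ^ 'n \<Rightarrow> real) set \<Rightarrow> ((real ^ 'n \<Rightarrow> real) \<times> (real ^ 'n \<Rightarrow> real ^ 'n)) set" where
  "QH_closure Q v \<Omega> A =
     {(u, Du). u \<in> weighted_Lp 2 v \<Omega> \<and> Du \<in> QL2 Q \<Omega> \<and>
        (\<forall>\<epsilon>>0. \<exists>\<phi>\<in>A. QH_norm Q v \<Omega> (\<lambda>x. u x - \<phi> x) (\<lambda>x. Du x - grad \<phi> x) < \<epsilon>)}"

definition QH ::
  "(real ^ 'n \<Rightarrow> real ^ 'n ^ 'n) \<Rightarrow> (real ^ 'n \<Rightarrow> real) \<Rightarrow> (real ^ 'n) set \<Rightarrow>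
    ((real ^ 'n \<Rightarrow> real) \<times> (real ^ 'n \<Rightarrow> real ^ 'n)) set" where
  "QH Q v \<Omega> = QH_closure Q v \<Omega> (QLip_loc Q v \<Omega>)"

definition QH0 ::
  "(real ^ 'n \<Rightarrow> real ^ 'n ^ 'n) \<Rightarrow> (real ^ 'n \<Rightarrow> real) \<Rightarrow> (real ^ 'n) set \<Rightarrow>
    ((real ^ 'n \<Rightarrow> real) \<times> (real ^ 'n \<Rightarrow> real ^ 'n)) set" where
  "QH0 Q v \<Omega> = QH_closure Q v \<Omega> (QLip0 Q v \<Omega>)"


section \<open>Vector fields\<close>

text \<open>
  A vector field is given by its coefficient function \<open>V\<close>; it acts on a pair \<open>(u, Du)\<close> by
  \<open>x \<mapsto> V x \<bullet> Du x\<close>.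
\<close>
definition degenerate_subunit ::
  "(real ^ 'n \<Rightarrow> real ^ 'n ^ 'n) \<Rightarrow> (real ^ 'n \<Rightarrow> real) \<Rightarrow> (real ^ 'n) set \<Rightarrow>
    (real ^ 'n \<Rightarrow> real ^ 'n) \<Rightarrow> bool" where
  "degenerate_subunit Q v \<Omega> V \<longleftrightarrow>
     V \<in> borel_measurable (lebesgue_on \<Omega>) \<and>
     (\<exists>C. \<forall>(u, Du)\<in>QH Q v \<Omega>.
        (\<lambda>x. V x \<bullet> Du x) \<in> weighted_Lp 2 v \<Omega> \<and>
        weighted_Lp_norm 2 v \<Omega> (\<lambda>x. V x \<bullet> Du x) \<le> C * QH_norm Q v \<Omega> u Du)"

text \<open>The function \<open>H \<cdot> R u = \<Sum>\<^sub>i H\<^sub>i R\<^sub>i u\<close> for a pair \<open>(u, Du)\<close>.\<close>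
definition fields_dot ::
  "(real ^ 'n \<Rightarrow> real ^ 'N) \<Rightarrow> ('N \<Rightarrow> real ^ 'n \<Rightarrow> real ^ 'n) \<Rightarrow>
    (real ^ 'n \<Rightarrow> real ^ 'n) \<Rightarrow> real ^ 'n \<Rightarrow> real" where
  "fields_dot H R Du x = (\<Sum>i\<in>UNIV. H x $ i * (R i x \<bullet> Du x))"


section \<open>Degenerate weak solutions\<close>

text \<open>
  Weak solutions of
  \<open>- v\<^sup>-\<^sup>1 div (Q \<nabla>u) + H \<cdot> R u + S' G u + F u = f + T' g\<close> in \<open>\<Omega>\<close>, \<open>u = 0\<close> on the boundary, where
  \<open>S'\<close> and \<open>T'\<close> are the formal adjoints of \<open>S\<close> and \<open>T\<close>.
  A divergent Bochner integral has the value 0.  No separate integrability condition is imposed: if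
  \<open>v\<close> is integrable, the Sobolev inequality with gain \<open>\<sigma> > 1\<close> holds, the fields are subunit, and \<open>H\<close>, \<open>G\<close>
  are in \<open>L\<^sup>q(v)\<close> with \<open>q > 2\<sigma>/(\<sigma> - 1)\<close>, \<open>F\<close>, \<open>f\<close>, \<open>g\<close> in \<open>L\<^sup>2(v)\<close>, all six integrals converge absolutely by
  Hoelder's inequality.
\<close>
definition degenerate_weak_solution ::
  "(real ^ 'n) set \<Rightarrow> (real ^ 'n \<Rightarrow> real) \<Rightarrow> (real ^ 'n \<Rightarrow> real ^ 'n ^ 'n) \<Rightarrow>
    (real ^ 'n \<Rightarrow> real ^ 'N) \<Rightarrow> ('N \<Rightarrow> real ^ 'n \<Rightarrow> real ^ 'n) \<Rightarrow>
    (real ^ 'n \<Rightarrow> real ^ 'N) \<Rightarrow> ('N \<Rightarrow> real ^ 'n \<Rightarrow> real ^ 'n) \<Rightarrow>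
    (real ^ 'n \<Rightarrow> real) \<Rightarrow> (real ^ 'n \<Rightarrow> real) \<Rightarrow>
    (real ^ 'n \<Rightarrow> real ^ 'N) \<Rightarrow> ('N \<Rightarrow> real ^ 'n \<Rightarrow> real ^ 'n) \<Rightarrow>
    (real ^ 'n \<Rightarrow> real) \<Rightarrow> (real ^ 'n \<Rightarrow> real ^ 'n) \<Rightarrow> bool" where
  "degenerate_weak_solution \<Omega> v Q H R G S F f g T u Du \<longleftrightarrow>
     (u, Du) \<in> QH0 Q v \<Omega> \<and>
     (\<forall>\<phi>\<in>QLip0 Q v \<Omega>.
        (LINT x|lebesgue_on \<Omega>. (Q x *v Du x) \<bullet> grad \<phi> x)
        + (LINT x|lebesgue_on \<Omega>. fields_dot H R Du x * \<phi> x * v x)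
        + (LINT x|lebesgue_on \<Omega>. u x * fields_dot G S (grad \<phi>) x * v x)
        + (LINT x|lebesgue_on \<Omega>. F x * u x * \<phi> x * v x)
        = (LINT x|lebesgue_on \<Omega>. f x * \<phi> x * v x)
        + (LINT x|lebesgue_on \<Omega>. fields_dot g T (grad \<phi>) x * v x))"


section \<open>Quasimetrics and Poincare inequality\<close>

definition quasimetric_on :: "(real ^ 'n) set \<Rightarrow> (real ^ 'n \<Rightarrow> real ^ 'n \<Rightarrow> real) \<Rightarrow> bool" where
  "quasimetric_on \<Omega> \<rho> \<longleftrightarrow>
     (\<forall>x\<in>\<Omega>. \<forall>y\<in>\<Omega>. 0 \<le> \<rho> x y \<and> \<rho> x y = \<rho> y x \<and> (\<rho> x y = 0 \<longleftrightarrow> x = y)) \<and>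
     (\<exists>\<kappa>>0. \<forall>x\<in>\<Omega>. \<forall>y\<in>\<Omega>. \<forall>z\<in>\<Omega>. \<rho> x y \<le> \<kappa> * (\<rho> x z + \<rho> z y))"

definition qball ::
  "(real ^ 'n) set \<Rightarrow> (real ^ 'n \<Rightarrow> real ^ 'n \<Rightarrow> real) \<Rightarrow> real ^ 'n \<Rightarrow> real \<Rightarrow> (real ^ 'n) set" where
  "qball \<Omega> \<rho> x r = {y\<in>\<Omega>. \<rho> x y < r}"

definition admissible_quasimetric ::
  "(real ^ 'n) set \<Rightarrow> (real ^ 'n \<Rightarrow> real ^ 'n \<Rightarrow> real) \<Rightarrow> bool" where
  "admissible_quasimetric \<Omega> \<rho> \<longleftrightarrow>
     quasimetric_on \<Omega> \<rho> \<and>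
     (\<forall>x\<in>\<Omega>. \<forall>r>0. open (qball \<Omega> \<rho> x r)) \<and>
     (\<forall>x\<in>\<Omega>. \<exists>\<delta>>0. \<forall>r. 0 < r \<and> r < \<delta> \<longrightarrow> closure (qball \<Omega> \<rho> x r) \<subseteq> \<Omega>) \<and>
     (\<exists>\<G> :: real \<Rightarrow> real. (\<forall>t>0. 0 < \<G> t) \<and>
        (\<forall>K. compact K \<and> K \<subseteq> \<Omega> \<longrightarrow>
           (\<exists>\<delta>>0. \<forall>s r. \<forall>x\<in>K. 0 < s \<and> s < r \<and> r < \<delta> \<longrightarrow>
              (\<forall>P. P \<subseteq> qball \<Omega> \<rho> x r \<and> disjoint_family_on (\<lambda>p. qball \<Omega> \<rho> p s) P \<longrightarrow>
                 finite P \<and> real (card P) \<le> \<G> (r / s)))))"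

definition weighted_average ::
  "(real ^ 'n \<Rightarrow> real) \<Rightarrow> (real ^ 'n) set \<Rightarrow> (real ^ 'n \<Rightarrow> real) \<Rightarrow> real" where
  "weighted_average v B \<phi> = (LINT y|lebesgue_on B. \<phi> y * v y) / (LINT y|lebesgue_on B. v y)"

definition local_Poincare ::
  "(real ^ 'n \<Rightarrow> real ^ 'n ^ 'n) \<Rightarrow> (real ^ 'n \<Rightarrow> real) \<Rightarrow> (real ^ 'n) set \<Rightarrow>
    (real ^ 'n \<Rightarrow> real ^ 'n \<Rightarrow> real) \<Rightarrow> bool" where
  "local_Poincare Q v \<Omega> \<rho> \<longleftrightarrow>
     (\<exists>c\<ge>1. \<forall>K \<epsilon>. compact K \<and> K \<subseteq> \<Omega> \<and> 0 < \<epsilon> \<longrightarrow>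
        (\<exists>\<delta>>0. \<forall>r. \<forall>x\<in>K. \<forall>\<phi>\<in>QLip0 Q v \<Omega>. 0 < r \<and> r < \<delta> \<longrightarrow>
           weighted_Lp_norm 2 v (qball \<Omega> \<rho> x r)
             (\<lambda>y. \<phi> y - weighted_average v (qball \<Omega> \<rho> x r) \<phi>)
           \<le> \<epsilon> * (QL2_norm Q (qball \<Omega> \<rho> x (c * r)) (grad \<phi>)
                  + weighted_Lp_norm 2 v (qball \<Omega> \<rho> x (c * r)) \<phi>)))"

end

theory Submission
  imports Defs "HOL-Library.Function_Algebras"
begin

text \<open>
  Write \<open>\<nu>\<close> for the measure \<open>v dx\<close> and \<open>B(u, w) = \<integral> Q\<nabla>u \<bullet> \<nabla>w + K(u, w)\<close> for the form on the left of the weak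
  equation, where \<open>K\<close> collects the three lower-order integrals.  By the Sobolev inequality
  \<open>\<langle>u, w\<rangle> = \<integral> Q\<nabla>u \<bullet> \<nabla>w\<close> is an inner product on \<open>QH\<^sub>0\<close> for which \<open>QH\<^sub>0\<close> is complete
  (\<open>X_complete\<close>), and by Hoelder's inequality multiplication by a function in \<open>L\<^sup>q(\<nu>)\<close> maps \<open>QH\<^sub>0\<close> boundedly
  into \<open>L\<^sup>2(\<nu>)\<close> (\<open>multiplier_QH0\<close>), so \<open>K\<close> is bounded.  But \<open>B\<close> need not be coercive.

  Everything follows from a bound for the adjoint problem: if \<open>|\<langle>u, w\<rangle> + t K(u, w)| \<le> m \<parallel>u\<parallel>\<close> for all \<open>u\<close>, then
  \<open>\<parallel>w\<parallel> \<le> C m\<close>, with \<open>C\<close> independent of \<open>t \<in> [0, 1]\<close> (\<open>apriori_estimate\<close>).  The adjoint problem is solvable for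
  \<open>t = 0\<close> by the Riesz theorem; since the bound does not depend on \<open>t\<close>, solvability propagates in steps of fixed
  length to \<open>t = 1\<close> (\<open>solvable_step\<close>).  An adjoint problem that is uniquely solvable with a bound gives existence
  and uniqueness for \<open>B\<close> itself by duality (\<open>exists_solution\<close>, \<open>unique_solution\<close>).

  For the bound it is enough, by density, to consider Lipschitz \<open>w\<close>.  Insert \<open>u = T(w)\<close> with \<open>s T(s) \<ge> 0\<close>.
  The product rule gives \<open>u G \<bullet> Sw = G \<bullet> S(uw) - w G \<bullet> Su\<close>, and the sign condition, applied to the nonnegative
  function \<open>uw = w T(w)\<close>, shows that \<open>\<integral> (G \<bullet> S(uw) + F u w) d\<nu>\<close> may be dropped.  In what remains the derivatives
  fall on \<open>u\<close> only.  Writing \<open>T' = \<psi>\<^sup>2\<close> and \<open>\<Psi>' = \<psi>\<close>, one obtains \<open>\<parallel>\<Psi>(w)\<parallel> \<le> m + A \<parallel>h w \<psi>(w)\<parallel>\<close>, where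
  \<open>h = max |H| |G|\<close> and the norm on the right is that of \<open>L\<^sup>2(\<nu>)\<close> (\<open>test_inequality\<close>).
  This is used twice.  For \<open>T(s) = m arctan (s/m)\<close> the right side is at most
  \<open>m (1 + A \<parallel>h\<parallel>)\<close>, because \<open>|s \<psi>(s)| \<le> m\<close>; as \<open>\<Psi>(s) = m arsinh (s/m)\<close>, this makes the sets \<open>{|w| \<ge> km}\<close> small,
  uniformly in \<open>w\<close> and \<open>m\<close>, if \<open>k\<close> is large.  For \<open>T(s) = s\<close> the right side contains \<open>\<parallel>h w\<parallel>\<close>: where \<open>|w| < km\<close>
  it is at most \<open>km \<parallel>h\<parallel>\<close>, and on the complement, a set of small measure, \<open>h\<close> is a multiplier of small norm, so
  that this part is absorbed into the left side.

  Two foundations are needed for this calculus: Lipschitz functions have partial derivatives almost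
  everywhere, so that \<open>grad\<close> is linear and obeys the chain rule up to null sets, and
  positive semidefinite matrices have unique square roots, so that \<open>|\<surd>Q w|\<^sup>2 = w \<bullet> Qw\<close>.
\<close>

section \<open>Semi-Hilbert spaces and perturbed inner products\<close>

text \<open>The source of all Cauchy-Schwarz inequalities and variational identities below.\<close>
lemma nonneg_quadratic_discriminant:
  fixes a b c :: real
  assumes nonneg: "\<And>t. 0 \<le> a + 2 * t * b + t\<^sup>2 * c"
  shows "b\<^sup>2 \<le> a * c"
proof -
  have "c \<ge> 0"
  proof (rule ccontr)
    assume "\<not> c \<ge> 0"
    then obtain d where d: "c = - d" "d > 0" by (metis minus_minus neg_0_less_iff_less not_le)
    define t where "t = 1 + (2 * \<bar>b\<bar> + \<bar>a\<bar>) / d"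
    have t: "t \<ge> 1" using d by (simp add: t_def)
    have "t * d = d + (2 * \<bar>b\<bar> + \<bar>a\<bar>)" using d by (simp add: t_def field_simps)
    then have "t * (t * d) = t * d + t * (2 * \<bar>b\<bar>) + t * \<bar>a\<bar>" by (simp add: algebra_simps)
    moreover have "t * \<bar>a\<bar> \<ge> \<bar>a\<bar>" using t by (simp add: mult_le_cancel_right1)
    moreover have "t * d > 0" using t d by (intro mult_pos_pos) auto
    moreover have "t * (2 * \<bar>b\<bar>) \<ge> 2 * t * b" using t abs_ge_self[of b] by (simp add: mult_left_mono)
    ultimately show False using nonneg[of t] abs_ge_self[of a] unfolding d(1) by (simp add: power2_eq_square mult.assoc)
  qed
  show ?thesis
  proof (cases "c = 0")
    case True
    have "b = 0"
    proof (rule ccontr)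
      assume "b \<noteq> 0"
      then show False using nonneg[of "- (a + 1) / (2 * b)"] True by (simp add: field_simps)
    qed
    then show ?thesis using True by simp
  next
    case False
    then have "c > 0" using \<open>c \<ge> 0\<close> by simp
    then show ?thesis using nonneg[of "- b / c"] by (simp add: field_simps power2_eq_square)
  qed
qed

text \<open>
  Elements of the function spaces are functions, not classes modulo null sets, so the inner product is
  only semidefinite and limits are determined up to elements of norm zero.  The carrier is a set because
  the spaces depend on parameters.
\<close>
locale semi_inner =
  fixes X :: "'a::real_vector set" and ip :: "'a \<Rightarrow> 'a \<Rightarrow> real"
  assumes subspace: "subspace X"
    and ip_add: "\<And>x y z. x \<in> X \<Longrightarrow> y \<in> X \<Longrightarrow> z \<in> X \<Longrightarrow> ip (x + y) z = ip x z + ip y z"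
    and ip_scale: "\<And>c x y. x \<in> X \<Longrightarrow> y \<in> X \<Longrightarrow> ip (c *\<^sub>R x) y = c * ip x y"
    and ip_sym: "\<And>x y. x \<in> X \<Longrightarrow> y \<in> X \<Longrightarrow> ip x y = ip y x"
    and ip_pos: "\<And>x. x \<in> X \<Longrightarrow> 0 \<le> ip x x"
begin

definition nm :: "'a \<Rightarrow> real" where "nm x = sqrt (ip x x)"

lemma closed [simp, intro]:
  "x \<in> X \<Longrightarrow> y \<in> X \<Longrightarrow> x + y \<in> X" "x \<in> X \<Longrightarrow> y \<in> X \<Longrightarrow> x - y \<in> X"
  "x \<in> X \<Longrightarrow> c *\<^sub>R x \<in> X" "0 \<in> X" "x \<in> X \<Longrightarrow> - x \<in> X"
  using subspace by (auto simp: subspace_add subspace_diff subspace_scale subspace_0 subspace_neg)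

lemma ip_diff: "x \<in> X \<Longrightarrow> y \<in> X \<Longrightarrow> z \<in> X \<Longrightarrow> ip (x - y) z = ip x z - ip y z"
  using ip_add[of "x - y" y z] by simp

lemma ip_right:
  assumes "x \<in> X" "y \<in> X" "z \<in> X"
  shows "ip z (x + y) = ip z x + ip z y" "ip z (x - y) = ip z x - ip z y"
    "ip z (c *\<^sub>R x) = c * ip z x"
  using assms by (simp_all add: ip_sym[of z] ip_add ip_diff ip_scale)

lemma nm_nonneg: "x \<in> X \<Longrightarrow> 0 \<le> nm x"
  by (simp add: nm_def ip_pos)

lemma nm_sq: "x \<in> X \<Longrightarrow> (nm x)\<^sup>2 = ip x x"
  by (simp add: nm_def ip_pos)

lemma nm_scale: "x \<in> X \<Longrightarrow> nm (c *\<^sub>R x) = \<bar>c\<bar> * nm x"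
  by (simp add: nm_def ip_scale ip_right real_sqrt_mult flip: mult.assoc)

lemma nm_minus: "x \<in> X \<Longrightarrow> y \<in> X \<Longrightarrow> nm (x - y) = nm (y - x)"
  using nm_scale[of "x - y" "- 1"] by simp

lemma Cauchy_Schwarz:
  assumes x: "x \<in> X" and y: "y \<in> X"
  shows "\<bar>ip x y\<bar> \<le> nm x * nm y"
proof -
  have "(ip x y)\<^sup>2 \<le> ip x x * ip y y"
  proof (rule nonneg_quadratic_discriminant)
    fix t
    have "0 \<le> ip (x + t *\<^sub>R y) (x + t *\<^sub>R y)" using x y by (intro ip_pos) auto
    also have "\<dots> = ip x x + 2 * t * ip x y + t\<^sup>2 * ip y y"
      using x y by (simp add: ip_add ip_right ip_scale ip_sym[of y x] power2_eq_square algebra_simps)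
    finally show "0 \<le> \<dots>" .
  qed
  then have "sqrt ((ip x y)\<^sup>2) \<le> sqrt (ip x x * ip y y)" by (rule real_sqrt_le_mono)
  then show ?thesis by (simp add: nm_def real_sqrt_mult)
qed

lemma nm_triangle:
  assumes x: "x \<in> X" and y: "y \<in> X"
  shows "nm (x + y) \<le> nm x + nm y"
proof (rule power2_le_imp_le)
  have "(nm (x + y))\<^sup>2 = ip x x + 2 * ip x y + ip y y"
    using x y by (simp add: nm_sq ip_add ip_right ip_sym[of y x])
  also have "\<dots> \<le> (nm x + nm y)\<^sup>2"
    using Cauchy_Schwarz[OF x y] x y by (simp add: power2_sum nm_sq)
  finally show "(nm (x + y))\<^sup>2 \<le> (nm x + nm y)\<^sup>2" .
qed (use x y nm_nonneg in auto)

end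

locale semi_hilbert = semi_inner +
  assumes complete: "\<And>s. (\<And>n. s n \<in> X) \<Longrightarrow>
      (\<And>e. e > 0 \<Longrightarrow> \<exists>N. \<forall>m\<ge>N. \<forall>n\<ge>N. nm (s m - s n) < e) \<Longrightarrow>
      \<exists>x\<in>X. (\<lambda>n. nm (s n - x)) \<longlonglongrightarrow> 0"
begin

lemma complete_nm:
  assumes "\<And>n. s n \<in> X" "\<And>e. e > 0 \<Longrightarrow> \<exists>N. \<forall>m\<ge>N. \<forall>n\<ge>N. nm (s m - s n) < e"
  obtains x where "x \<in> X" "(\<lambda>n. nm (s n - x)) \<longlonglongrightarrow> 0"
  using complete[of s] assms by blast

definition bounded_functional :: "('a \<Rightarrow> real) \<Rightarrow> bool" where
  "bounded_functional l \<longleftrightarrow>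
     (\<forall>x\<in>X. \<forall>y\<in>X. l (x + y) = l x + l y) \<and> (\<forall>c. \<forall>x\<in>X. l (c *\<^sub>R x) = c * l x) \<and>
     (\<exists>M. \<forall>x\<in>X. \<bar>l x\<bar> \<le> M * nm x)"

lemma bounded_functionalI:
  assumes "\<And>x y. x \<in> X \<Longrightarrow> y \<in> X \<Longrightarrow> l (x + y) = l x + l y"
    "\<And>c x. x \<in> X \<Longrightarrow> l (c *\<^sub>R x) = c * l x" "\<And>x. x \<in> X \<Longrightarrow> \<bar>l x\<bar> \<le> M * nm x"
  shows "bounded_functional l"
  using assms unfolding bounded_functional_def by blast

lemma bounded_functionalD:
  assumes "bounded_functional l" "x \<in> X" "y \<in> X"
  shows "l (x + y) = l x + l y" "l (c *\<^sub>R x) = c * l x" "l (x - y) = l x - l y"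
proof -
  show *: "l (x + y) = l x + l y" "l (c *\<^sub>R x) = c * l x"
    using assms unfolding bounded_functional_def by auto
  have "l (x - y + y) = l (x - y) + l y"
    using assms unfolding bounded_functional_def by (meson closed(2))
  then show "l (x - y) = l x - l y" by simp
qed

lemma bounded_functional_bound:
  assumes "bounded_functional l"
  obtains M where "M \<ge> 0" "\<And>x. x \<in> X \<Longrightarrow> \<bar>l x\<bar> \<le> M * nm x"
proof -
  obtain M where M: "\<And>x. x \<in> X \<Longrightarrow> \<bar>l x\<bar> \<le> M * nm x"
    using assms unfolding bounded_functional_def by blast
  have "\<bar>l x\<bar> \<le> \<bar>M\<bar> * nm x" if "x \<in> X" for x
    using M[OF that] mult_right_mono[OF abs_ge_self[of M] nm_nonneg[OF that]] by linarith
  then show ?thesis using that[of "\<bar>M\<bar>"] by simp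
qed

lemma bounded_functional_tendsto:
  assumes l: "bounded_functional l" and s: "\<And>n. s n \<in> X" "x \<in> X" "(\<lambda>n. nm (s n - x)) \<longlonglongrightarrow> 0"
  shows "(\<lambda>n. l (s n)) \<longlonglongrightarrow> l x"
proof -
  obtain M where M: "M \<ge> 0" "\<And>x. x \<in> X \<Longrightarrow> \<bar>l x\<bar> \<le> M * nm x"
    using bounded_functional_bound[OF l] by blast
  have "(\<lambda>n. l (s n) - l x) \<longlonglongrightarrow> 0"
  proof (rule Lim_null_comparison)
    show "\<forall>\<^sub>F n in sequentially. norm (l (s n) - l x) \<le> M * nm (s n - x)"
      using M(2)[of "s _ - x"] s bounded_functionalD(3)[OF l] by (auto intro!: always_eventually)
    show "(\<lambda>n. M * nm (s n - x)) \<longlonglongrightarrow> 0" using tendsto_mult_right_zero[OF s(3)] .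
  qed
  then show ?thesis by (simp add: LIM_zero_iff)
qed

lemma bounded_functional_ip: "y \<in> X \<Longrightarrow> bounded_functional (\<lambda>x. ip x y)"
  by (rule bounded_functionalI[where M = "nm y"])
     (use Cauchy_Schwarz in \<open>auto simp: ip_add ip_scale mult.commute\<close>)

lemma bounded_functional_lincomb:
  assumes "bounded_functional f" "bounded_functional g"
  shows "bounded_functional (\<lambda>x. f x + c * g x)"
proof -
  obtain M where M: "\<And>x. x \<in> X \<Longrightarrow> \<bar>f x\<bar> \<le> M * nm x" using bounded_functional_bound assms(1) by metis
  obtain N where N: "\<And>x. x \<in> X \<Longrightarrow> \<bar>g x\<bar> \<le> N * nm x" using bounded_functional_bound assms(2) by metis
  show ?thesis
  proof (rule bounded_functionalI[where M = "M + \<bar>c\<bar> * N"])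
    fix x assume x: "x \<in> X"
    have "\<bar>f x + c * g x\<bar> \<le> \<bar>f x\<bar> + \<bar>c\<bar> * \<bar>g x\<bar>" by (metis abs_mult abs_triangle_ineq)
    also have "\<dots> \<le> M * nm x + \<bar>c\<bar> * (N * nm x)" using M N x by (intro add_mono mult_left_mono) auto
    finally show "\<bar>f x + c * g x\<bar> \<le> (M + \<bar>c\<bar> * N) * nm x" by (simp add: algebra_simps)
  qed (use bounded_functionalD[OF assms(1)] bounded_functionalD[OF assms(2)] in \<open>auto simp: algebra_simps\<close>)
qed

lemma bounded_functional_sum:
  assumes "finite I" "\<And>i. i \<in> I \<Longrightarrow> bounded_functional (f i)"
  shows "bounded_functional (\<lambda>x. \<Sum>i\<in>I. f i x)"
  using assms
proof (induction I rule: finite_induct)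
  case empty
  show ?case by (rule bounded_functionalI[where M = 0]) auto
next
  case (insert i I)
  then show ?case using bounded_functional_lincomb[of "f i" "\<lambda>x. \<Sum>i\<in>I. f i x" 1] by simp
qed

text \<open>
  A minimizing sequence of \<open>\<langle>x, x\<rangle> - 2 l x\<close> is Cauchy by the parallelogram law; the first variation at its
  limit gives the representation.
\<close>
theorem Riesz:
  assumes l: "bounded_functional l"
  obtains z where "z \<in> X" "\<And>x. x \<in> X \<Longrightarrow> ip x z = l x"
proof -
  obtain M where M: "M \<ge> 0" "\<And>x. x \<in> X \<Longrightarrow> \<bar>l x\<bar> \<le> M * nm x"
    using bounded_functional_bound[OF l] by blast
  define J where "J x = ip x x - 2 * l x" for x
  have J_lower: "- (M\<^sup>2) \<le> J x" if x: "x \<in> X" for x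
  proof -
    have "0 \<le> (nm x - M)\<^sup>2" by simp
    also have "\<dots> = ip x x - 2 * (M * nm x) + M\<^sup>2" using x by (simp add: power2_diff nm_sq)
    finally show ?thesis unfolding J_def using M(2)[OF x] by linarith
  qed
  define d where "d = Inf (J ` X)"
  have bdd: "bdd_below (J ` X)" using J_lower by (auto intro!: bdd_belowI)
  have d_le: "d \<le> J x" if "x \<in> X" for x
    unfolding d_def using bdd that by (intro cInf_lower) auto
  have "\<exists>x\<in>X. J x < d + 1 / real (Suc n)" for n
  proof -
    have "J ` X \<noteq> {}" using closed(4) by blast
    then have "\<exists>y\<in>J ` X. y < d + 1 / real (Suc n)"
      unfolding d_def using bdd by (subst cInf_less_iff[symmetric]) auto
    then show ?thesis by auto
  qed
  then obtain s where s: "\<And>n. s n \<in> X" "\<And>n. J (s n) < d + 1 / real (Suc n)" by metis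
  have par: "ip (x - y) (x - y) \<le> 2 * J x + 2 * J y - 4 * d" if "x \<in> X" "y \<in> X" for x y
  proof -
    have "J ((1/2) *\<^sub>R (x + y)) \<ge> d" using that by (intro d_le) auto
    moreover have "4 * J ((1/2) *\<^sub>R (x + y)) = 2 * J x + 2 * J y - ip (x - y) (x - y)"
      unfolding J_def using that l
      by (simp add: bounded_functionalD ip_add ip_right ip_scale ip_diff ip_sym[of y x] algebra_simps)
    ultimately show ?thesis by linarith
  qed
  obtain z where z: "z \<in> X" "(\<lambda>n. nm (s n - z)) \<longlonglongrightarrow> 0"
  proof (rule complete_nm[of s])
    show "\<exists>N. \<forall>m\<ge>N. \<forall>n\<ge>N. nm (s m - s n) < e" if "e > 0" for e
    proof -
      obtain N :: nat where N: "4 / e\<^sup>2 < real N" using reals_Archimedean2 by blast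
      have "nm (s m - s n) < e" if mn: "m \<ge> N" "n \<ge> N" for m n
      proof (rule power2_less_imp_less)
        have le: "1 / real (Suc i) < e\<^sup>2 / 4" if "i \<ge> N" for i
        proof -
          have "4 / e\<^sup>2 < real (Suc i)" using N that by (auto intro: less_trans order.strict_trans2)
          then show ?thesis using \<open>e > 0\<close> by (simp add: field_simps)
        qed
        have "(nm (s m - s n))\<^sup>2 \<le> 2 * J (s m) + 2 * J (s n) - 4 * d"
          using par[OF s(1) s(1)] s(1) by (simp add: nm_sq)
        also have "\<dots> < e\<^sup>2" using s(2)[of m] s(2)[of n] le[OF mn(1)] le[OF mn(2)] by linarith
        finally show "(nm (s m - s n))\<^sup>2 < e\<^sup>2" .
      qed (use \<open>e > 0\<close> in auto)
      then show ?thesis by blast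
    qed
  qed (use s in auto)
  have "ip x z = l x" if x: "x \<in> X" for x
  proof -
    have key: "0 \<le> 2 * t * (ip z x - l x) + t\<^sup>2 * ip x x" for t
    proof -
      have "- (1 / real (Suc n)) \<le> 2 * t * (ip (s n) x - l x) + t\<^sup>2 * ip x x" for n
      proof -
        have "d \<le> J (s n + t *\<^sub>R x)" using s x by (intro d_le) auto
        also have "\<dots> = J (s n) + 2 * t * (ip (s n) x - l x) + t\<^sup>2 * ip x x"
          unfolding J_def using s(1)[of n] x l
          by (simp add: bounded_functionalD ip_add ip_right ip_scale ip_sym[of x "s n"]
              power2_eq_square algebra_simps)
        finally show ?thesis using s(2)[of n] by linarith
      qed
      moreover have "(\<lambda>n. 2 * t * (ip (s n) x - l x) + t\<^sup>2 * ip x x)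
          \<longlonglongrightarrow> 2 * t * (ip z x - l x) + t\<^sup>2 * ip x x"
        using bounded_functional_tendsto[OF bounded_functional_ip[OF x] s(1) z]
        by (intro tendsto_intros)
      moreover have "(\<lambda>n. - (1 / real (Suc n))) \<longlonglongrightarrow> - 0"
        using LIMSEQ_Suc[OF lim_1_over_n] by (intro tendsto_minus) simp
      ultimately show ?thesis by (intro LIMSEQ_le[of _ "0::real"]) auto
    qed
    have "(ip z x - l x)\<^sup>2 \<le> 0 * ip x x"
      using key by (intro nonneg_quadratic_discriminant) simp
    then show ?thesis using ip_sym[OF x z(1)] by simp
  qed
  then show ?thesis using z(1) that by blast
qed

text \<open>The form in which completeness is used for contraction iterations.\<close>
lemma geometric_converges:
  assumes s: "\<And>n. s n \<in> X" and g: "\<And>n. nm (s (Suc n) - s n) \<le> c / 2 ^ n"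
  obtains x where "x \<in> X" "(\<lambda>n. nm (s n - x)) \<longlonglongrightarrow> 0"
proof (rule complete_nm[OF s])
  have c: "c \<ge> 0" using g[of 0] nm_nonneg[of "s (Suc 0) - s 0"] s by (auto intro: order_trans)
  have far: "nm (s (n + p) - s n) \<le> 2 * c / 2 ^ n - 2 * c / 2 ^ (n + p)" for n p
  proof (induction p)
    case 0
    then show ?case using ip_scale[of 0 0 0] by (simp add: nm_def)
  next
    case (Suc p)
    have "nm (s (n + Suc p) - s n) = nm ((s (Suc (n + p)) - s (n + p)) + (s (n + p) - s n))" by simp
    also have "\<dots> \<le> nm (s (Suc (n + p)) - s (n + p)) + nm (s (n + p) - s n)"
      using s by (intro nm_triangle) auto
    also have "\<dots> \<le> c / 2 ^ (n + p) + (2 * c / 2 ^ n - 2 * c / 2 ^ (n + p))"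
      using g Suc by (intro add_mono) auto
    also have "\<dots> = 2 * c / 2 ^ n - 2 * c / 2 ^ (n + Suc p)" by simp
    finally show ?case .
  qed
  fix e :: real assume "e > 0"
  have "(\<lambda>n. 4 * c * (1 / 2) ^ n) \<longlonglongrightarrow> 4 * c * 0" by (intro tendsto_intros) auto
  then have "\<forall>\<^sub>F n in sequentially. 4 * c * (1 / 2) ^ n < e"
    using \<open>e > 0\<close> by (intro order_tendstoD) auto
  then obtain N where N: "4 * c / 2 ^ N < e"
    by (auto simp: eventually_sequentially power_one_over divide_simps)
  have near: "nm (s m - s N) \<le> 2 * c / 2 ^ N" if "m \<ge> N" for m
  proof -
    have "0 \<le> 2 * c / 2 ^ m" using c by simp
    then show ?thesis using far[of N "m - N"] that by simp
  qed
  have "nm (s m - s n) < e" if "m \<ge> N" "n \<ge> N" for m n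
  proof -
    have "nm (s m - s n) = nm ((s m - s N) + (s N - s n))" by simp
    also have "\<dots> \<le> nm (s m - s N) + nm (s N - s n)" using s by (intro nm_triangle) auto
    also have "\<dots> \<le> 2 * c / 2 ^ N + 2 * c / 2 ^ N"
      using near that nm_minus[of "s N" "s n"] s by (intro add_mono) auto
    finally show ?thesis using N by simp
  qed
  then show "\<exists>N. \<forall>m\<ge>N. \<forall>n\<ge>N. nm (s m - s n) < e" by blast
qed (use that in auto)

end

text \<open>
  The set \<open>D\<close> is a dense set of nice elements; it is not a subspace in the application, since the graph of the
  pointwise gradient is one only up to null sets.  The estimate is assumed on \<open>D\<close> for the
  adjoint problem, in which the second argument is the unknown, and uniformly along the path from the inner
  product to the full form.
\<close>
locale perturbed_form = semi_hilbert +
  fixes K :: "'a \<Rightarrow> 'a \<Rightarrow> real" and k C :: real and D :: "'a set"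
  assumes K_add: "\<And>x y z. x \<in> X \<Longrightarrow> y \<in> X \<Longrightarrow> z \<in> X \<Longrightarrow> K (x + y) z = K x z + K y z"
    and K_scale: "\<And>c x y. x \<in> X \<Longrightarrow> y \<in> X \<Longrightarrow> K (c *\<^sub>R x) y = c * K x y"
    and K_add': "\<And>x y z. x \<in> X \<Longrightarrow> y \<in> X \<Longrightarrow> z \<in> X \<Longrightarrow> K z (x + y) = K z x + K z y"
    and K_scale': "\<And>c x y. x \<in> X \<Longrightarrow> y \<in> X \<Longrightarrow> K x (c *\<^sub>R y) = c * K x y"
    and K_bound: "\<And>x y. x \<in> X \<Longrightarrow> y \<in> X \<Longrightarrow> \<bar>K x y\<bar> \<le> k * nm x * nm y"
    and D_sub: "D \<subseteq> X"
    and D_dense: "\<And>x e. x \<in> X \<Longrightarrow> e > 0 \<Longrightarrow> \<exists>d\<in>D. nm (x - d) < e"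
    and apriori: "\<And>t m w. 0 \<le> t \<Longrightarrow> t \<le> 1 \<Longrightarrow> m > 0 \<Longrightarrow> w \<in> D \<Longrightarrow>
      (\<And>u. u \<in> D \<Longrightarrow> \<bar>ip u w + t * K u w\<bar> \<le> m * nm u) \<Longrightarrow> nm w \<le> C * m"
    and k_nonneg: "k \<ge> 0" and C_nonneg: "C \<ge> 0"
begin

definition B :: "real \<Rightarrow> 'a \<Rightarrow> 'a \<Rightarrow> real" where "B t u w = ip u w + t * K u w"

lemma K_diff': "x \<in> X \<Longrightarrow> y \<in> X \<Longrightarrow> z \<in> X \<Longrightarrow> K z (x - y) = K z x - K z y"
  using K_add'[of "x - y" y z] by simp

lemma bounded_functional_K: "y \<in> X \<Longrightarrow> bounded_functional (\<lambda>x. K x y)"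
  by (rule bounded_functionalI[where M = "k * nm y"])
     (use K_bound in \<open>auto simp: K_add K_scale mult_ac\<close>)

lemma bounded_functional_K': "y \<in> X \<Longrightarrow> bounded_functional (K y)"
  by (rule bounded_functionalI[where M = "k * nm y"])
     (use K_bound in \<open>auto simp: K_add' K_scale'\<close>)

lemma bounded_functional_ip': "y \<in> X \<Longrightarrow> bounded_functional (ip y)"
  by (rule bounded_functionalI[where M = "nm y"])
     (use Cauchy_Schwarz in \<open>auto simp: ip_right\<close>)

lemma bounded_functional_B: "y \<in> X \<Longrightarrow> bounded_functional (\<lambda>x. B t x y)"
  unfolding B_def by (intro bounded_functional_lincomb bounded_functional_ip bounded_functional_K)

lemma bounded_functional_B': "y \<in> X \<Longrightarrow> bounded_functional (B t y)"
  unfolding B_def by (intro bounded_functional_lincomb bounded_functional_ip' bounded_functional_K')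

lemma B_bound:
  assumes "0 \<le> t" "t \<le> 1" "x \<in> X" "y \<in> X"
  shows "\<bar>B t x y\<bar> \<le> (1 + k) * nm x * nm y"
proof -
  have "\<bar>B t x y\<bar> \<le> \<bar>ip x y\<bar> + \<bar>t\<bar> * \<bar>K x y\<bar>" unfolding B_def by (metis abs_mult abs_triangle_ineq)
  also have "\<dots> \<le> nm x * nm y + 1 * (k * nm x * nm y)"
    using assms Cauchy_Schwarz K_bound by (intro add_mono mult_mono) auto
  finally show ?thesis by (simp add: algebra_simps)
qed

text \<open>
  Both sides of the estimate are continuous in \<open>w\<close>, so it extends from \<open>D\<close>.  The number \<open>c\<close> collects
  the loss when \<open>w\<close> is replaced by an element of \<open>D\<close> at distance \<open>e / c\<close>.
\<close>
lemma apriori_X: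
  assumes t: "0 \<le> t" "t \<le> 1" and m: "m \<ge> 0" and w: "w \<in> X"
    and le: "\<And>u. u \<in> X \<Longrightarrow> \<bar>B t u w\<bar> \<le> m * nm u"
  shows "nm w \<le> C * m"
proof (rule field_le_epsilon)
  fix e :: real assume e: "e > 0"
  define c where "c = C * (1 + k) + 1"
  have c: "c > 0" using C_nonneg k_nonneg by (simp add: c_def add_nonneg_pos)
  obtain d where d: "d \<in> D" "nm (w - d) < e / c" using D_dense[OF w, of "e / c"] e c by auto
  have dX: "d \<in> X" using d D_sub by auto
  have "nm d \<le> C * (m + (1 + k) * (e / c))"
  proof (rule apriori[OF t])
    show "m + (1 + k) * (e / c) > 0" using m e c k_nonneg by (smt (verit) mult_pos_pos divide_pos_pos)
    fix u assume "u \<in> D"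
    then have u: "u \<in> X" using D_sub by auto
    have "B t u d = B t u w - B t u (w - d)"
      using bounded_functionalD(3)[OF bounded_functional_B'[OF u], of w d t] w dX by simp
    then have "\<bar>B t u d\<bar> \<le> \<bar>B t u w\<bar> + \<bar>B t u (w - d)\<bar>" by linarith
    also have "\<dots> \<le> m * nm u + (1 + k) * nm u * nm (w - d)"
      using le B_bound[OF t] u w dX by (intro add_mono) auto
    also have "\<dots> \<le> m * nm u + (1 + k) * nm u * (e / c)"
      using d(2) nm_nonneg[OF u] k_nonneg by (intro add_left_mono mult_left_mono) auto
    finally show "\<bar>ip u d + t * K u d\<bar> \<le> (m + (1 + k) * (e / c)) * nm u"
      by (simp add: B_def algebra_simps add_divide_distrib)
  qed fact
  moreover have "nm w \<le> nm (w - d) + nm d" using nm_triangle[of "w - d" d] w dX by simp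
  ultimately have "nm w \<le> e / c + C * (m + (1 + k) * (e / c))" using d(2) by linarith
  also have "\<dots> = C * m + c * (e / c)" by (simp add: c_def algebra_simps add_divide_distrib)
  finally show "nm w \<le> C * m + e" using c by simp
qed

text \<open>The unknown is the second argument of \<open>B\<close>: this is the adjoint problem.\<close>
definition solvable :: "real \<Rightarrow> bool" where
  "solvable t \<longleftrightarrow> (\<forall>l. bounded_functional l \<longrightarrow> (\<exists>w\<in>X. \<forall>u\<in>X. B t u w = l u))"

text \<open>
  The problem at \<open>t\<close> is a fixed point problem for the solution operator at \<open>s\<close>, whose norm is at most \<open>C\<close>;
  it is a contraction as soon as \<open>C |t - s| k \<le> 1/2\<close>, a condition that does not involve \<open>s\<close>.
\<close>
lemma solvable_step:
  assumes s: "0 \<le> s" "s \<le> 1" and sol: "solvable s" and close: "C * (\<bar>t - s\<bar> * k) \<le> 1 / 2"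
  shows "solvable t"
  unfolding solvable_def
proof (intro allI impI)
  fix l assume l: "bounded_functional l"
  have "\<exists>w'\<in>X. \<forall>u\<in>X. B s u w' = l u + (s - t) * K u w" if "w \<in> X" for w
    using sol bounded_functional_lincomb[OF l bounded_functional_K[OF that]]
    unfolding solvable_def by blast
  then obtain step where nxt: "\<And>w. w \<in> X \<Longrightarrow> step w \<in> X"
     "\<And>w u. w \<in> X \<Longrightarrow> u \<in> X \<Longrightarrow> B s u (step w) = l u + (s - t) * K u w" by metis
  define w where "w n = (step ^^ n) 0" for n
  have w: "w n \<in> X" for n by (induction n) (auto simp: w_def nxt(1))
  have wS: "B s u (w (Suc n)) = l u + (s - t) * K u (w n)" if "u \<in> X" for u n
    using nxt(2)[OF w that, of n] by (simp add: w_def)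
  have contr: "nm (w (Suc (Suc n)) - w (Suc n)) \<le> 1 / 2 * nm (w (Suc n) - w n)" for n
  proof -
    have "nm (w (Suc (Suc n)) - w (Suc n)) \<le> C * (\<bar>t - s\<bar> * k * nm (w (Suc n) - w n))"
    proof (rule apriori_X[OF s])
      fix u assume u: "u \<in> X"
      have "B s u (w (Suc (Suc n)) - w (Suc n)) = (s - t) * K u (w (Suc n) - w n)"
        using bounded_functionalD(3)[OF bounded_functional_B'[OF u] w w] wS[OF u] u w
        by (simp add: K_diff' right_diff_distrib)
      then have "\<bar>B s u (w (Suc (Suc n)) - w (Suc n))\<bar> = \<bar>t - s\<bar> * \<bar>K u (w (Suc n) - w n)\<bar>"
        by (simp add: abs_mult abs_minus_commute)
      also have "\<dots> \<le> \<bar>t - s\<bar> * (k * nm u * nm (w (Suc n) - w n))"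
        using K_bound u w by (intro mult_left_mono) auto
      finally show "\<bar>B s u (w (Suc (Suc n)) - w (Suc n))\<bar> \<le> \<bar>t - s\<bar> * k * nm (w (Suc n) - w n) * nm u"
        by (simp add: mult_ac)
    qed (use w k_nonneg nm_nonneg in auto)
    also have "\<dots> = C * (\<bar>t - s\<bar> * k) * nm (w (Suc n) - w n)" by simp
    also have "\<dots> \<le> 1 / 2 * nm (w (Suc n) - w n)"
      using close nm_nonneg w by (intro mult_right_mono) auto
    finally show ?thesis .
  qed
  have "nm (w (Suc n) - w n) \<le> nm (w 1 - w 0) / 2 ^ n" for n
  proof (induction n)
    case (Suc n)
    show ?case using contr[of n] Suc by simp
  qed simp
  then obtain z where z: "z \<in> X" "(\<lambda>n. nm (w n - z)) \<longlonglongrightarrow> 0"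
    using geometric_converges[of w, OF w] by metis
  have "B t u z = l u" if u: "u \<in> X" for u
  proof -
    have "(\<lambda>n. B s u (w (Suc n))) \<longlonglongrightarrow> B s u z"
      using bounded_functional_tendsto[OF bounded_functional_B'[OF u] w z] by (rule LIMSEQ_Suc)
    moreover have "(\<lambda>n. l u + (s - t) * K u (w n)) \<longlonglongrightarrow> l u + (s - t) * K u z"
      using bounded_functional_tendsto[OF bounded_functional_K'[OF u] w z] by (intro tendsto_intros)
    ultimately have "B s u z = l u + (s - t) * K u z"
      using wS[OF u] LIMSEQ_unique by (simp add: fun_eq_iff) 
    then show ?thesis by (simp add: B_def algebra_simps)
  qed
  then show "\<exists>w\<in>X. \<forall>u\<in>X. B t u w = l u" using z(1) by blast
qed

lemma solvable_1: "solvable 1"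
proof -
  obtain n :: nat where n: "2 * C * k < real n" using reals_Archimedean2 by blast
  then have n0: "real n > 0" using C_nonneg k_nonneg by (meson mult_nonneg_nonneg order.strict_trans1 zero_le_numeral)
  have "i \<le> n \<Longrightarrow> solvable (real i / real n)" for i
  proof (induction i)
    case 0
    show ?case unfolding solvable_def
    proof (intro allI impI)
      fix l assume "bounded_functional l"
      from Riesz[OF this] obtain z where "z \<in> X" "\<And>x. x \<in> X \<Longrightarrow> ip x z = l x" by blast
      then show "\<exists>w\<in>X. \<forall>u\<in>X. B (real 0 / real n) u w = l u" by (auto simp: B_def)
    qed
  next
    case (Suc i)
    show ?case
    proof (rule solvable_step)
      have "real (Suc i) / real n - real i / real n = 1 / real n" by (simp add: diff_divide_distrib[symmetric])
      then show "C * (\<bar>real (Suc i) / real n - real i / real n\<bar> * k) \<le> 1 / 2"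
        using n n0 by (simp add: field_simps)
    qed (use Suc n0 in auto)
  qed
  from this[of n] n0 show ?thesis by simp
qed

text \<open>
  Let \<open>S z\<close> solve the adjoint problem with datum \<open>\<langle>\<cdot>, z\<rangle>\<close>.  Up to elements of norm zero \<open>S\<close> is linear and bounded, so
  \<open>l \<circ> S\<close> is represented by some \<open>u\<close>.  For given \<open>w\<close>, choosing \<open>z\<close> with \<open>B(\<cdot>, w) = \<langle>\<cdot>, z\<rangle>\<close> makes \<open>S z\<close> and \<open>w\<close> agree,
  hence \<open>B(u, w) = \<langle>u, z\<rangle> = l (S z) = l w\<close>.
\<close>
theorem exists_solution:
  assumes l: "bounded_functional l"
  obtains u where "u \<in> X" "\<And>w. w \<in> X \<Longrightarrow> ip u w + K u w = l w"
proof -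
  have null: "l w = 0" if w: "w \<in> X" "nm w = 0" for w
  proof -
    obtain M where "\<And>x. x \<in> X \<Longrightarrow> \<bar>l x\<bar> \<le> M * nm x" using bounded_functional_bound[OF l] by metis
    from this[OF w(1)] w(2) show ?thesis by simp
  qed
  have inj: "nm w = 0" if "w \<in> X" "\<And>u. u \<in> X \<Longrightarrow> B 1 u w = 0" for w
    using apriori_X[of 1 0 w] that nm_nonneg[of w] by auto
  have "\<exists>w\<in>X. \<forall>u\<in>X. B 1 u w = ip u z" if "z \<in> X" for z
    using solvable_1 bounded_functional_ip[OF that] unfolding solvable_def by blast
  then obtain S where S: "\<And>z. z \<in> X \<Longrightarrow> S z \<in> X" "\<And>z u. z \<in> X \<Longrightarrow> u \<in> X \<Longrightarrow> B 1 u (S z) = ip u z"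
    by metis
  obtain M where M: "M \<ge> 0" "\<And>x. x \<in> X \<Longrightarrow> \<bar>l x\<bar> \<le> M * nm x"
    using bounded_functional_bound[OF l] by blast
  note BD = bounded_functionalD[OF bounded_functional_B'[of _ 1]]
  have "bounded_functional (\<lambda>z. l (S z))"
  proof (rule bounded_functionalI[where M = "M * C"])
    fix x y assume xy: "x \<in> X" "y \<in> X"
    have "l (S (x + y) - (S x + S y)) = 0"
      using xy S by (intro null inj) (simp_all add: BD ip_right)
    then show "l (S (x + y)) = l (S x) + l (S y)"
      using xy S(1) bounded_functionalD[OF l] by simp
  next
    fix c x assume x: "x \<in> X"
    have "l (S (c *\<^sub>R x) - c *\<^sub>R S x) = 0"
      using x S by (intro null inj) (simp_all add: BD(2)[of _ _ "0"] BD(3) ip_right(3)[of _ 0])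
    then show "l (S (c *\<^sub>R x)) = c * l (S x)"
      using x S(1) bounded_functionalD(3)[OF l] bounded_functionalD(2)[OF l _ closed(4)] by simp
  next
    fix x assume x: "x \<in> X"
    have "nm (S x) \<le> C * nm x"
      using S x Cauchy_Schwarz nm_nonneg by (intro apriori_X[of 1]) (auto simp: mult.commute)
    then show "\<bar>l (S x)\<bar> \<le> M * C * nm x"
      using M(2)[OF S(1)[OF x]] mult_left_mono[OF _ M(1)] by fastforce
  qed
  from Riesz[OF this] obtain u where u: "u \<in> X" "\<And>z. z \<in> X \<Longrightarrow> ip z u = l (S z)" by blast
  have "ip u w + K u w = l w" if w: "w \<in> X" for w
  proof -
    obtain z where z: "z \<in> X" "\<And>x. x \<in> X \<Longrightarrow> ip x z = B 1 x w"
      using Riesz[OF bounded_functional_B[OF w]] by blast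
    have "l (S z - w) = 0" using z w S by (intro null inj) (simp_all add: BD)
    then have "l (S z) = l w" using z w S(1) bounded_functionalD(3)[OF l] by simp
    moreover have "ip u w + K u w = ip u z" using z(2)[OF u(1)] by (simp add: B_def)
    ultimately show ?thesis using u z(1) ip_sym[OF u(1) z(1)] by simp
  qed
  with u(1) that show ?thesis by blast
qed

text \<open>If \<open>B(u, \<cdot>)\<close> vanishes, insert the solution \<open>w\<close> of the adjoint problem with datum \<open>\<langle>\<cdot>, u\<rangle>\<close>.\<close>
theorem unique_solution:
  assumes u: "u \<in> X" and eq: "\<And>w. w \<in> D \<Longrightarrow> ip u w + K u w = 0"
  shows "nm u = 0"
proof -
  have B0: "B 1 u w = 0" if w: "w \<in> X" for w
  proof -
    have "\<exists>d\<in>D. nm (w - d) < 1 / real (Suc n)" for n by (rule D_dense[OF w]) simp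
    then obtain d where d: "\<And>n. d n \<in> D" "\<And>n. nm (w - d n) < 1 / real (Suc n)" by metis
    have dX: "d n \<in> X" for n using d(1) D_sub by auto
    have "(\<lambda>n. nm (d n - w)) \<longlonglongrightarrow> 0"
    proof (rule Lim_null_comparison)
      show "(\<lambda>n. 1 / real (Suc n)) \<longlonglongrightarrow> 0" using LIMSEQ_Suc[OF lim_1_over_n] by simp
    qed (use d(2) nm_minus[OF w dX] nm_nonneg w dX in \<open>auto intro!: always_eventually less_imp_le\<close>)
    from bounded_functional_tendsto[OF bounded_functional_B'[OF u] dX w this, of 1]
    have "(\<lambda>n. B 1 u (d n)) \<longlonglongrightarrow> B 1 u w" .
    then show ?thesis using eq[OF d(1)] by (simp add: B_def LIMSEQ_const_iff)
  qed
  obtain w where "w \<in> X" "\<forall>x\<in>X. B 1 x w = ip x u"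
    using solvable_1 bounded_functional_ip[OF u] unfolding solvable_def by blast
  with B0 u show ?thesis by (auto simp: nm_def)
qed

end

section \<open>Square roots of positive semidefinite matrices\<close>

lemma symmetric_matrix_inner:
  fixes A :: "real ^ 'n ^ 'n"
  assumes "transpose A = A"
  shows "x \<bullet> (A *v y) = (A *v x) \<bullet> y"
  using dot_lmul_matrix[of x A y] assms by (metis vector_transpose_matrix)

lemma symmetric_matrixI:
  fixes A :: "real ^ 'n ^ 'n"
  assumes "\<And>x y. x \<bullet> (A *v y) = (A *v x) \<bullet> y"
  shows "transpose A = A"
proof -
  have "A $ i $ j = A $ j $ i" for i j
    using assms[of "axis i 1" "axis j 1"]
    by (simp add: inner_axis inner_axis' matrix_vector_mul_component inner_commute)
  then show ?thesis by (simp add: transpose_def vec_eq_iff)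
qed

text \<open>
  A maximizer \<open>x\<close> of the quadratic form on the unit sphere of \<open>V\<close> is an eigenvector: with \<open>c\<close> the maximum, the form
  \<open>p y = c (y \<bullet> y) - y \<bullet> Ay\<close> is nonnegative on \<open>V\<close> and vanishes at \<open>x\<close>, so its derivative at \<open>x\<close> vanishes on \<open>V\<close>.
\<close>
lemma eigenvector_in_invariant_subspace:
  fixes A :: "real ^ 'n ^ 'n"
  assumes sym: "transpose A = A" and V: "subspace V" "V \<noteq> {0}"
    and inv: "\<And>x. x \<in> V \<Longrightarrow> A *v x \<in> V"
  obtains x c where "x \<in> V" "norm x = 1" "A *v x = c *\<^sub>R x"
proof -
  obtain v where v: "v \<in> V" "v \<noteq> 0" using V subspace_0 by blast
  then have "v /\<^sub>R norm v \<in> V \<inter> sphere 0 1" using V by (simp add: subspace_scale)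
  then have ne: "V \<inter> sphere 0 1 \<noteq> {}" by blast
  have comp: "compact (V \<inter> sphere 0 1)"
    by (intro closed_Int_compact closed_subspace V compact_sphere)
  have cont: "continuous_on (V \<inter> sphere 0 1) (\<lambda>x. x \<bullet> (A *v x))"
    by (intro continuous_intros linear_continuous_on matrix_vector_mul_bounded_linear)
  obtain x where x: "x \<in> V" "norm x = 1"
      "\<And>y. y \<in> V \<inter> sphere 0 1 \<Longrightarrow> y \<bullet> (A *v y) \<le> x \<bullet> (A *v x)"
    using continuous_attains_sup[OF comp ne cont] by auto
  define c where "c = x \<bullet> (A *v x)"
  define p where "p y = c * (y \<bullet> y) - y \<bullet> (A *v y)" for y
  have p_nonneg: "0 \<le> p y" if y: "y \<in> V" for y
  proof (cases "y = 0")
    case False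
    have "(y /\<^sub>R norm y) \<bullet> (A *v (y /\<^sub>R norm y)) \<le> c"
      unfolding c_def using False y V by (intro x(3)) (simp add: subspace_scale)
    then have "y \<bullet> (A *v y) / (norm y)\<^sup>2 \<le> c"
      by (simp add: matrix_vector_mult_scaleR power2_eq_square divide_simps)
    then show ?thesis using False by (simp add: p_def dot_square_norm field_simps)
  qed (simp add: p_def)
  have "(c *\<^sub>R x - A *v x) \<bullet> y = 0" if y: "y \<in> V" for y
  proof -
    define a where "a = (c *\<^sub>R x - A *v x) \<bullet> y"
    have *: "p (x + t *\<^sub>R y) = 2 * t * a + t\<^sup>2 * p y" for t
    proof -
      have "x \<bullet> x = 1" using x(2) by (simp add: dot_square_norm)
      then show ?thesis unfolding p_def a_def
        by (simp add: c_def matrix_vector_right_distrib matrix_vector_mult_scaleR inner_left_distrib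
            inner_right_distrib inner_diff_left inner_commute[of y x] inner_commute[of y "A *v x"]
            symmetric_matrix_inner[OF sym, of x y] power2_eq_square algebra_simps)
    qed
    have key: "0 \<le> 2 * t * a + t\<^sup>2 * p y" for t
      using p_nonneg[of "x + t *\<^sub>R y"] *[of t] x(1) y V by (simp add: subspace_add subspace_scale)
    have "a\<^sup>2 \<le> 0 * p y" using key by (intro nonneg_quadratic_discriminant) simp
    then show ?thesis by (simp add: a_def)
  qed
  from this[of "c *\<^sub>R x - A *v x"] have "A *v x = c *\<^sub>R x"
    using x(1) inv V by (simp add: subspace_diff subspace_scale)
  with x that show ?thesis by blast
qed

text \<open>
  An orthonormal set of eigenvectors with the largest possible number of elements spans the space, since
  otherwise its orthogonal complement, which is invariant, contains one more eigenvector.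
\<close>
theorem symmetric_matrix_eigenbasis:
  fixes A :: "real ^ 'n ^ 'n"
  assumes sym: "transpose A = A"
  obtains S c where "finite S" "pairwise orthogonal S" "span S = UNIV"
    "\<And>x. x \<in> S \<Longrightarrow> norm x = 1" "\<And>x. x \<in> S \<Longrightarrow> A *v x = c x *\<^sub>R x"
proof -
  define good where "good S \<longleftrightarrow> pairwise orthogonal S \<and> (\<forall>x\<in>S. norm x = 1 \<and> (\<exists>c. A *v x = c *\<^sub>R x))"
    for S :: "(real ^ 'n) set"
  have good_card: "finite S \<and> card S \<le> DIM(real ^ 'n)" if "good S" for S
  proof (rule independent_bound, rule pairwise_orthogonal_independent)
    show "pairwise orthogonal S" "0 \<notin> S" using that by (auto simp: good_def)
  qed
  have "good {}" by (simp add: good_def)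
  then obtain S where S: "good S" "\<And>S'. good S' \<Longrightarrow> card S' \<le> card S"
    using ex_has_greatest_nat[of good "{}" card "Suc DIM(real ^ 'n)"] good_card
    by (metis less_Suc_eq_le)
  have "span S = UNIV"
  proof (rule ccontr)
    assume "span S \<noteq> UNIV"
    then have "dim S < DIM(real ^ 'n)"
      using dim_eq_full[of S] dim_subset_UNIV[of S] by (metis le_neq_implies_less)
    then obtain y where y: "y \<noteq> 0" "\<And>x. x \<in> span S \<Longrightarrow> orthogonal y x"
      using orthogonal_to_subspace_exists by blast
    define V where "V = {y. \<forall>x\<in>S. x \<bullet> y = 0}"
    have V: "subspace V" by (auto simp: V_def subspace_def inner_right_distrib)
    have "y \<in> V" using y(2) span_base by (fastforce simp: V_def orthogonal_def inner_commute)
    then have "V \<noteq> {0}" using y(1) by auto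
    moreover have "A *v v \<in> V" if "v \<in> V" for v
      using that S(1) by (force simp: V_def good_def symmetric_matrix_inner[OF sym])
    ultimately obtain x c where x: "x \<in> V" "norm x = 1" "A *v x = c *\<^sub>R x"
      using eigenvector_in_invariant_subspace[OF sym V] by metis
    have "good (insert x S)"
      using S(1) x by (auto simp: good_def pairwise_insert orthogonal_def V_def inner_commute)
    moreover have "x \<notin> S" using x by (force simp: V_def dot_square_norm)
    ultimately show False using S(2)[of "insert x S"] good_card[OF S(1)] by simp
  qed
  moreover obtain c where "\<And>x. x \<in> S \<Longrightarrow> A *v x = c x *\<^sub>R x"
    using S(1) unfolding good_def by metis
  ultimately show ?thesis using that[of S c] S(1) good_card[OF S(1)] by (auto simp: good_def)
qed

lemma psd_sqrt_exists:
  fixes A :: "real ^ 'n ^ 'n"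
  assumes A: "psd_matrix A"
  obtains B where "psd_matrix B" "B ** B = A"
proof -
  have sym: "transpose A = A" using A by (simp add: psd_matrix_def)
  obtain S c where S: "finite S" "pairwise orthogonal S" "span S = UNIV"
    "\<And>x. x \<in> S \<Longrightarrow> norm x = 1" "\<And>x. x \<in> S \<Longrightarrow> A *v x = c x *\<^sub>R x"
    using symmetric_matrix_eigenbasis[OF sym] by metis
  have c: "c s \<ge> 0" if s: "s \<in> S" for s
  proof -
    have "0 \<le> s \<bullet> (A *v s)" using A by (simp add: psd_matrix_def)
    then show ?thesis using S(4,5)[OF s] by (simp add: dot_square_norm)
  qed
  have orth: "s \<bullet> s' = (if s = s' then 1 else 0)" if "s \<in> S" "s' \<in> S" for s s'
    using S(2,4) that by (auto simp: pairwise_def orthogonal_def dot_square_norm)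
  define b where "b x = (\<Sum>s\<in>S. (sqrt (c s) * (s \<bullet> x)) *\<^sub>R s)" for x
  have lin: "linear b"
    unfolding b_def by (intro linearI)
      (simp_all add: inner_right_distrib scaleR_left_distrib sum.distrib scaleR_sum_right algebra_simps)
  define B where "B = matrix b"
  have Bv: "B *v x = b x" for x using lin by (simp add: B_def matrix_works)
  have b_S: "b s = sqrt (c s) *\<^sub>R s" if s: "s \<in> S" for s
  proof -
    have "b s = (\<Sum>s'\<in>S. if s' = s then sqrt (c s) *\<^sub>R s else 0)"
      unfolding b_def using s by (intro sum.cong) (auto simp: orth)
    then show ?thesis using s S(1) by simp
  qed
  have "psd_matrix B" unfolding psd_matrix_def
  proof (intro conjI allI)
    show "transpose B = B"
      by (rule symmetric_matrixI)
         (simp add: Bv b_def inner_sum_left inner_sum_right inner_commute mult_ac)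
    show "0 \<le> x \<bullet> (B *v x)" for x
    proof -
      have "x \<bullet> (B *v x) = (\<Sum>s\<in>S. sqrt (c s) * (s \<bullet> x)\<^sup>2)"
        by (simp add: Bv b_def inner_sum_right inner_commute power2_eq_square mult_ac)
      then show ?thesis using c by (auto intro!: sum_nonneg)
    qed
  qed
  moreover have "B ** B = A"
  proof -
    have "b (b x) = A *v x" for x
    proof (rule linear_eq_on_span[of "\<lambda>x. b (b x)" "(*v) A" S])
      show "linear (\<lambda>x. b (b x))" using linear_compose[OF lin lin] by (simp add: o_def)
      show "b (b s) = A *v s" if s: "s \<in> S" for s
        using b_S[OF s] linear_scale[OF lin] c[OF s] S(5)[OF s] by simp
    qed (use S(3) in auto)
    then show ?thesis by (simp add: matrix_eq Bv flip: matrix_vector_mul_assoc)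
  qed
  ultimately show ?thesis by (rule that)
qed

text \<open>
  If \<open>B\<^sup>2 = C\<^sup>2\<close> and \<open>s\<close> is an eigenvector of the symmetric matrix \<open>B - C\<close> with eigenvalue \<open>c\<close>, then
  \<open>0 = |Bs|\<^sup>2 - |Cs|\<^sup>2 = c (s \<bullet> Bs + s \<bullet> Cs)\<close>, while \<open>c = s \<bullet> Bs - s \<bullet> Cs\<close>; as both terms are nonnegative, \<open>c = 0\<close>.
\<close>
lemma psd_sqrt_unique:
  fixes B C :: "real ^ 'n ^ 'n"
  assumes B: "psd_matrix B" and C: "psd_matrix C" and eq: "B ** B = C ** C"
  shows "B = C"
proof -
  have "transpose (B - C) = B - C"
    using B C by (simp add: psd_matrix_def transpose_def vec_eq_iff)
  then obtain S c where S: "span S = UNIV"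
    "\<And>x. x \<in> S \<Longrightarrow> norm x = 1" "\<And>x. x \<in> S \<Longrightarrow> (B - C) *v x = c x *\<^sub>R x"
    using symmetric_matrix_eigenbasis by metis
  have Bsym: "transpose B = B" and Csym: "transpose C = C" using B C by (auto simp: psd_matrix_def)
  have "B *v s = C *v s" if s: "s \<in> S" for s
  proof -
    have D: "B *v s - C *v s = c s *\<^sub>R s" using S(3)[OF s] by (simp add: matrix_vector_mult_diff_rdistrib)
    have "s \<bullet> (B *v (B *v s)) = s \<bullet> (C *v (C *v s))"
      using eq by (simp add: matrix_vector_mul_assoc)
    then have "(B *v s) \<bullet> (B *v s) - (C *v s) \<bullet> (C *v s) = 0"
      by (simp add: symmetric_matrix_inner[OF Bsym] symmetric_matrix_inner[OF Csym])
    moreover have "(B *v s) \<bullet> (B *v s) - (C *v s) \<bullet> (C *v s)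
        = (B *v s - C *v s) \<bullet> (B *v s) + (B *v s - C *v s) \<bullet> (C *v s)"
      by (simp add: inner_diff_left inner_commute[of "C *v s" "B *v s"])
    ultimately have zero: "c s * (s \<bullet> (B *v s) + s \<bullet> (C *v s)) = 0"
      unfolding D by (simp add: algebra_simps)
    have "c s = s \<bullet> (B *v s) - s \<bullet> (C *v s)"
      using arg_cong[OF D, of "inner s"] S(2)[OF s] by (simp add: inner_diff_right dot_square_norm)
    moreover have "s \<bullet> (B *v s) \<ge> 0" "s \<bullet> (C *v s) \<ge> 0" using B C by (auto simp: psd_matrix_def)
    ultimately have "c s = 0" using zero by (auto simp: add_nonneg_eq_0_iff)
    then show ?thesis using D by simp
  qed
  then have "B *v x = C *v x" for x
    using linear_eq_on_span[of "(*v) B" "(*v) C" S x] S(1) by simp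
  then show ?thesis by (simp add: matrix_eq)
qed

lemma psd_sqrt:
  assumes A: "psd_matrix A"
  shows "psd_matrix (psd_sqrt A)" "psd_sqrt A ** psd_sqrt A = A"
proof -
  have "psd_matrix (psd_sqrt A) \<and> psd_sqrt A ** psd_sqrt A = A"
    unfolding psd_sqrt_def
    by (rule theI') (metis psd_sqrt_exists[OF A] psd_sqrt_unique)
  then show "psd_matrix (psd_sqrt A)" "psd_sqrt A ** psd_sqrt A = A" by auto
qed

theorem norm_psd_sqrt_mult:
  fixes A :: "real ^ 'n ^ 'n"
  assumes A: "psd_matrix A"
  shows "(norm (psd_sqrt A *v w))\<^sup>2 = w \<bullet> (A *v w)"
proof -
  have P: "transpose (psd_sqrt A) = psd_sqrt A" using psd_sqrt(1)[OF A] by (auto simp: psd_matrix_def)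
  have "(norm (psd_sqrt A *v w))\<^sup>2 = w \<bullet> (psd_sqrt A *v (psd_sqrt A *v w))"
    by (simp add: symmetric_matrix_inner[OF P] dot_square_norm)
  then show ?thesis by (simp add: matrix_vector_mul_assoc psd_sqrt(2)[OF A])
qed

lemma psd_invertible_coercive:
  fixes A :: "real ^ 'n ^ 'n"
  assumes A: "psd_matrix A" and inv: "invertible A"
  obtains c where "c > 0" "\<And>w. c * (norm w)\<^sup>2 \<le> w \<bullet> (A *v w)"
proof -
  have inj: "inj ((*v) (psd_sqrt A))"
  proof (rule injI)
    fix x y assume "psd_sqrt A *v x = psd_sqrt A *v y"
    then have "A *v x = A *v y"
      by (metis psd_sqrt(2)[OF A] matrix_vector_mul_assoc)
    then show "x = y" using inv inj_matrix_vector_mult by (meson injD)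
  qed
  obtain e where e: "e > 0" "\<And>w. e * norm w \<le> norm (psd_sqrt A *v w)"
    using linear_inj_bounded_below_pos[OF matrix_vector_mul_linear inj] by metis
  have "e\<^sup>2 * (norm w)\<^sup>2 \<le> w \<bullet> (A *v w)" for w
    using power_mono[OF e(2), of w 2] e(1) by (simp add: power_mult_distrib norm_psd_sqrt_mult[OF A])
  with e(1) that[of "e\<^sup>2"] show ?thesis by simp
qed

section \<open>Partial derivatives of Lipschitz functions\<close>

definition diff_quot :: "(real \<Rightarrow> real) \<Rightarrow> real \<Rightarrow> real \<Rightarrow> real" where
  "diff_quot f x h = (f (x + h) - f x) / h"

text \<open>
  The lower derivate of \<open>f\<close> at \<open>x\<close> is at most \<open>p\<close> and the upper one is at least \<open>q\<close>.  Failure of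
  differentiability is the existence of such a gap between two rationals.
\<close>
definition gap :: "(real \<Rightarrow> real) \<Rightarrow> real \<Rightarrow> real \<Rightarrow> real \<Rightarrow> bool" where
  "gap f p q x \<longleftrightarrow> (\<exists>\<^sub>F h in at 0. diff_quot f x h < p) \<and> (\<exists>\<^sub>F h in at 0. diff_quot f x h > q)"

lemma gap_not_differentiable:
  assumes "p < q" "gap f p q x"
  shows "\<not> f differentiable (at x)"
proof
  assume "f differentiable (at x)"
  then obtain d where "DERIV f x :> d" using real_differentiable_def by blast
  then have lim: "(diff_quot f x \<longlongrightarrow> d) (at 0)" by (simp add: DERIV_def diff_quot_def[abs_def])
  show False
  proof (cases "p < d")
    case True
    with lim have "\<forall>\<^sub>F h in at 0. p < diff_quot f x h" by (rule order_tendstoD)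
    then have "\<forall>\<^sub>F h in at 0. \<not> diff_quot f x h < p" by eventually_elim simp
    then show False using assms(2) by (simp add: gap_def frequently_def)
  next
    case False
    then have "d < q" using assms(1) by simp
    with lim have "\<forall>\<^sub>F h in at 0. diff_quot f x h < q" by (rule order_tendstoD)
    then have "\<forall>\<^sub>F h in at 0. \<not> q < diff_quot f x h" by eventually_elim simp
    then show False using assms(2) by (simp add: gap_def frequently_def)
  qed
qed

lemma not_differentiable_gap:
  fixes f :: "real \<Rightarrow> real"
  assumes bnd: "\<And>h. \<bar>diff_quot f x h\<bar> \<le> L" and nd: "\<not> f differentiable (at x)"
  obtains p q where "p \<in> \<rat>" "q \<in> \<rat>" "p < q" "gap f p q x"
proof -
  define l where "l = Liminf (at 0) (\<lambda>h. ereal (diff_quot f x h))"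
  define u where "u = Limsup (at 0) (\<lambda>h. ereal (diff_quot f x h))"
  have "l \<le> u" unfolding l_def u_def by (rule Liminf_le_Limsup) simp
  have lower: "ereal (- L) \<le> l" unfolding l_def
    by (rule Liminf_bounded) (use bnd in \<open>auto intro!: always_eventually simp: abs_le_iff minus_le_iff\<close>)
  have upper: "u \<le> ereal L" unfolding u_def
    by (rule Limsup_bounded) (use bnd in \<open>auto intro!: always_eventually simp: abs_le_iff\<close>)
  have "l \<noteq> u"
  proof
    assume "l = u"
    then obtain r where r: "l = ereal r" "u = ereal r" using lower upper by (cases l) auto
    have "((\<lambda>h. ereal (diff_quot f x h)) \<longlongrightarrow> ereal r) (at 0)"
      using r by (intro Liminf_eq_Limsup) (auto simp: l_def u_def)
    then have "(diff_quot f x \<longlongrightarrow> r) (at 0)" by simp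
    then have "DERIV f x :> r" by (simp add: DERIV_def diff_quot_def[abs_def])
    then show False using nd real_differentiable_def by blast
  qed
  then have "l < u" using \<open>l \<le> u\<close> by simp
  then obtain a where a: "l < ereal a" "ereal a < u" using ereal_dense2 by blast
  then obtain b where b: "ereal a < ereal b" "ereal b < u" using ereal_dense2 by blast
  have "a < b" using b by simp
  obtain p where p: "p \<in> \<rat>" "a < p" "p < b" using Rats_dense_in_real[OF \<open>a < b\<close>] by blast
  obtain q where q: "q \<in> \<rat>" "p < q" "q < b" using Rats_dense_in_real[OF p(3)] by blast
  have "\<exists>\<^sub>F h in at 0. diff_quot f x h < p"
  proof (rule ccontr)
    assume "\<not> ?thesis"
    then have "\<forall>\<^sub>F h in at 0. ereal p \<le> ereal (diff_quot f x h)"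
      by (simp add: not_frequently not_less)
    then have "ereal p \<le> l" unfolding l_def by (rule Liminf_bounded)
    then have "ereal p < ereal a" using a(1) by (rule order.strict_trans1)
    then show False using p by simp
  qed
  moreover have "\<exists>\<^sub>F h in at 0. diff_quot f x h > q"
  proof (rule ccontr)
    assume "\<not> ?thesis"
    then have "\<forall>\<^sub>F h in at 0. ereal (diff_quot f x h) \<le> ereal q"
      by (simp add: not_frequently not_less)
    then have "u \<le> ereal q" unfolding u_def by (rule Limsup_bounded)
    then have "ereal b < ereal q" using b(2) by (rule order.strict_trans2[rotated])
    then show False using q by simp
  qed
  ultimately show ?thesis using that p q unfolding gap_def by blast
qed

text \<open>
  For fixed \<open>n\<close> the points at which some quotient with \<open>|h| < 1 / (n + 1)\<close> is below \<open>p\<close> form an open set, so the gap set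
  is a \<open>G\<^sub>\<delta>\<close>.
\<close>
lemma gap_borel:
  fixes f :: "'a::real_normed_vector \<Rightarrow> real"
  assumes cont: "continuous_on UNIV f"
  shows "{x. gap (\<lambda>t. f (x + t *\<^sub>R e)) p q 0} \<in> sets borel"
proof -
  have frequently_at0: "(\<exists>\<^sub>F h in at (0::real). P h) \<longleftrightarrow> (\<forall>n. \<exists>h. h \<noteq> 0 \<and> \<bar>h\<bar> < 1 / real (Suc n) \<and> P h)" for P
  proof -
    have "(\<exists>\<^sub>F h in at (0::real). P h) \<longleftrightarrow> (\<forall>d>0. \<exists>h. h \<noteq> 0 \<and> \<bar>h\<bar> < d \<and> P h)"
      by (auto simp: frequently_def eventually_at dist_real_def)
    moreover have "(\<forall>d>0. \<exists>h. h \<noteq> 0 \<and> \<bar>h\<bar> < d \<and> P h) \<longleftrightarrow> (\<forall>n. \<exists>h. h \<noteq> 0 \<and> \<bar>h\<bar> < 1 / real (Suc n) \<and> P h)"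
    proof (intro iffI allI impI)
      fix d :: real assume all: "\<forall>n. \<exists>h. h \<noteq> 0 \<and> \<bar>h\<bar> < 1 / real (Suc n) \<and> P h" and "d > 0"
      obtain n where "1 / real (Suc n) < d"
        using reals_Archimedean[OF \<open>d > 0\<close>] by (auto simp: inverse_eq_divide)
      then show "\<exists>h. h \<noteq> 0 \<and> \<bar>h\<bar> < d \<and> P h" using all by (meson less_trans)
    qed simp
    ultimately show ?thesis by simp
  qed
  define W where "W P n = (\<Union>h\<in>{h. h \<noteq> 0 \<and> \<bar>h\<bar> < 1 / real (Suc n)}. {x. P ((f (x + h *\<^sub>R e) - f x) / h)})"
    for P and n :: nat
  have cdq: "continuous_on UNIV (\<lambda>x. (f (x + h *\<^sub>R e) - f x) / h)" if "h \<noteq> 0" for h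
    using that by (auto intro!: continuous_intros continuous_on_compose2[OF cont])
  have W_open: "open (W P n)" if "P = (\<lambda>y. y < p) \<or> P = (\<lambda>y. y > q)" for P n
    unfolding W_def
    using that by (auto intro!: open_UN open_Collect_less cdq continuous_on_const)
  have "{x. gap (\<lambda>t. f (x + t *\<^sub>R e)) p q 0} = (\<Inter>n. W (\<lambda>y. y < p) n) \<inter> (\<Inter>n. W (\<lambda>y. y > q) n)"
    unfolding gap_def W_def frequently_at0 by (auto simp: diff_quot_def)
  then show ?thesis using W_open by (auto intro!: sets.Int sets.countable_INT)
qed

text \<open>
  Lebesgue's argument.  Let \<open>\<mu>\<close> be the measure with \<open>\<mu> [a, b] = f b - f a\<close>, and let \<open>U\<close> be open with \<open>S \<subseteq> U\<close>.  Almost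
  all of \<open>S\<close> is covered by disjoint intervals in \<open>U\<close> with \<open>\<mu> I < p |I|\<close>, and almost all of what is then covered
  is covered again by disjoint intervals inside the first ones with \<open>\<mu> I > q |I|\<close>.  Hence
  \<open>q |S| \<le> p |U|\<close>, and \<open>|S| = 0\<close> on letting \<open>U\<close> shrink to \<open>S\<close>.
\<close>
lemma quotient_gap_null:
  fixes f :: "real \<Rightarrow> real"
  assumes mono: "mono f" and cont: "continuous_on UNIV f" and pq: "p < q"
  defines "E \<equiv> {x. gap f p q x}"
  shows "negligible E"
proof -
  have dq_nonneg: "0 \<le> diff_quot f x h" for x h
    using mono by (cases "h \<ge> 0") (auto simp: diff_quot_def monoD zero_le_divide_iff)
  have E_borel: "E \<in> sets borel"
    using gap_borel[OF cont, of 1 p q] by (simp add: E_def gap_def diff_quot_def)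
  have "negligible (E \<inter> ball 0 N)" for N
  proof (cases "E = {}")
    case False
    then obtain x0 where "x0 \<in> E" by blast
    then obtain h0 where "diff_quot f x0 h0 < p" unfolding E_def gap_def using frequently_ex by blast
    then have p: "p > 0" using dq_nonneg[of x0 h0] by linarith
    define S where "S = E \<inter> ball 0 N"
    have S_borel: "S \<in> sets borel" unfolding S_def using E_borel by auto
    define \<mu> where "\<mu> = interval_measure f"
    have sets_\<mu> [simp, measurable_cong]: "sets \<mu> = sets borel" by (simp add: \<mu>_def)
    have \<mu>_Icc: "emeasure \<mu> {a..b} = ennreal (f b - f a)" if "a \<le> b" for a b
      unfolding \<mu>_def using that mono cont
      by (intro emeasure_interval_measure_Icc) (auto simp: monoD continuous_on_eq_continuous_at)
    define I where "I i = cball (fst i + snd i / 2) (\<bar>snd i\<bar> / 2)" for i :: "real \<times> real"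
    have I_eq: "I (x, h) = {min x (x + h)..max x (x + h)}" for x h
      unfolding I_def cball_eq_atLeastAtMost by (cases "h \<ge> 0") (auto simp: field_simps)
    have \<mu>_I: "emeasure \<mu> (I (x, h)) = ennreal (diff_quot f x h * \<bar>h\<bar>)" if "h \<noteq> 0" for x h
    proof -
      have "f (max x (x + h)) - f (min x (x + h)) = diff_quot f x h * \<bar>h\<bar>"
        using that by (cases "h > 0") (auto simp: diff_quot_def max_def min_def)
      then show ?thesis unfolding I_eq by (subst \<mu>_Icc) auto
    qed
    have leb_I: "emeasure lborel (I (x, h)) = ennreal \<bar>h\<bar>" for x h
      unfolding I_eq by (auto simp: max_def min_def)
    \<comment> \<open>The intervals between \<open>x\<close> and \<open>x + h\<close> are not centred at \<open>x\<close>; Vitali's theorem only asks that they contain \<open>x\<close>.\<close>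
    have cover: "\<exists>C. countable C \<and> C \<subseteq> {(x, h). h \<noteq> 0 \<and> P (diff_quot f x h) \<and> I (x, h) \<subseteq> U}
        \<and> disjoint_family_on I C \<and> negligible (S' - (\<Union>i\<in>C. I i))"
      if U: "open U" "S' \<subseteq> U" and fr: "\<And>x. x \<in> S' \<Longrightarrow> \<exists>\<^sub>F h in at 0. P (diff_quot f x h)" for P U S'
    proof -
      let ?K = "{(x, h). h \<noteq> 0 \<and> P (diff_quot f x h) \<and> I (x, h) \<subseteq> U}"
      have cov: "\<exists>i. i \<in> ?K \<and> x \<in> cball (fst i + snd i / 2) (\<bar>snd i\<bar> / 2) \<and> \<bar>snd i\<bar> / 2 < d"
        if x: "x \<in> S'" and d: "d > 0" for x d
      proof -
        obtain e where e: "e > 0" "cball x e \<subseteq> U" using U x open_contains_cball by blast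
        have "\<forall>\<^sub>F h in at (0::real). h \<noteq> 0 \<and> \<bar>h\<bar> < min d e"
          using d e(1) by (auto simp: eventually_at dist_real_def intro!: exI[of _ "min d e"])
        from frequently_ex[OF frequently_eventually_conj[OF fr[OF x] this]]
        obtain h where h: "P (diff_quot f x h)" "h \<noteq> 0" "\<bar>h\<bar> < min d e" by blast
        have "I (x, h) \<subseteq> cball x e" using h(3) by (auto simp: I_eq cball_eq_atLeastAtMost)
        then have "(x, h) \<in> ?K" using h e by auto
        moreover have "x \<in> I (x, h)" by (auto simp: I_eq)
        moreover have "\<bar>h\<bar> / 2 < d" using h(3) d by auto
        ultimately show ?thesis by (intro exI[of _ "(x, h)"]) (auto simp: I_def)
      qed
      have pos: "0 < \<bar>snd i\<bar> / 2" if "i \<in> ?K" for i using that by auto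
      obtain C where C: "countable C" "C \<subseteq> ?K"
        "pairwise (\<lambda>i j. disjnt (cball (fst i + snd i / 2) (\<bar>snd i\<bar> / 2))
            (cball (fst j + snd j / 2) (\<bar>snd j\<bar> / 2))) C"
        "negligible (S' - (\<Union>i\<in>C. cball (fst i + snd i / 2) (\<bar>snd i\<bar> / 2)))"
        using Vitali_covering_theorem_cballs[where K = ?K and S = S'
              and a = "\<lambda>i. fst i + snd i / 2" and r = "\<lambda>i. \<bar>snd i\<bar> / 2", OF pos cov] by blast
      then have "disjoint_family_on I C" "negligible (S' - (\<Union>i\<in>C. I i))"
        unfolding I_def[abs_def] by (auto simp: disjoint_family_on_def pairwise_def disjnt_def)
      with C(1,2) show ?thesis by blast
    qed
    have I_borel [measurable]: "I i \<in> sets borel" for i unfolding I_def by auto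
    have family: "emeasure M (\<Union>i\<in>C. I i) = (\<integral>\<^sup>+i. emeasure M (I i) \<partial>count_space C)"
      if "countable C" "disjoint_family_on I C" "sets M = sets borel" for C M
      using that by (intro emeasure_UN_countable) auto
    have null_lborel: "emeasure lborel (A - B) = 0" if "negligible (A - B)" "A \<in> sets borel" "B \<in> sets borel"
      for A B :: "real set"
    proof -
      have "A - B \<in> sets lborel" using sets.Diff[OF that(2,3)] by (simp only: sets_lborel)
      from null_sets_completion_iff[OF this] have "A - B \<in> null_sets lborel"
        using that(1) unfolding negligible_iff_null_sets by blast
      then show ?thesis by auto
    qed
    have fr: "\<And>x. x \<in> S \<Longrightarrow> \<exists>\<^sub>F h in at 0. diff_quot f x h < p"
      "\<And>x. x \<in> S \<Longrightarrow> \<exists>\<^sub>F h in at 0. diff_quot f x h > q" by (auto simp: S_def E_def gap_def)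
    have main: "ennreal q * emeasure lborel S \<le> ennreal p * emeasure lborel U"
      if U: "open U" "S \<subseteq> U" for U
    proof -
      obtain C1 where C1: "countable C1" "C1 \<subseteq> {(x, h). h \<noteq> 0 \<and> diff_quot f x h < p \<and> I (x, h) \<subseteq> U}"
        "disjoint_family_on I C1" "negligible (S - (\<Union>i\<in>C1. I i))"
        using cover[where P = "\<lambda>y. y < p", OF U fr(1)] by blast
      define J where "J = (\<Union>i\<in>C1. I i)"
      define V where "V = (\<Union>i\<in>C1. interior (I i))"
      have Vopen: "open V" by (auto simp: V_def)
      have VJ: "V \<subseteq> J" unfolding V_def J_def using interior_subset by blast
      have J_borel: "J \<in> sets borel" unfolding J_def using C1(1) by auto
      have "countable (\<Union>i\<in>C1. {fst i, fst i + snd i})" using C1(1) by auto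
      then have "negligible (\<Union>i\<in>C1. {fst i, fst i + snd i})" 
        unfolding negligible_iff_null_sets by (intro null_sets_completionI countable_imp_null_set_lborel)
      moreover have "S - V \<subseteq> (S - J) \<union> (\<Union>i\<in>C1. {fst i, fst i + snd i})"
        unfolding V_def J_def by (force simp: I_eq min_def max_def split: if_splits)
      ultimately have negSV: "negligible (S - V)"
        using negligible_subset[OF negligible_Un[OF C1(4)[folded J_def]]] by blast
      have frV: "\<And>x. x \<in> S \<inter> V \<Longrightarrow> \<exists>\<^sub>F h in at 0. diff_quot f x h > q" by (rule fr(2)[OF IntD1])
      have "\<exists>C2. countable C2 \<and> C2 \<subseteq> {(x, h). h \<noteq> 0 \<and> diff_quot f x h > q \<and> I (x, h) \<subseteq> V} \<and>
        disjoint_family_on I C2 \<and> negligible ((S \<inter> V) - (\<Union>i\<in>C2. I i))"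
        by (rule cover[OF Vopen Int_lower2 frV])
      then obtain C2 where C2: "countable C2" "C2 \<subseteq> {(x, h). h \<noteq> 0 \<and> diff_quot f x h > q \<and> I (x, h) \<subseteq> V}"
        "disjoint_family_on I C2" "negligible ((S \<inter> V) - (\<Union>i\<in>C2. I i))"
        by (elim exE conjE)
      define J2 where "J2 = (\<Union>i\<in>C2. I i)"
      have J2_borel: "J2 \<in> sets borel" unfolding J2_def using C2(1) by auto
      have "emeasure lborel S \<le> emeasure lborel (S - V) + (emeasure lborel ((S \<inter> V) - J2) + emeasure lborel J2)"
      proof -
        have "emeasure lborel S \<le> emeasure lborel ((S - V) \<union> (((S \<inter> V) - J2) \<union> J2))"
          using S_borel Vopen J2_borel by (intro emeasure_mono) auto
        also have "\<dots> \<le> emeasure lborel (S - V) + emeasure lborel (((S \<inter> V) - J2) \<union> J2)"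
          using S_borel Vopen J2_borel by (intro emeasure_subadditive) auto
        also have "\<dots> \<le> emeasure lborel (S - V) + (emeasure lborel ((S \<inter> V) - J2) + emeasure lborel J2)"
          using S_borel Vopen J2_borel by (intro add_left_mono emeasure_subadditive) auto
        finally show ?thesis .
      qed
      also have "\<dots> = emeasure lborel J2"
        using null_lborel[OF negSV] null_lborel[of "S \<inter> V" J2] C2(4) S_borel J2_borel Vopen
        by (simp add: J2_def)
      finally have "ennreal q * emeasure lborel S \<le> ennreal q * emeasure lborel J2"
        by (rule mult_left_mono) simp
      also have "\<dots> = (\<integral>\<^sup>+i. ennreal q * emeasure lborel (I i) \<partial>count_space C2)"
        unfolding J2_def using family[OF C2(1,3), of lborel] by (simp add: nn_integral_cmult)
      also have "\<dots> \<le> (\<integral>\<^sup>+i. emeasure \<mu> (I i) \<partial>count_space C2)"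
      proof (rule nn_integral_mono)
        fix i assume "i \<in> space (count_space C2)"
        then obtain x h where i: "i = (x, h)" "h \<noteq> 0" "diff_quot f x h > q" using C2(2) by auto
        show "ennreal q * emeasure lborel (I i) \<le> emeasure \<mu> (I i)"
          unfolding i(1) leb_I \<mu>_I[OF i(2)]
          using i(3) p pq by (auto simp: ennreal_mult[symmetric] intro!: ennreal_leI mult_right_mono)
      qed
      also have "\<dots> = emeasure \<mu> J2" unfolding J2_def using family[OF C2(1,3)] by simp
      also have "\<dots> \<le> emeasure \<mu> J"
        using J_borel C2(2) VJ by (intro emeasure_mono) (auto simp: J2_def)
      also have "\<dots> = (\<integral>\<^sup>+i. emeasure \<mu> (I i) \<partial>count_space C1)"
        unfolding J_def using family[OF C1(1,3)] by simp
      also have "\<dots> \<le> (\<integral>\<^sup>+i. ennreal p * emeasure lborel (I i) \<partial>count_space C1)"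
      proof (rule nn_integral_mono)
        fix i assume "i \<in> space (count_space C1)"
        then obtain x h where i: "i = (x, h)" "h \<noteq> 0" "diff_quot f x h < p" using C1(2) by auto
        show "emeasure \<mu> (I i) \<le> ennreal p * emeasure lborel (I i)"
          unfolding i(1) leb_I \<mu>_I[OF i(2)]
          using i(3) p by (auto simp: ennreal_mult[symmetric] intro!: ennreal_leI mult_right_mono)
      qed
      also have "\<dots> = ennreal p * emeasure lborel J"
        unfolding J_def using family[OF C1(1,3), of lborel] by (simp add: nn_integral_cmult)
      also have "\<dots> \<le> ennreal p * emeasure lborel U"
        using C1(2) U(1) by (intro mult_left_mono emeasure_mono) (auto simp: J_def)
      finally show ?thesis .
    qed
    have fin: "emeasure lborel S < \<infinity>"
    proof -
      have "emeasure lborel S \<le> emeasure lborel (ball (0::real) N)" unfolding S_def by (intro emeasure_mono) auto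
      also have "\<dots> < \<infinity>" using emeasure_bounded_finite[of "ball (0::real) N"] by auto
      finally show ?thesis .
    qed
    then obtain m where m: "emeasure lborel S = ennreal m" "m \<ge> 0" by (cases "emeasure lborel S") auto
    have "q * m \<le> p * m"
    proof (rule field_le_epsilon)
      fix e :: real assume e: "e > 0"
      obtain U where U: "open U" "S \<subseteq> U" "emeasure lebesgue (U - S) < ennreal (e / p)"
      proof (rule sets_lebesgue_outer_open[of S "e / p"])
        show "S \<in> sets lebesgue" using S_borel by simp
        show "e / p > 0" using e p by simp
      qed
      have "emeasure lborel U \<le> emeasure lborel S + emeasure lborel (U - S)"
        using U(1,2) S_borel emeasure_subadditive[of S lborel "U - S"] by (simp add: Un_absorb1)
      also have "\<dots> \<le> ennreal m + ennreal (e / p)"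
        using U S_borel m by (intro add_mono) auto
      finally have "emeasure lborel U \<le> ennreal (m + e / p)" using m(2) e p by simp
      then have "ennreal q * ennreal m \<le> ennreal p * ennreal (m + e / p)"
        using main[OF U(1,2)] m(1) by (metis mult_left_mono order_trans zero_le)
      then have "ennreal (q * m) \<le> ennreal (p * (m + e / p))"
        using p pq m(2) e by (simp add: ennreal_mult)
      moreover have "p * (m + e / p) = p * m + e" using p by (simp add: field_simps)
      ultimately have "ennreal (q * m) \<le> ennreal (p * m + e)" by (simp only:)
      then show "q * m \<le> p * m + e" using p e m(2) by (subst (asm) ennreal_le_iff) auto
    qed
    then have "m = 0" using pq m(2) by (simp add: mult_le_cancel_right)
    then have "emeasure lborel S = 0" using m by simp
    then show ?thesis using S_borel unfolding S_def[symmetric] negligible_iff_null_sets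
      by (auto intro!: null_setsI simp: null_sets_completionI)
  qed auto
  then have "negligible (\<Union>N. E \<inter> ball 0 (real N))" by (intro negligible_Union_nat) auto
  moreover have "E = (\<Union>N. E \<inter> ball 0 (real N))"
    using reals_Archimedean2 by (force simp: dist_real_def)
  ultimately show ?thesis by metis
qed

lemma lipschitz_diff_quot_le:
  assumes lip: "L-lipschitz_on UNIV f"
  shows "\<bar>diff_quot f x h\<bar> \<le> L"
proof (cases "h = 0")
  case True
  then show ?thesis using lipschitz_on_nonneg[OF lip] by (simp add: diff_quot_def)
next
  case False
  have "\<bar>f (x + h) - f x\<bar> \<le> L * \<bar>h\<bar>"
    using lipschitz_onD[OF lip, of "x + h" x] by (simp add: dist_real_def)
  then show ?thesis using False by (simp add: diff_quot_def abs_divide divide_le_eq)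
qed

text \<open>Adding \<open>L x\<close> makes the function monotone without affecting differentiability.\<close>
theorem lipschitz_real_differentiable_AE:
  fixes f :: "real \<Rightarrow> real"
  assumes lip: "L-lipschitz_on UNIV f"
  shows "negligible {x. \<not> f differentiable (at x)}"
proof -
  define g where "g x = f x + L * x" for x
  have "mono g"
  proof (rule monoI)
    fix x y :: real assume "x \<le> y"
    moreover have "\<bar>f x - f y\<bar> \<le> L * \<bar>x - y\<bar>"
      using lipschitz_onD[OF lip, of x y] by (simp add: dist_real_def)
    ultimately show "g x \<le> g y" by (simp add: g_def abs_le_iff algebra_simps)
  qed
  have cont: "continuous_on UNIV g" unfolding g_def
    by (intro continuous_intros lipschitz_on_continuous_on[OF lip])
  have "L-lipschitz_on UNIV (\<lambda>x. L * x)"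
    using lipschitz_on_nonneg[OF lip]
    by (intro lipschitz_onI) (auto simp: dist_real_def abs_mult simp flip: right_diff_distrib)
  then have "(L + L)-lipschitz_on UNIV g" unfolding g_def by (rule lipschitz_on_add[OF lip])
  note bnd = lipschitz_diff_quot_le[OF this]
  define E where "E p q = {x. gap g p q x}" for p q
  have "{x. \<not> f differentiable (at x)} \<subseteq> (\<Union>(p, q)\<in>{(p, q). p \<in> \<rat> \<and> q \<in> \<rat> \<and> p < q}. E p q)"
  proof
    fix x assume "x \<in> {x. \<not> f differentiable (at x)}"
    moreover have "f differentiable (at x)" if "g differentiable (at x)"
    proof -
      have "(\<lambda>x. g x - L * x) differentiable (at x)" using that by (intro differentiable_diff) auto
      then show ?thesis by (simp add: g_def)
    qed
    ultimately have "\<not> g differentiable (at x)" by blast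
    from not_differentiable_gap[OF bnd this] show "x \<in> (\<Union>(p, q)\<in>{(p, q). p \<in> \<rat> \<and> q \<in> \<rat> \<and> p < q}. E p q)"
      unfolding E_def by blast
  qed
  moreover have "negligible (\<Union>(p, q)\<in>{(p, q). p \<in> \<rat> \<and> q \<in> \<rat> \<and> p < q}. E p q)"
  proof (rule negligible_countable_Union)
    have "{(p, q). p \<in> \<rat> \<and> q \<in> \<rat> \<and> p < q} \<subseteq> \<rat> \<times> (\<rat> :: real set)" by auto
    then show "countable ((\<lambda>(p, q). E p q) ` {(p, q). p \<in> \<rat> \<and> q \<in> \<rat> \<and> p < q})"
      by (meson countable_SIGMA countable_image countable_rat countable_subset)
    show "negligible t" if "t \<in> (\<lambda>(p, q). E p q) ` {(p, q). p \<in> \<rat> \<and> q \<in> \<rat> \<and> p < q}" for t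
      using that quotient_gap_null[OF \<open>mono g\<close> cont] by (auto simp: E_def)
  qed
  ultimately show ?thesis using negligible_subset by blast
qed

lemma lipschitz_on_line:
  fixes f :: "'a::real_normed_vector \<Rightarrow> real"
  assumes lip: "L-lipschitz_on UNIV f"
  shows "(L * norm e)-lipschitz_on UNIV (\<lambda>t. f (x + t *\<^sub>R e))"
proof (rule lipschitz_onI)
  fix s t
  have "dist (f (x + s *\<^sub>R e)) (f (x + t *\<^sub>R e)) \<le> L * dist (x + s *\<^sub>R e) (x + t *\<^sub>R e)"
    by (rule lipschitz_onD[OF lip]) auto
  also have "dist (x + s *\<^sub>R e) (x + t *\<^sub>R e) = norm e * dist s t"
    by (simp add: dist_norm flip: scaleR_left_diff_distrib)
  finally show "dist (f (x + s *\<^sub>R e)) (f (x + t *\<^sub>R e)) \<le> L * norm e * dist s t" by simp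
qed (use lipschitz_on_nonneg[OF lip] in auto)

text \<open>
  It suffices to treat one gap set for each pair of rationals.  Such an exceptional set meets every line in direction \<open>e\<close> in a null set.  Fubini's theorem, applied to the pairs
  \<open>(t, x)\<close> with \<open>x + te\<close> in the exceptional set, shows that almost all of its translates along \<open>e\<close>
  are null; by translation invariance so is the set itself.
\<close>
theorem lipschitz_partial_differentiable_AE:
  fixes f :: "'a::euclidean_space \<Rightarrow> real"
  assumes lip: "L-lipschitz_on UNIV f"
  shows "AE x in lborel. (\<lambda>t. f (x + t *\<^sub>R e)) differentiable (at 0)"
proof -
  have cont: "continuous_on UNIV f" by (rule lipschitz_on_continuous_on[OF lip])
  have no_gap: "AE x in lborel. \<not> gap (\<lambda>t. f (x + t *\<^sub>R e)) p q 0" if pq: "p < q" for p q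
  proof -
    define B where "B x \<longleftrightarrow> gap (\<lambda>t. f (x + t *\<^sub>R e)) p q 0" for x
    have [measurable]: "Measurable.pred borel B"
      using gap_borel[OF cont, of e p q] by (simp add: pred_def B_def)
    have slice: "AE t in lborel. \<not> B (x + t *\<^sub>R e)" for x
    proof -
      define g where "g t = f (x + t *\<^sub>R e)" for t
      have "negligible {t. \<not> g differentiable (at t)}"
        unfolding g_def by (rule lipschitz_real_differentiable_AE[OF lipschitz_on_line[OF lip]])
      moreover have "{t. B (x + t *\<^sub>R e)} \<subseteq> {t. \<not> g differentiable (at t)}"
      proof clarify
        fix t assume "B (x + t *\<^sub>R e)" and g: "g differentiable (at t)"
        then have "gap g p q t"
          by (simp add: B_def gap_def diff_quot_def g_def scaleR_left_distrib add.assoc)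
        with pq g gap_not_differentiable show False by blast
      qed
      ultimately have "negligible {t. B (x + t *\<^sub>R e)}" by (rule negligible_subset)
      then have "AE t in lebesgue. \<not> B (x + t *\<^sub>R e)"
        by (auto simp: negligible_iff_null_sets intro!: AE_I')
      then show ?thesis by (simp add: AE_completion_iff)
    qed
    have "AE t in lborel. AE x in lborel. \<not> B (x + t *\<^sub>R e)"
    proof (subst lborel_pair.AE_commute)
      show "{p \<in> space (lborel \<Otimes>\<^sub>M lborel). \<not> B (snd p + fst p *\<^sub>R e)}
          \<in> sets (lborel \<Otimes>\<^sub>M (lborel :: 'a measure))"
        by measurable
      show "AE x in lborel. AE t in lborel. \<not> B (x + t *\<^sub>R e)"
        using slice by simp
    qed
    then obtain t :: real where t: "AE x in lborel. \<not> B (x + t *\<^sub>R e)"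
      using eventually_happens'[of "ae_filter (lborel :: real measure)"] by (auto simp: ae_filter_eq_bot_iff)
    have "AE x in distr lborel borel ((+) (t *\<^sub>R e)). \<not> B x"
      by (subst AE_distr_iff) (use t in \<open>auto simp: add.commute\<close>)
    then have "AE x in lborel. \<not> B x" by (simp only: lborel_distr_plus)
    then show ?thesis by (simp add: B_def)
  qed
  have "AE x in lborel. \<forall>p\<in>\<rat>. \<forall>q\<in>\<rat>. p < q \<longrightarrow> \<not> gap (\<lambda>t. f (x + t *\<^sub>R e)) p q 0"
    unfolding AE_ball_countable[OF countable_rat] using no_gap by (auto simp: AE_impI)
  then show ?thesis
  proof eventually_elim
    case (elim x)
    show ?case
    proof (rule ccontr)
      assume "\<not> (\<lambda>t. f (x + t *\<^sub>R e)) differentiable (at 0)"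
      from not_differentiable_gap[OF lipschitz_diff_quot_le[OF lipschitz_on_line[OF lip]] this] elim
      show False by blast
    qed
  qed
qed

text \<open>McShane's extension \<open>inf\<^sub>y (f y + L d(x, y))\<close>.\<close>
theorem lipschitz_extension_real:
  fixes f :: "'a::metric_space \<Rightarrow> real"
  assumes lip: "L-lipschitz_on S f"
  obtains g where "L-lipschitz_on UNIV g" "\<And>x. x \<in> S \<Longrightarrow> g x = f x"
proof (cases "S = {}")
  case True
  have "L-lipschitz_on UNIV (\<lambda>x::'a. 0::real)"
    using lipschitz_on_nonneg[OF lip] by (auto intro!: lipschitz_onI)
  then show ?thesis using that True by blast
next
  case False
  then obtain s where s: "s \<in> S" by blast
  have L: "L \<ge> 0" by (rule lipschitz_on_nonneg[OF lip])
  have ff: "f x \<le> f y + L * dist x y" if "x \<in> S" "y \<in> S" for x y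
    using lipschitz_onD[OF lip that] by (simp add: dist_real_def abs_le_iff)
  define g where "g x = Inf ((\<lambda>y. f y + L * dist x y) ` S)" for x
  have bdd: "bdd_below ((\<lambda>y. f y + L * dist x y) ` S)" for x
  proof (rule bdd_belowI2)
    fix y assume y: "y \<in> S"
    have "L * dist s y \<le> L * (dist x s + dist x y)"
      using L dist_triangle[of s y x] by (intro mult_left_mono) (auto simp: dist_commute)
    then show "f s - L * dist x s \<le> f y + L * dist x y" using ff[OF s y] by (simp add: algebra_simps)
  qed
  have g_le: "g x \<le> f y + L * dist x y" if "y \<in> S" for x y
    unfolding g_def using bdd that by (intro cInf_lower) auto
  have le_g: "c \<le> g x" if "\<And>y. y \<in> S \<Longrightarrow> c \<le> f y + L * dist x y" for c x
    unfolding g_def using False that by (intro cInf_greatest) auto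
  have half: "g x \<le> g x' + L * dist x x'" for x x'
  proof -
    have "g x - L * dist x x' \<le> g x'"
    proof (rule le_g)
      fix y assume y: "y \<in> S"
      have "L * dist x y \<le> L * (dist x x' + dist x' y)" using L dist_triangle by (intro mult_left_mono) auto
      then show "g x - L * dist x x' \<le> f y + L * dist x' y" using g_le[OF y, of x] by (simp add: algebra_simps)
    qed
    then show ?thesis by simp
  qed
  have "L-lipschitz_on UNIV g"
  proof (rule lipschitz_onI[OF _ L])
    fix x y
    show "dist (g x) (g y) \<le> L * dist x y"
      using half[of x y] half[of y x] by (simp add: dist_real_def abs_le_iff dist_commute)
  qed
  moreover have "g x = f x" if "x \<in> S" for x
    using g_le[OF that, of x] le_g[of "f x" x] ff[OF that] by (intro antisym) auto
  ultimately show ?thesis using that by blast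
qed

text \<open>
  The statement that \<open>g\<close> is a genuine gradient: \<open>grad\<close> alone takes unspecified values where partial derivatives do
  not exist.
\<close>
definition has_partials :: "(real ^ 'n \<Rightarrow> real) \<Rightarrow> real ^ 'n \<Rightarrow> real ^ 'n \<Rightarrow> bool" where
  "has_partials f x g \<longleftrightarrow> (\<forall>i. ((\<lambda>t. f (x + t *\<^sub>R axis i 1)) has_real_derivative g $ i) (at 0))"

lemma has_partials_grad: "has_partials f x g \<Longrightarrow> grad f x = g"
  by (simp add: has_partials_def grad_def vec_eq_iff DERIV_imp_deriv)

lemma has_partials_add:
  "has_partials f x g \<Longrightarrow> has_partials f' x g' \<Longrightarrow> has_partials (\<lambda>x. f x + f' x) x (g + g')"
  unfolding has_partials_def by (auto intro: DERIV_add)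

lemma has_partials_chain:
  assumes "(T has_real_derivative d) (at (f x))" "has_partials f x g"
  shows "has_partials (\<lambda>x. T (f x)) x (d *\<^sub>R g)"
  unfolding has_partials_def
proof
  fix i
  show "((\<lambda>t. T (f (x + t *\<^sub>R axis i 1))) has_real_derivative (d *\<^sub>R g) $ i) (at 0)"
    using DERIV_chain2[of T d "\<lambda>t. f (x + t *\<^sub>R axis i 1)" 0 "g $ i" UNIV] assms
    by (simp add: has_partials_def)
qed

lemma lipschitz_has_partials_AE:
  fixes f :: "real ^ 'n \<Rightarrow> real"
  assumes \<Omega>: "open \<Omega>" and lip: "L-lipschitz_on \<Omega> f"
  shows "AE x in lebesgue_on \<Omega>. has_partials f x (grad f x)"
proof -
  obtain g where g: "L-lipschitz_on UNIV g" "\<And>x. x \<in> \<Omega> \<Longrightarrow> g x = f x"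
    using lipschitz_extension_real[OF lip] by blast
  have "AE x in lborel. \<forall>i. (\<lambda>t. g (x + t *\<^sub>R axis i 1)) differentiable (at 0)"
    using lipschitz_partial_differentiable_AE[OF g(1)] by (simp add: AE_all_countable)
  then have "AE x in lebesgue. \<forall>i. (\<lambda>t. g (x + t *\<^sub>R axis i 1)) differentiable (at 0)"
    by (rule AE_completion)
  then have "AE x in lebesgue. x \<in> \<Omega> \<longrightarrow> has_partials f x (grad f x)"
  proof eventually_elim
    case (elim x)
    show ?case
    proof
      assume x: "x \<in> \<Omega>"
      have "\<exists>D. ((\<lambda>t. f (x + t *\<^sub>R axis i 1)) has_real_derivative D) (at 0)" for i
      proof -
        obtain D where D: "((\<lambda>t. g (x + t *\<^sub>R axis i 1)) has_real_derivative D) (at 0)"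
          using elim real_differentiable_def by blast
        have "isCont (\<lambda>t. x + t *\<^sub>R axis i 1) (0::real)" by (intro continuous_intros)
        then have "((\<lambda>t. x + t *\<^sub>R axis i 1) \<longlongrightarrow> x) (nhds (0::real))"
          using tendsto_at_iff_tendsto_nhds[of "\<lambda>t. x + t *\<^sub>R axis i 1" "0::real"] by (simp add: continuous_at)
        then have "\<forall>\<^sub>F t in nhds (0::real). x + t *\<^sub>R axis i 1 \<in> \<Omega>"
          using \<Omega> x by (rule topological_tendstoD)
        then have ev: "\<forall>\<^sub>F t in nhds 0. f (x + t *\<^sub>R axis i 1) = g (x + t *\<^sub>R axis i 1)"
          by eventually_elim (simp add: g(2))
        show ?thesis using D DERIV_cong_ev[OF refl ev refl] by blast
      qed
      then show "has_partials f x (grad f x)"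
        by (auto simp: has_partials_def grad_def DERIV_deriv_iff_real_differentiable real_differentiable_def)
    qed
  qed
  then show ?thesis
    using \<Omega> by (subst AE_restrict_space_iff) auto
qed

section \<open>Inequalities and limits of integrals\<close>

lemma Cauchy_Schwarz_integral:
  fixes f g :: "'a \<Rightarrow> real"
  assumes [measurable]: "f \<in> borel_measurable M" "g \<in> borel_measurable M"
    and f: "integrable M (\<lambda>x. (f x)\<^sup>2)" and g: "integrable M (\<lambda>x. (g x)\<^sup>2)"
  shows "integrable M (\<lambda>x. f x * g x)"
    and "(LINT x|M. \<bar>f x * g x\<bar>) \<le> sqrt (LINT x|M. (f x)\<^sup>2) * sqrt (LINT x|M. (g x)\<^sup>2)"
proof -
  show fg: "integrable M (\<lambda>x. f x * g x)"
  proof (rule Bochner_Integration.integrable_bound[OF Bochner_Integration.integrable_add[OF f g]])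
    have "\<bar>f x * g x\<bar> \<le> (f x)\<^sup>2 + (g x)\<^sup>2" for x
    proof -
      have "2 * (\<bar>f x\<bar> * \<bar>g x\<bar>) \<le> (f x)\<^sup>2 + (g x)\<^sup>2"
        using sum_squares_bound[of "\<bar>f x\<bar>" "\<bar>g x\<bar>"] by simp
      moreover have "0 \<le> \<bar>f x\<bar> * \<bar>g x\<bar>" by simp
      ultimately show ?thesis unfolding abs_mult by linarith
    qed
    then show "AE x in M. norm (f x * g x) \<le> norm ((f x)\<^sup>2 + (g x)\<^sup>2)" by (intro always_eventually) simp
  qed measurable
  have fg': "integrable M (\<lambda>x. \<bar>f x\<bar> * \<bar>g x\<bar>)" using integrable_abs[OF fg] by (simp add: abs_mult)
  have "(LINT x|M. \<bar>f x\<bar> * \<bar>g x\<bar>)\<^sup>2 \<le> (LINT x|M. (f x)\<^sup>2) * (LINT x|M. (g x)\<^sup>2)"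
  proof (rule nonneg_quadratic_discriminant)
    fix t :: real
    have "0 \<le> (LINT x|M. (\<bar>f x\<bar> + t * \<bar>g x\<bar>)\<^sup>2)" by simp
    also have "(\<lambda>x. (\<bar>f x\<bar> + t * \<bar>g x\<bar>)\<^sup>2) = (\<lambda>x. (f x)\<^sup>2 + 2 * t * (\<bar>f x\<bar> * \<bar>g x\<bar>) + t\<^sup>2 * (g x)\<^sup>2)"
      by (simp add: power2_sum power_mult_distrib algebra_simps)
    also have "(LINT x|M. (f x)\<^sup>2 + 2 * t * (\<bar>f x\<bar> * \<bar>g x\<bar>) + t\<^sup>2 * (g x)\<^sup>2)
        = (LINT x|M. (f x)\<^sup>2) + 2 * t * (LINT x|M. \<bar>f x\<bar> * \<bar>g x\<bar>) + t\<^sup>2 * (LINT x|M. (g x)\<^sup>2)"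
      using f g fg' by simp
    finally show "0 \<le> \<dots>" .
  qed
  then have "sqrt ((LINT x|M. \<bar>f x\<bar> * \<bar>g x\<bar>)\<^sup>2) \<le> sqrt ((LINT x|M. (f x)\<^sup>2) * (LINT x|M. (g x)\<^sup>2))"
    by (rule real_sqrt_le_mono)
  then show "(LINT x|M. \<bar>f x * g x\<bar>) \<le> sqrt (LINT x|M. (f x)\<^sup>2) * sqrt (LINT x|M. (g x)\<^sup>2)"
    by (simp add: real_sqrt_mult abs_mult)
qed

text \<open>Young's inequality for \<open>f\<close> and \<open>g\<close> divided by their norms.\<close>
lemma Holder_integral:
  fixes f g :: "'a \<Rightarrow> real"
  assumes p: "p > 1" "p' > 1" "1 / p + 1 / p' = 1"
    and [measurable]: "f \<in> borel_measurable M" "g \<in> borel_measurable M"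
    and f: "integrable M (\<lambda>x. \<bar>f x\<bar> powr p)" and g: "integrable M (\<lambda>x. \<bar>g x\<bar> powr p')"
  shows "integrable M (\<lambda>x. f x * g x)"
    and "(LINT x|M. \<bar>f x * g x\<bar>) \<le> (LINT x|M. \<bar>f x\<bar> powr p) powr (1 / p) * (LINT x|M. \<bar>g x\<bar> powr p') powr (1 / p')"
proof -
  have young: "\<bar>a * b\<bar> \<le> \<bar>a\<bar> powr p / p + \<bar>b\<bar> powr p' / p'" for a b :: real
    using Youngs_inequality[OF p, of "\<bar>a\<bar>" "\<bar>b\<bar>"] by (simp add: abs_mult)
  have dom: "integrable M (\<lambda>x. \<bar>f x\<bar> powr p / p + \<bar>g x\<bar> powr p' / p')"
    using f g by (intro Bochner_Integration.integrable_add integrable_divide) auto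
  show fg: "integrable M (\<lambda>x. f x * g x)"
    by (rule Bochner_Integration.integrable_bound[OF dom])
       (auto intro!: always_eventually order_trans[OF young])
  define A where "A = (LINT x|M. \<bar>f x\<bar> powr p)"
  define B where "B = (LINT x|M. \<bar>g x\<bar> powr p')"
  have A0: "A \<ge> 0" and B0: "B \<ge> 0" by (auto simp: A_def B_def)
  have "(LINT x|M. \<bar>f x * g x\<bar>) \<le> A powr (1 / p) * B powr (1 / p')"
  proof (cases "A = 0 \<or> B = 0")
    case True
    then have "(AE x in M. \<bar>f x\<bar> powr p = 0) \<or> (AE x in M. \<bar>g x\<bar> powr p' = 0)"
      using integral_nonneg_eq_0_iff_AE[OF f] integral_nonneg_eq_0_iff_AE[OF g] by (auto simp: A_def B_def)
    then have "AE x in M. \<bar>f x * g x\<bar> = 0" 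
    proof
      assume "AE x in M. \<bar>f x\<bar> powr p = 0"
      then show ?thesis by eventually_elim auto
    next
      assume "AE x in M. \<bar>g x\<bar> powr p' = 0"
      then show ?thesis by eventually_elim auto
    qed
    then have "(LINT x|M. \<bar>f x * g x\<bar>) = 0" using integral_cong_AE[of "\<lambda>x. \<bar>f x * g x\<bar>" M "\<lambda>x. 0"] by simp
    then show ?thesis by simp
  next
    case False
    then have AB: "A > 0" "B > 0" using A0 B0 by auto
    define a where "a = A powr (1 / p)"
    define b where "b = B powr (1 / p')"
    have ab: "a > 0" "b > 0" "a powr p = A" "b powr p' = B" using AB p by (auto simp: a_def b_def powr_powr)
    have "(LINT x|M. \<bar>f x * g x\<bar>) / (a * b) = (LINT x|M. \<bar>f x * g x\<bar> / (a * b))" by simp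
    also have "\<dots> \<le> (LINT x|M. \<bar>f x\<bar> powr p / (A * p) + \<bar>g x\<bar> powr p' / (B * p'))"
    proof (rule integral_mono)
      show "integrable M (\<lambda>x. \<bar>f x * g x\<bar> / (a * b))" using fg by (intro integrable_divide) auto
      show "integrable M (\<lambda>x. \<bar>f x\<bar> powr p / (A * p) + \<bar>g x\<bar> powr p' / (B * p'))"
        using f g by (intro Bochner_Integration.integrable_add integrable_divide) auto
      fix x
      show "\<bar>f x * g x\<bar> / (a * b) \<le> \<bar>f x\<bar> powr p / (A * p) + \<bar>g x\<bar> powr p' / (B * p')"
        using young[of "f x / a" "g x / b"] ab by (simp add: powr_divide abs_mult)
    qed
    also have "\<dots> = A / (A * p) + B / (B * p')" using f g by (simp add: A_def B_def)
    also have "\<dots> = 1" using AB p by simp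
    finally show ?thesis using ab by (simp add: a_def b_def divide_le_eq)
  qed
  then show "(LINT x|M. \<bar>f x * g x\<bar>) \<le> (LINT x|M. \<bar>f x\<bar> powr p) powr (1 / p) * (LINT x|M. \<bar>g x\<bar> powr p') powr (1 / p')"
    by (simp add: A_def B_def)
qed

lemma integrable_integral_le_nn:
  fixes f :: "'a \<Rightarrow> real"
  assumes f: "f \<in> borel_measurable M" "AE x in M. 0 \<le> f x" and le: "(\<integral>\<^sup>+x. ennreal (f x) \<partial>M) \<le> ennreal a" and a: "a \<ge> 0"
  shows "integrable M f" "integral\<^sup>L M f \<le> a"
proof -
  show int: "integrable M f"
    using f le by (intro integrableI_nonneg) (auto intro: order.strict_trans1)
  have "ennreal (integral\<^sup>L M f) \<le> ennreal a"
    using nn_integral_eq_integral[OF int f(2)] le by simp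
  then show "integral\<^sup>L M f \<le> a" using a by (simp add: ennreal_le_iff)
qed

lemma Fatou_integral:
  fixes f :: "nat \<Rightarrow> 'a \<Rightarrow> real"
  assumes f: "\<And>n. integrable M (f n)" "\<And>n x. 0 \<le> f n x"
    and lim: "AE x in M. (\<lambda>n. f n x) \<longlonglongrightarrow> g x" and g: "g \<in> borel_measurable M"
    and bound: "\<And>n. integral\<^sup>L M (f n) \<le> a n" and a: "a \<longlonglongrightarrow> c"
  shows "integrable M g" "integral\<^sup>L M g \<le> c"
proof -
  have meas [measurable]: "f n \<in> borel_measurable M" for n using f(1) by auto
  have a_nonneg: "a n \<ge> 0" for n
  proof -
    have "0 \<le> integral\<^sup>L M (f n)" by (intro integral_nonneg_AE always_eventually allI f(2))
    then show ?thesis using bound[of n] by linarith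
  qed
  have c: "c \<ge> 0" using a a_nonneg by (intro LIMSEQ_le_const) auto
  have g_nonneg: "AE x in M. 0 \<le> g x"
    using lim by eventually_elim (use f(2) in \<open>auto intro!: LIMSEQ_le_const\<close>)
  have "(\<integral>\<^sup>+x. ennreal (g x) \<partial>M) = (\<integral>\<^sup>+x. liminf (\<lambda>n. ennreal (f n x)) \<partial>M)"
  proof (rule nn_integral_cong_AE)
    show "AE x in M. ennreal (g x) = liminf (\<lambda>n. ennreal (f n x))"
      using lim
    proof eventually_elim
      case (elim x)
      then have "(\<lambda>n. ennreal (f n x)) \<longlonglongrightarrow> ennreal (g x)" by (rule tendsto_ennrealI)
      then show ?case by (simp add: lim_imp_Liminf)
    qed
  qed
  also have "\<dots> \<le> liminf (\<lambda>n. \<integral>\<^sup>+x. ennreal (f n x) \<partial>M)" by (rule nn_integral_liminf) measurable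
  also have "\<dots> \<le> liminf (\<lambda>n. ennreal (a n))"
    using f bound by (intro Liminf_mono always_eventually allI) (simp add: nn_integral_eq_integral ennreal_leI)
  also have "\<dots> = ennreal c" using a by (intro lim_imp_Liminf tendsto_ennrealI) auto
  finally have "(\<integral>\<^sup>+x. ennreal (g x) \<partial>M) \<le> ennreal c" .
  from integrable_integral_le_nn[OF g g_nonneg this c]
  show "integrable M g" "integral\<^sup>L M g \<le> c" .
qed

text \<open>Weighted bounds on a sequence pass to its limit in \<open>L\<^sup>2\<close>, along a subsequence that converges almost everywhere.\<close>
lemma Fatou_L2:
  fixes f :: "nat \<Rightarrow> 'a \<Rightarrow> real"
  assumes [measurable]: "g \<in> borel_measurable M" "w \<in> borel_measurable M"
    and conv: "\<And>n. integrable M (\<lambda>x. (f n x - g x)\<^sup>2)" "(\<lambda>n. LINT x|M. (f n x - g x)\<^sup>2) \<longlonglongrightarrow> 0"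
    and w: "\<And>x. 0 \<le> w x"
    and bound: "\<And>n. integrable M (\<lambda>x. w x * (f n x)\<^sup>2)" "\<And>n. (LINT x|M. w x * (f n x)\<^sup>2) \<le> a n" and a: "a \<longlonglongrightarrow> c"
  shows "integrable M (\<lambda>x. w x * (g x)\<^sup>2)" "(LINT x|M. w x * (g x)\<^sup>2) \<le> c"
proof -
  obtain r where r: "strict_mono r" "AE x in M. (\<lambda>n. (f (r n) x - g x)\<^sup>2) \<longlonglongrightarrow> 0"
    using tendsto_L1_AE_subseq[of M "\<lambda>n x. (f n x - g x)\<^sup>2"] conv by auto
  have lim: "AE x in M. (\<lambda>n. w x * (f (r n) x)\<^sup>2) \<longlonglongrightarrow> w x * (g x)\<^sup>2"
    using r(2)
  proof eventually_elim
    case (elim x)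
    then have "(\<lambda>n. f (r n) x - g x) \<longlonglongrightarrow> 0"
      using tendsto_real_sqrt[OF elim] by (simp add: tendsto_rabs_zero_iff)
    then have "(\<lambda>n. f (r n) x) \<longlonglongrightarrow> g x" by (simp add: LIM_zero_iff)
    then show ?case by (intro tendsto_intros)
  qed
  have "(a \<circ> r) \<longlonglongrightarrow> c" using a r(1) by (rule LIMSEQ_subseq_LIMSEQ)
  then have a': "(\<lambda>n. a (r n)) \<longlonglongrightarrow> c" by (simp add: o_def)
  have nonneg: "0 \<le> w x * (f (r n) x)\<^sup>2" for n x using w by simp
  have meas: "(\<lambda>x. w x * (g x)\<^sup>2) \<in> borel_measurable M" by measurable
  show "integrable M (\<lambda>x. w x * (g x)\<^sup>2)" "(LINT x|M. w x * (g x)\<^sup>2) \<le> c"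
    by (rule Fatou_integral[OF bound(1) nonneg lim meas bound(2) a'])+
qed

text \<open>
  Completeness of a space of vector functions whose squared norm is the integral of \<open>N x (z x)\<close>, where \<open>N x\<close> is, in the
  applications, a quadratic form that depends on the point.  Since the increments have size \<open>4\<^sup>-\<^sup>n\<close>, the series \<open>\<Sum> 2\<^sup>n N x (z\<^bsub>n+1\<^esub> x - z\<^sub>n x)\<close> converges almost everywhere;
  as \<open>N x\<close> is bounded below by a multiple of the Euclidean norm, with a constant depending on \<open>x\<close>, the sequence
  itself converges at these points.  Fatou's lemma identifies the limit in the norm.
\<close>
theorem Riesz_Fischer_pointwise:
  fixes z :: "nat \<Rightarrow> 'a \<Rightarrow> 'b::euclidean_space" and N :: "'a \<Rightarrow> 'b \<Rightarrow> real"
  assumes z [measurable]: "\<And>n. z n \<in> borel_measurable M"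
    and N_meas: "\<And>w. w \<in> borel_measurable M \<Longrightarrow> (\<lambda>x. N x (w x)) \<in> borel_measurable M"
    and N_nonneg: "\<And>x w. x \<in> space M \<Longrightarrow> 0 \<le> N x w"
    and N_cont: "\<And>x. x \<in> space M \<Longrightarrow> continuous_on UNIV (N x)"
    and N_coercive: "AE x in M. \<exists>c>0. \<forall>w. c * (norm w)\<^sup>2 \<le> N x w"
    and int: "\<And>m n. integrable M (\<lambda>x. N x (z m x - z n x))"
    and bound: "\<And>m n. n \<le> m \<Longrightarrow> (LINT x|M. N x (z m x - z n x)) \<le> C / 4 ^ n"
  obtains y where "y \<in> borel_measurable M" "\<And>n. integrable M (\<lambda>x. N x (y x - z n x))"
    "\<And>n. (LINT x|M. N x (y x - z n x)) \<le> C / 4 ^ n"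
proof -
  define d where "d n x = N x (z (Suc n) x - z n x)" for n x
  have d_meas [measurable]: "d n \<in> borel_measurable M" for n
    unfolding d_def by (intro N_meas) measurable
  have C: "C \<ge> 0"
  proof -
    have "0 \<le> (LINT x|M. N x (z 0 x - z 0 x))" using N_nonneg by (intro integral_nonneg_AE AE_I2)
    then show ?thesis using bound[of 0 0] by simp
  qed
  have term_le: "(\<integral>\<^sup>+x. ennreal (2 ^ n * d n x) \<partial>M) \<le> ennreal (C / 2 ^ n)" for n
  proof -
    have "(\<integral>\<^sup>+x. ennreal (2 ^ n * d n x) \<partial>M) = ennreal (LINT x|M. 2 ^ n * d n x)"
      using int[of "Suc n" n] N_nonneg unfolding d_def by (intro nn_integral_eq_integral) auto
    also have "(LINT x|M. 2 ^ n * d n x) \<le> 2 ^ n * (C / 4 ^ n)"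
      using mult_left_mono[OF bound[of n "Suc n"], of "2 ^ n"] unfolding d_def by simp
    also have "2 ^ n * (C / 4 ^ n) = C / 2 ^ n"
      by (simp add: divide_simps flip: power_mult_distrib)
    finally show ?thesis by (simp add: ennreal_leI)
  qed
  have "(\<integral>\<^sup>+x. (\<Sum>n. ennreal (2 ^ n * d n x)) \<partial>M) = (\<Sum>n. \<integral>\<^sup>+x. ennreal (2 ^ n * d n x) \<partial>M)"
    by (rule nn_integral_suminf) measurable
  also have "\<dots> \<le> (\<Sum>n. ennreal (C / 2 ^ n))" by (intro suminf_le term_le) auto
  also have "\<dots> = ennreal (\<Sum>n. C / 2 ^ n)"
    using C summable_mult[OF summable_geometric[of "1 / 2 :: real"], of C]
    by (intro suminf_ennreal2) (auto simp: power_one_over)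
  also have "\<dots> < \<infinity>" by simp
  finally have "AE x in M. (\<Sum>n. ennreal (2 ^ n * d n x)) \<noteq> \<infinity>"
    by (intro nn_integral_PInf_AE) auto
  then have conv: "AE x in M. convergent (\<lambda>n. z n x)"
    using N_coercive AE_space
  proof eventually_elim
    case (elim x)
    then obtain c where c: "c > 0" "\<And>w. c * (norm w)\<^sup>2 \<le> N x w" by blast
    obtain b where b: "(\<Sum>n. ennreal (2 ^ n * d n x)) = ennreal b" "b \<ge> 0"
      using elim(1) by (cases "\<Sum>n. ennreal (2 ^ n * d n x)") auto
    have le: "norm (z (Suc n) x - z n x) \<le> sqrt (b / c) * (1 / sqrt 2) ^ n" for n
    proof -
      have "ennreal (2 ^ n * d n x) \<le> ennreal b"
        unfolding b(1)[symmetric] using sum_le_suminf[of "\<lambda>n. ennreal (2 ^ n * d n x)" "{n}"] by simp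
      then have "2 ^ n * d n x \<le> b" using b(2) by (simp add: ennreal_le_iff)
      moreover have "c * (norm (z (Suc n) x - z n x))\<^sup>2 \<le> d n x" unfolding d_def by (rule c(2))
      ultimately have "2 ^ n * (c * (norm (z (Suc n) x - z n x))\<^sup>2) \<le> b"
        by (meson mult_left_mono order_trans zero_le_numeral zero_le_power)
      then have "(norm (z (Suc n) x - z n x))\<^sup>2 \<le> b / c * (1 / 2) ^ n"
        using c(1) by (simp add: field_simps power_one_over)
      then have "sqrt ((norm (z (Suc n) x - z n x))\<^sup>2) \<le> sqrt (b / c * (1 / 2) ^ n)"
        by (rule real_sqrt_le_mono)
      then show ?thesis by (simp add: real_sqrt_mult real_sqrt_power real_sqrt_divide)
    qed
    have "summable (\<lambda>n. sqrt (b / c) * (1 / sqrt 2) ^ n)"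
      by (intro summable_mult summable_geometric) (simp add: field_simps)
    then have "summable (\<lambda>n. z (Suc n) x - z n x)"
      by (rule summable_comparison_test[rotated]) (use le in auto)
    then have "convergent (\<lambda>n. \<Sum>i<n. z (Suc i) x - z i x)" by (simp add: summable_iff_convergent)
    then have "convergent (\<lambda>n. z n x - z 0 x)" using sum_lessThan_telescope[of "\<lambda>n. z n x"] by (simp only:)
    then have "convergent (\<lambda>n. (z n x - z 0 x) + z 0 x)" by (intro convergent_add convergent_const)
    then show ?case by simp
  qed
  define y where "y x = lim (\<lambda>n. z n x)" for x
  have y_meas [measurable]: "y \<in> borel_measurable M" unfolding y_def by measurable
  have lim: "AE x in M. (\<lambda>m. N x (z m x - z n x)) \<longlonglongrightarrow> N x (y x - z n x)" for n
    using conv AE_space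
  proof eventually_elim
    case (elim x)
    have "(\<lambda>m. z m x - z n x) \<longlonglongrightarrow> y x - z n x"
      using elim(1) unfolding y_def by (intro tendsto_diff tendsto_const) (simp add: convergent_LIMSEQ_iff)
    then show ?case
      using N_cont[OF elim(2)] continuous_on_tendsto_compose[of UNIV "N x"] by auto
  qed
  have fin: "integrable M (\<lambda>x. N x (y x - z n x))" "(LINT x|M. N x (y x - z n x)) \<le> C / 4 ^ n" for n
  proof -
    define P where "P w x = (if x \<in> space M then N x w else 0)" for w x
    have P: "P w x = N x w" if "x \<in> space M" for w x using that by (simp add: P_def)
    have cong: "integrable M (\<lambda>x. P (w x) x) = integrable M (\<lambda>x. N x (w x))"
        "(LINT x|M. P (w x) x) = (LINT x|M. N x (w x))" for w
      by (auto simp: P intro!: Bochner_Integration.integrable_cong Bochner_Integration.integral_cong)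
    have F3: "AE x in M. (\<lambda>m. P (z (m + n) x - z n x) x) \<longlonglongrightarrow> P (y x - z n x) x"
      using lim[of n] AE_space by eventually_elim (use P LIMSEQ_ignore_initial_segment[where k = n] in force)
    have F4: "(\<lambda>x. P (y x - z n x) x) \<in> borel_measurable M"
      using N_meas[of "\<lambda>x. y x - z n x"] by (subst measurable_cong[OF P]) auto
    have F1: "integrable M (\<lambda>x. P (z (m + n) x - z n x) x)" for m
      unfolding cong by (rule int)
    have F2: "0 \<le> P (z (m + n) x - z n x) x" for m x
      using N_nonneg by (simp add: P_def)
    have F5: "(LINT x|M. P (z (m + n) x - z n x) x) \<le> C / 4 ^ n" for m
      unfolding cong by (rule bound) simp
    have "integrable M (\<lambda>x. P (y x - z n x) x)" "(LINT x|M. P (y x - z n x) x) \<le> C / 4 ^ n"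
      by (rule Fatou_integral[OF F1 F2 F3 F4 F5 tendsto_const])+
    then show "integrable M (\<lambda>x. N x (y x - z n x))" "(LINT x|M. N x (y x - z n x)) \<le> C / 4 ^ n"
      by (simp_all add: cong)
  qed
  show ?thesis using that[OF y_meas fin] .
qed

text \<open>On the set where \<open>h \<le> n\<close> the integral over \<open>A\<close> is at most \<open>n\<close> times the measure of \<open>A\<close>; the rest is small for large \<open>n\<close>.\<close>
lemma integrable_absolutely_continuous:
  fixes h :: "'a \<Rightarrow> real"
  assumes h: "integrable M h" "\<And>x. 0 \<le> h x" and \<epsilon>: "\<epsilon> > 0" and fin: "finite_measure M"
  obtains \<delta> where "\<delta> > 0" "\<And>A. A \<in> sets M \<Longrightarrow> measure M A < \<delta> \<Longrightarrow> (LINT x|M. indicator A x * h x) < \<epsilon>"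
proof -
  interpret finite_measure M by (rule fin)
  have [measurable]: "h \<in> borel_measurable M" using h by auto
  have "(\<lambda>n. LINT x|M. indicator {x\<in>space M. real n < h x} x * h x) \<longlonglongrightarrow> (LINT x|M. 0)"
  proof (rule integral_dominated_convergence[where w = h])
    show "AE x in M. (\<lambda>n. indicator {x\<in>space M. real n < h x} x * h x) \<longlonglongrightarrow> 0"
    proof (rule AE_I2)
      fix x assume "x \<in> space M"
      obtain n0 :: nat where "h x \<le> real n0" using real_arch_simple by blast
      then have "\<forall>\<^sub>F n in sequentially. indicator {x\<in>space M. real n < h x} x * h x = 0"
        by (auto simp: eventually_sequentially indicator_def intro!: exI[of _ n0])
      then show "(\<lambda>n. indicator {x\<in>space M. real n < h x} x * h x) \<longlonglongrightarrow> 0" by (rule tendsto_eventually)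
    qed
    show "AE x in M. norm (indicator {x\<in>space M. real n < h x} x * h x) \<le> h x" for n
      using h(2) by (intro always_eventually) (auto simp: indicator_def)
  qed (use h in auto)
  then have "\<forall>\<^sub>F n in sequentially. (LINT x|M. indicator {x\<in>space M. real n < h x} x * h x) < \<epsilon> / 2"
    using \<epsilon> by (intro order_tendstoD(2)) auto
  then obtain n where n: "(LINT x|M. indicator {x\<in>space M. real n < h x} x * h x) < \<epsilon> / 2"
    using eventually_happens'[OF sequentially_bot] by blast
  define \<delta> where "\<delta> = \<epsilon> / (2 * (real n + 1))"
  have "\<delta> > 0" using \<epsilon> by (simp add: \<delta>_def add_nonneg_pos)
  moreover have "(LINT x|M. indicator A x * h x) < \<epsilon>" if A [measurable]: "A \<in> sets M" "measure M A < \<delta>" for A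
  proof -
    have iA: "integrable M (\<lambda>x. real n * indicator A x)"
      using A by (intro integrable_mult_right integrable_real_indicator) (auto simp: less_top[symmetric])
    have ih: "integrable M (\<lambda>x. indicator B x * h x)" if "B \<in> sets M" for B
      using integrable_mult_indicator[OF that h(1)] by simp
    have "(LINT x|M. indicator A x * h x) \<le> (LINT x|M. indicator {x\<in>space M. real n < h x} x * h x + real n * indicator A x)"
    proof (rule integral_mono)
      show "integrable M (\<lambda>x. indicator {x\<in>space M. real n < h x} x * h x + real n * indicator A x)"
        using iA ih[of "{x\<in>space M. real n < h x}"] by (intro Bochner_Integration.integrable_add) auto
      show "indicator A x * h x \<le> indicator {x\<in>space M. real n < h x} x * h x + real n * indicator A x"
        if "x \<in> space M" for x
        using that h(2)[of x] by (auto simp: indicator_def)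
    qed (use ih A in auto)
    also have "\<dots> = (LINT x|M. indicator {x\<in>space M. real n < h x} x * h x) + real n * measure M A"
      using iA ih[of "{x\<in>space M. real n < h x}"] A by (subst Bochner_Integration.integral_add) auto
    also have "real n * measure M A \<le> real n * \<delta>" using A(2) by (intro mult_left_mono) auto
    also have "real n * \<delta> \<le> \<epsilon> / 2" using \<epsilon> by (simp add: \<delta>_def field_simps)
    finally show ?thesis using n by linarith
  qed
  ultimately show ?thesis using that by blast
qed

lemma borel_measurable_lebesgue_on_AE:
  assumes f: "f \<in> borel_measurable (lebesgue_on \<Omega>)" and \<Omega>: "\<Omega> \<in> sets lebesgue"
    and eq: "AE x in lebesgue_on \<Omega>. f x = g x"
  shows "g \<in> borel_measurable (lebesgue_on \<Omega>)"
proof -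
  interpret complete_measure "lebesgue_on \<Omega>"
  proof
    fix A B assume "A \<subseteq> B" "B \<in> null_sets (lebesgue_on \<Omega>)"
    then show "A \<in> sets (lebesgue_on \<Omega>)"
      using \<Omega> completion.complete2 by (metis Int_absorb2 null_setsD2 null_sets_restrict_space order_trans sets.sets_into_space space_restrict_space2 sets_restrict_space_iff)
  qed
  show ?thesis
  proof (rule measurableI)
    fix A :: "'b set" assume A: "A \<in> sets borel"
    show "g -` A \<inter> space (lebesgue_on \<Omega>) \<in> sets (lebesgue_on \<Omega>)"
    proof (rule in_sets_AE)
      show "f -` A \<inter> space (lebesgue_on \<Omega>) \<in> sets (lebesgue_on \<Omega>)" using f A by (rule measurable_sets)
      show "AE x in lebesgue_on \<Omega>. (x \<in> f -` A \<inter> space (lebesgue_on \<Omega>)) = (x \<in> g -` A \<inter> space (lebesgue_on \<Omega>))"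
        using eq by eventually_elim auto
    qed auto
  qed auto
qed

section \<open>Lipschitz functions with compact support\<close>

lemma compact_closed_subset: "compact B \<Longrightarrow> closed A \<Longrightarrow> A \<subseteq> B \<Longrightarrow> compact A"
  using compact_Int_closed[of B A] by (simp add: Int_absorb1)

lemma Lip0_add:
  assumes "\<phi> \<in> Lip0 \<Omega>" "\<psi> \<in> Lip0 \<Omega>"
  shows "(\<lambda>x. \<phi> x + \<psi> x) \<in> Lip0 \<Omega>"
proof -
  obtain L M where "L-lipschitz_on \<Omega> \<phi>" "M-lipschitz_on \<Omega> \<psi>" using assms by (auto simp: Lip0_def)
  then have "(L + M)-lipschitz_on \<Omega> (\<lambda>x. \<phi> x + \<psi> x)" by (rule lipschitz_on_add)
  moreover have "closure (support_on \<Omega> (\<lambda>x. \<phi> x + \<psi> x)) \<subseteq> closure (support_on \<Omega> \<phi>) \<union> closure (support_on \<Omega> \<psi>)"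
    unfolding closure_Un[symmetric] by (intro closure_mono) (auto simp: support_on_def)
  moreover have "compact (closure (support_on \<Omega> \<phi>) \<union> closure (support_on \<Omega> \<psi>))"
    using assms by (intro compact_Un) (auto simp: Lip0_def)
  ultimately show ?thesis using assms unfolding Lip0_def
    by (auto intro: compact_closed_subset[OF _ closed_closure] simp del: compact_closure)
qed

lemma Lip0_bounded:
  assumes "bounded \<Omega>" "\<phi> \<in> Lip0 \<Omega>"
  obtains b where "b \<ge> 0" "\<And>x. x \<in> \<Omega> \<Longrightarrow> \<bar>\<phi> x\<bar> \<le> b"
proof -
  obtain L where L: "L-lipschitz_on \<Omega> \<phi>" using assms by (auto simp: Lip0_def)
  have "bounded (\<phi> ` \<Omega>)"
    using lipschitz_on_uniformly_continuous[OF L] assms(1) by (rule bounded_uniformly_continuous_image)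
  then obtain b where "\<And>x. x \<in> \<Omega> \<Longrightarrow> norm (\<phi> x) \<le> b" by (auto simp: bounded_iff)
  then show ?thesis using that[of "\<bar>b\<bar>"] by (metis abs_ge_zero abs_of_nonneg order_trans abs_ge_self real_norm_def)
qed

lemma Lip0_compose:
  assumes \<phi>: "\<phi> \<in> Lip0 \<Omega>" and \<Omega>: "bounded \<Omega>"
    and T: "\<And>s. (T has_real_derivative T' s) (at s)" "continuous_on UNIV T'" "T 0 = 0"
  shows "(\<lambda>x. T (\<phi> x)) \<in> Lip0 \<Omega>"
proof -
  obtain L where L: "L-lipschitz_on \<Omega> \<phi>" using \<phi> by (auto simp: Lip0_def)
  obtain b where b: "b \<ge> 0" "\<And>x. x \<in> \<Omega> \<Longrightarrow> \<bar>\<phi> x\<bar> \<le> b" using Lip0_bounded[OF \<Omega> \<phi>] by blast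
  have "bounded (T' ` {-b..b})"
    by (intro compact_imp_bounded compact_continuous_image continuous_on_subset[OF T(2)]) auto
  then obtain c where c: "\<And>s. s \<in> {-b..b} \<Longrightarrow> norm (T' s) \<le> c"
    unfolding bounded_iff by blast
  have c0: "c \<ge> 0" using c[of 0] b(1) by (auto intro: order_trans[OF norm_ge_zero])
  have "c-lipschitz_on {-b..b} T"
    using c c0 by (intro bounded_derivative_imp_lipschitz[where f' = "\<lambda>s h. T' s * h"])
      (auto intro!: has_field_derivative_imp_has_derivative T(1)[THEN has_field_derivative_at_within]
        onorm_le simp: abs_mult mult_right_mono)
  then have "c-lipschitz_on (\<phi> ` \<Omega>) T" by (rule lipschitz_on_subset) (use b(2) in \<open>auto simp: abs_le_iff minus_le_iff\<close>)
  then have "(c * L)-lipschitz_on \<Omega> (T \<circ> \<phi>)" by (rule lipschitz_on_compose[OF L])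
  moreover have "closure (support_on \<Omega> (\<lambda>x. T (\<phi> x))) \<subseteq> closure (support_on \<Omega> \<phi>)"
    using T(3) by (intro closure_mono) (auto simp: support_on_def)
  ultimately show ?thesis using \<phi> unfolding Lip0_def o_def
    by (auto intro: compact_closed_subset[OF _ closed_closure] simp del: compact_closure)
qed

lemma Lip0_measurable:
  assumes "open \<Omega>" "\<phi> \<in> Lip0 \<Omega>"
  shows "\<phi> \<in> borel_measurable (lebesgue_on \<Omega>)"
  using assms by (auto simp: Lip0_def intro!: continuous_imp_measurable_on_sets_lebesgue lipschitz_on_continuous_on)

lemma Lip0_has_partials_AE:
  "open \<Omega> \<Longrightarrow> \<phi> \<in> Lip0 \<Omega> \<Longrightarrow> AE x in lebesgue_on \<Omega>. has_partials \<phi> x (grad \<phi> x)"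
  by (auto simp: Lip0_def intro: lipschitz_has_partials_AE)

section \<open>The weighted spaces\<close>

text \<open>
  Pointwise operations turn pairs \<open>(u, Du)\<close> of functions into a real vector space, so that \<open>QH0\<close> can be treated as
  a subspace.
\<close>
instantiation "fun" :: (type, real_vector) real_vector
begin

definition scaleR_fun_def: "c *\<^sub>R f = (\<lambda>x. c *\<^sub>R f x)"

instance
  by standard (simp_all add: scaleR_fun_def fun_eq_iff scaleR_add_right scaleR_add_left)

end

lemma scaleR_fun_apply [simp]: "(c *\<^sub>R f) x = c *\<^sub>R f x"
  by (simp add: scaleR_fun_def)

locale degenerate_space =
  fixes \<Omega> :: "(real ^ 'n) set" and v :: "real ^ 'n \<Rightarrow> real" and Q :: "real ^ 'n \<Rightarrow> real ^ 'n ^ 'n"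
  assumes \<Omega>_open: "open \<Omega>" and \<Omega>_bounded: "bounded \<Omega>"
    and weight: "weight_on \<Omega> v" and v_integrable: "integrable (lebesgue_on \<Omega>) v"
    and Q: "matrix_function_on \<Omega> Q"
begin

abbreviation M :: "(real ^ 'n) measure" where "M \<equiv> lebesgue_on \<Omega>"

text \<open>The measure \<open>v dx\<close>.  As \<open>v > 0\<close> almost everywhere, it has the null sets of Lebesgue measure.\<close>
definition \<nu> :: "(real ^ 'n) measure" where "\<nu> = density M (\<lambda>x. ennreal (v x))"

lemma v_meas [measurable]: "v \<in> borel_measurable M" and v_nonneg: "x \<in> \<Omega> \<Longrightarrow> 0 \<le> v x"
  and v_pos: "AE x in M. 0 < v x"
  using weight by (auto simp: weight_on_def)

lemma \<Omega>_lebesgue [measurable]: "\<Omega> \<in> sets lebesgue" using \<Omega>_open by simp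

lemma sets_\<nu> [simp, measurable_cong]: "sets \<nu> = sets M" by (simp add: \<nu>_def)

lemma space_\<nu> [simp]: "space \<nu> = \<Omega>" by (simp add: \<nu>_def)

lemma borel_measurable_\<nu> [simp]: "borel_measurable \<nu> = borel_measurable M"
  by (rule measurable_cong_sets) auto

lemma AE_\<nu>: "(AE x in \<nu>. P x) \<longleftrightarrow> (AE x in M. P x)"
proof -
  have "(AE x in \<nu>. P x) \<longleftrightarrow> (AE x in M. 0 < v x \<longrightarrow> P x)"
    unfolding \<nu>_def by (subst AE_density) auto
  also have "\<dots> \<longleftrightarrow> (AE x in M. P x)"
  proof
    assume "AE x in M. 0 < v x \<longrightarrow> P x"
    then show "AE x in M. P x" using v_pos by eventually_elim auto
  qed auto
  finally show ?thesis .
qed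

lemma v_nonneg_AE: "AE x in M. 0 \<le> v x" by (rule AE_I2) (simp add: v_nonneg)

lemma integrable_\<nu>:
  fixes f :: "real ^ 'n \<Rightarrow> real"
  shows "f \<in> borel_measurable M \<Longrightarrow> integrable \<nu> f \<longleftrightarrow> integrable M (\<lambda>x. f x * v x)"
  unfolding \<nu>_def using v_nonneg_AE by (subst integrable_density) (auto simp: mult.commute)

lemma integral_\<nu>:
  fixes f :: "real ^ 'n \<Rightarrow> real"
  shows "f \<in> borel_measurable M \<Longrightarrow> (LINT x|\<nu>. f x) = (LINT x|M. f x * v x)"
  unfolding \<nu>_def using v_nonneg_AE by (subst integral_density) (auto simp: mult.commute)

lemma finite_\<nu>: "finite_measure \<nu>"
proof -
  have "integrable \<nu> (\<lambda>x. 1 :: real)" using v_integrable by (subst integrable_\<nu>) auto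
  then show ?thesis by (intro finite_measureI) (simp add: integrable_iff_bounded less_top)
qed

lemma weighted_Lp_iff:
  fixes f :: "real ^ 'n \<Rightarrow> 'b::euclidean_space"
  shows "f \<in> weighted_Lp p v \<Omega> \<longleftrightarrow> f \<in> borel_measurable M \<and> integrable \<nu> (\<lambda>x. norm (f x) powr p)"
  unfolding weighted_Lp_def by (auto simp: integrable_\<nu>)

lemma weighted_Lp_norm_eq:
  fixes f :: "real ^ 'n \<Rightarrow> 'b::euclidean_space"
  shows "f \<in> borel_measurable M \<Longrightarrow> weighted_Lp_norm p v \<Omega> f = (LINT x|\<nu>. norm (f x) powr p) powr (1 / p)"
  unfolding weighted_Lp_norm_def by (simp add: integral_\<nu>)

definition L2 :: "(real ^ 'n \<Rightarrow> real) set" where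
  "L2 = {f. f \<in> borel_measurable M \<and> integrable \<nu> (\<lambda>x. (f x)\<^sup>2)}"

lemma weighted_L2: "(f :: real ^ 'n \<Rightarrow> real) \<in> weighted_Lp 2 v \<Omega> \<longleftrightarrow> f \<in> L2"
  unfolding weighted_Lp_iff L2_def by simp

lemma weighted_L2_norm:
  fixes f :: "real ^ 'n \<Rightarrow> real"
  shows "f \<in> borel_measurable M \<Longrightarrow> weighted_Lp_norm 2 v \<Omega> f = sqrt (LINT x|\<nu>. (f x)\<^sup>2)"
  by (simp add: weighted_Lp_norm_eq powr_half_sqrt)

lemma L2_dominated:
  assumes f: "f \<in> borel_measurable M" and g: "g \<in> L2" and le: "\<And>x. x \<in> \<Omega> \<Longrightarrow> \<bar>f x\<bar> \<le> c * \<bar>g x\<bar>"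
  shows "f \<in> L2"
proof -
  have "integrable \<nu> (\<lambda>x. c\<^sup>2 * (g x)\<^sup>2)" using g by (auto simp: L2_def)
  moreover have "(f x)\<^sup>2 \<le> c\<^sup>2 * (g x)\<^sup>2" if "x \<in> \<Omega>" for x
    using power_mono[OF le[OF that], of 2] by (simp add: power_mult_distrib)
  ultimately have "integrable \<nu> (\<lambda>x. (f x)\<^sup>2)"
    by (intro Bochner_Integration.integrable_bound[of \<nu> "\<lambda>x. c\<^sup>2 * (g x)\<^sup>2" "\<lambda>x. (f x)\<^sup>2"] AE_I2) (use f in auto)
  then show ?thesis using f by (simp add: L2_def)
qed

lemma sum_sq_le: "(a + b)\<^sup>2 \<le> 2 * a\<^sup>2 + 2 * (b::real)\<^sup>2"
  using sum_squares_bound[of a b] by (simp add: power2_sum)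

lemma L2_add: assumes "f \<in> L2" "g \<in> L2" shows "(\<lambda>x. f x + g x) \<in> L2"
proof -
  have m: "f \<in> borel_measurable M" "g \<in> borel_measurable M" using assms by (auto simp: L2_def)
  have "integrable \<nu> (\<lambda>x. 2 * (f x)\<^sup>2 + 2 * (g x)\<^sup>2)" using assms by (auto simp: L2_def)
  then have "integrable \<nu> (\<lambda>x. (f x + g x)\<^sup>2)"
  proof (rule Bochner_Integration.integrable_bound)
    have "norm ((f x + g x)\<^sup>2) \<le> norm (2 * (f x)\<^sup>2 + 2 * (g x)\<^sup>2)" for x
      using sum_sq_le[of "f x" "g x"] by simp
    then show "AE x in \<nu>. norm ((f x + g x)\<^sup>2) \<le> norm (2 * (f x)\<^sup>2 + 2 * (g x)\<^sup>2)" by simp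
  qed (use m in simp)
  then show ?thesis using m by (simp add: L2_def)
qed

lemma L2_scale: assumes "f \<in> L2" shows "(\<lambda>x. c * f x) \<in> L2"
  using assms by (intro L2_dominated[OF _ assms, of _ "\<bar>c\<bar>"]) (auto simp: L2_def abs_mult)

lemma L2_diff: assumes "f \<in> L2" "g \<in> L2" shows "(\<lambda>x. f x - g x) \<in> L2"
  using L2_add[OF assms(1) L2_scale[OF assms(2), of "- 1"]] by simp

lemma L2_dist_add_le:
  assumes "a \<in> L2" "b \<in> L2"
  shows "(LINT x|\<nu>. (a x + b x)\<^sup>2) \<le> 2 * (LINT x|\<nu>. (a x)\<^sup>2) + 2 * (LINT x|\<nu>. (b x)\<^sup>2)"
proof -
  have "(LINT x|\<nu>. (a x + b x)\<^sup>2) \<le> (LINT x|\<nu>. 2 * (a x)\<^sup>2 + 2 * (b x)\<^sup>2)"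
    using assms L2_add[OF assms] sum_sq_le by (intro integral_mono) (auto simp: L2_def)
  then show ?thesis using assms by (simp add: L2_def)
qed

text \<open>The integrand of the inner product of \<open>QL2\<close>; for \<open>a = b\<close> it is \<open>|\<surd>Q a|\<^sup>2\<close>.\<close>
definition qf :: "real ^ 'n \<Rightarrow> real ^ 'n \<Rightarrow> real ^ 'n \<Rightarrow> real" where "qf x a b = a \<bullet> (Q x *v b)"

lemma Q_psd: "x \<in> \<Omega> \<Longrightarrow> psd_matrix (Q x)" using Q by (simp add: matrix_function_on_def)

lemma qf_nonneg: "x \<in> \<Omega> \<Longrightarrow> 0 \<le> qf x a a" using Q_psd by (simp add: qf_def psd_matrix_def)

lemma qf_sym: "x \<in> \<Omega> \<Longrightarrow> qf x a b = qf x b a"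
  using Q_psd symmetric_matrix_inner[of "Q x" a b] inner_commute[of "Q x *v a" b]
  by (simp add: qf_def psd_matrix_def)

lemma qf_linear:
  "qf x (a + b) c = qf x a c + qf x b c" "qf x c (a + b) = qf x c a + qf x c b"
  "qf x (a - b) c = qf x a c - qf x b c" "qf x c (a - b) = qf x c a - qf x c b"
  "qf x (t *\<^sub>R a) c = t * qf x a c" "qf x c (t *\<^sub>R a) = t * qf x c a"
  "qf x 0 c = 0" "qf x c 0 = 0"
  by (simp_all add: qf_def inner_add_left inner_diff_left matrix_vector_right_distrib
      matrix_vector_mult_diff_distrib matrix_vector_mult_scaleR inner_add_right inner_diff_right)

lemma qf_abs_le: assumes "x \<in> \<Omega>" shows "2 * \<bar>qf x a b\<bar> \<le> qf x a a + qf x b b"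
  using qf_nonneg[OF assms, of "a + b"] qf_nonneg[OF assms, of "a - b"] qf_sym[OF assms, of b a]
  by (simp add: qf_linear abs_le_iff)

lemma qf_measurable [measurable]:
  assumes [measurable]: "a \<in> borel_measurable M" "b \<in> borel_measurable M"
  shows "(\<lambda>x. qf x (a x) (b x)) \<in> borel_measurable M"
proof -
  have [measurable]: "(\<lambda>x. Q x $ i $ j) \<in> borel_measurable M" for i j
    using Q by (simp add: matrix_function_on_def)
  have "(\<lambda>x. qf x (a x) (b x)) = (\<lambda>x. \<Sum>i\<in>UNIV. (a x \<bullet> axis i 1) * (\<Sum>j\<in>UNIV. Q x $ i $ j * (b x \<bullet> axis j 1)))"
  proof -
    have "y \<bullet> axis i 1 = y $ i" for y :: "real ^ 'n" and i by (simp add: inner_axis)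
    then show ?thesis by (simp only: qf_def inner_vec_def[of "a _"] matrix_vector_mult_def vec_lambda_beta inner_real_def)
  qed
  then show ?thesis by simp
qed

lemma QL2_iff: "w \<in> QL2 Q \<Omega> \<longleftrightarrow> w \<in> borel_measurable M \<and> integrable M (\<lambda>x. qf x (w x) (w x))"
proof -
  have "integrable M (\<lambda>x. (norm (psd_sqrt (Q x) *v w x))\<^sup>2) \<longleftrightarrow> integrable M (\<lambda>x. qf x (w x) (w x))"
    by (intro Bochner_Integration.integrable_cong) (auto simp: norm_psd_sqrt_mult[OF Q_psd] qf_def)
  then show ?thesis by (simp add: QL2_def)
qed

lemma QL2_measurable: "w \<in> QL2 Q \<Omega> \<Longrightarrow> w \<in> borel_measurable M" by (simp add: QL2_iff)

definition ipQ :: "(real ^ 'n \<Rightarrow> real ^ 'n) \<Rightarrow> (real ^ 'n \<Rightarrow> real ^ 'n) \<Rightarrow> real" where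
  "ipQ a b = (LINT x|M. qf x (a x) (b x))"

abbreviation energy :: "(real ^ 'n \<Rightarrow> real ^ 'n) \<Rightarrow> real" where "energy w \<equiv> ipQ w w"

lemma ipQ_nonneg: "0 \<le> energy w"
  unfolding ipQ_def by (intro integral_nonneg_AE AE_I2) (simp add: qf_nonneg)

lemma QL2_norm_eq: "QL2_norm Q \<Omega> w = sqrt (energy w)"
proof -
  have "(LINT x|M. (norm (psd_sqrt (Q x) *v w x))\<^sup>2) = (LINT x|M. qf x (w x) (w x))"
    by (intro Bochner_Integration.integral_cong) (auto simp: norm_psd_sqrt_mult[OF Q_psd] qf_def)
  then show ?thesis by (simp add: QL2_norm_def ipQ_def)
qed

lemma qf_integrable:
  assumes "a \<in> QL2 Q \<Omega>" "b \<in> QL2 Q \<Omega>"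
  shows "integrable M (\<lambda>x. qf x (a x) (b x))"
proof (rule Bochner_Integration.integrable_bound)
  show "integrable M (\<lambda>x. qf x (a x) (a x) + qf x (b x) (b x))" using assms by (auto simp: QL2_iff)
  show "(\<lambda>x. qf x (a x) (b x)) \<in> borel_measurable M" using assms by (auto simp: QL2_iff)
  show "AE x in M. norm (qf x (a x) (b x)) \<le> norm (qf x (a x) (a x) + qf x (b x) (b x))"
  proof (rule AE_I2)
    fix x assume "x \<in> space M"
    then have x: "x \<in> \<Omega>" by simp
    show "norm (qf x (a x) (b x)) \<le> norm (qf x (a x) (a x) + qf x (b x) (b x))"
      using qf_abs_le[OF x, of "a x" "b x"] qf_nonneg[OF x, of "a x"] qf_nonneg[OF x, of "b x"] by simp
  qed
qed

lemma QL2_add: assumes "a \<in> QL2 Q \<Omega>" "b \<in> QL2 Q \<Omega>" shows "(\<lambda>x. a x + b x) \<in> QL2 Q \<Omega>"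
  using assms qf_integrable[OF assms] qf_integrable[OF assms(2,1)]
  by (auto simp: QL2_iff qf_linear)

lemma QL2_scale: assumes "a \<in> QL2 Q \<Omega>" shows "(\<lambda>x. c *\<^sub>R a x) \<in> QL2 Q \<Omega>"
  using assms by (auto simp: QL2_iff qf_linear)

lemma QL2_diff: assumes "a \<in> QL2 Q \<Omega>" "b \<in> QL2 Q \<Omega>" shows "(\<lambda>x. a x - b x) \<in> QL2 Q \<Omega>"
  using QL2_add[OF assms(1) QL2_scale[OF assms(2), of "- 1"]] by simp

lemma QL2_mult:
  assumes a: "a \<in> QL2 Q \<Omega>" and f [measurable]: "f \<in> borel_measurable M" and le: "\<And>x. x \<in> \<Omega> \<Longrightarrow> \<bar>f x\<bar> \<le> c"
  shows "(\<lambda>x. f x *\<^sub>R a x) \<in> QL2 Q \<Omega>"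
proof -
  have [measurable]: "a \<in> borel_measurable M" using a by (rule QL2_measurable)
  have i1: "integrable M (\<lambda>x. c\<^sup>2 * qf x (a x) (a x))" using a by (simp add: QL2_iff)
  have m: "(\<lambda>x. f x *\<^sub>R a x) \<in> borel_measurable M" by measurable
  have i2: "AE x in M. norm (qf x (f x *\<^sub>R a x) (f x *\<^sub>R a x)) \<le> norm (c\<^sup>2 * qf x (a x) (a x))"
  proof (rule AE_I2)
    fix x assume "x \<in> space M"
    then have x: "x \<in> \<Omega>" by simp
    have "(f x)\<^sup>2 \<le> c\<^sup>2" using power_mono[OF le[OF x], of 2] by simp
    then have "(f x)\<^sup>2 * qf x (a x) (a x) \<le> c\<^sup>2 * qf x (a x) (a x)"
      using qf_nonneg[OF x] by (rule mult_right_mono)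
    then show "norm (qf x (f x *\<^sub>R a x) (f x *\<^sub>R a x)) \<le> norm (c\<^sup>2 * qf x (a x) (a x))"
      using qf_nonneg[OF x, of "a x"] by (simp add: qf_linear power2_eq_square abs_mult mult.assoc)
  qed
  show ?thesis unfolding QL2_iff
    using m Bochner_Integration.integrable_bound[OF i1 qf_measurable[OF m m] i2] by simp
qed

lemma QL2_cong_AE:
  assumes "a \<in> QL2 Q \<Omega>" "AE x in M. a x = b x"
  shows "b \<in> QL2 Q \<Omega>"
proof -
  have b: "b \<in> borel_measurable M"
    using borel_measurable_lebesgue_on_AE[OF _ \<Omega>_lebesgue assms(2)] assms(1) by (simp add: QL2_iff)
  have "AE x in M. qf x (a x) (a x) = qf x (b x) (b x)" using assms(2) by eventually_elim simp
  then have "integrable M (\<lambda>x. qf x (b x) (b x))"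
    using assms(1) b by (subst integrable_cong_AE[where g = "\<lambda>x. qf x (a x) (a x)"]) (auto simp: QL2_iff)
  then show ?thesis using b by (simp add: QL2_iff)
qed

lemma ipQ_cong_AE:
  assumes "a \<in> borel_measurable M" "b \<in> borel_measurable M" "a' \<in> borel_measurable M" "b' \<in> borel_measurable M"
    "AE x in M. a x = a' x" "AE x in M. b x = b' x"
  shows "ipQ a b = ipQ a' b'"
  unfolding ipQ_def
proof (rule integral_cong_AE)
  show "AE x in M. qf x (a x) (b x) = qf x (a' x) (b' x)" using assms(5,6) by eventually_elim simp
qed (use assms in auto)

lemma subspace_QL2: "subspace (QL2 Q \<Omega>)"
proof (rule subspaceI)
  show "0 \<in> QL2 Q \<Omega>" by (simp add: QL2_iff zero_fun_def qf_linear)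
  show "a + b \<in> QL2 Q \<Omega>" if "a \<in> QL2 Q \<Omega>" "b \<in> QL2 Q \<Omega>" for a b
    using QL2_add[OF that] by (simp add: plus_fun_def)
  show "c *\<^sub>R a \<in> QL2 Q \<Omega>" if "a \<in> QL2 Q \<Omega>" for c a
    using QL2_scale[OF that] by (simp add: scaleR_fun_def)
qed

sublocale QL: semi_inner "QL2 Q \<Omega>" ipQ
proof
  show "subspace (QL2 Q \<Omega>)" by (rule subspace_QL2)
  show "ipQ (a + b) c = ipQ a c + ipQ b c" if "a \<in> QL2 Q \<Omega>" "b \<in> QL2 Q \<Omega>" "c \<in> QL2 Q \<Omega>" for a b c
    using that unfolding ipQ_def by (simp add: qf_linear qf_integrable)
  show "ipQ (t *\<^sub>R a) b = t * ipQ a b" for t a b unfolding ipQ_def by (simp add: qf_linear)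
  show "ipQ a b = ipQ b a" for a b
    unfolding ipQ_def by (intro Bochner_Integration.integral_cong) (auto simp: qf_sym)
  show "0 \<le> energy a" for a by (rule ipQ_nonneg)
qed

lemma QLip0_iff: "\<phi> \<in> QLip0 Q v \<Omega> \<longleftrightarrow> \<phi> \<in> Lip0 \<Omega> \<and> \<phi> \<in> L2 \<and> grad \<phi> \<in> QL2 Q \<Omega>"
  by (auto simp: QLip0_def weighted_L2)

lemma QLip0_bounded:
  assumes "\<phi> \<in> QLip0 Q v \<Omega>"
  obtains b where "b \<ge> 0" "\<And>x. x \<in> \<Omega> \<Longrightarrow> \<bar>\<phi> x\<bar> \<le> b"
  using Lip0_bounded[OF \<Omega>_bounded] assms unfolding QLip0_iff by blast

lemma QLip0_add:
  assumes \<phi>: "\<phi> \<in> QLip0 Q v \<Omega>" and \<psi>: "\<psi> \<in> QLip0 Q v \<Omega>"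
  shows "(\<lambda>x. \<phi> x + \<psi> x) \<in> QLip0 Q v \<Omega>"
    and "AE x in M. grad (\<lambda>x. \<phi> x + \<psi> x) x = grad \<phi> x + grad \<psi> x"
proof -
  have "AE x in M. has_partials \<phi> x (grad \<phi> x)" "AE x in M. has_partials \<psi> x (grad \<psi> x)"
    using Lip0_has_partials_AE[OF \<Omega>_open] \<phi> \<psi> by (auto simp: QLip0_iff)
  then show *: "AE x in M. grad (\<lambda>x. \<phi> x + \<psi> x) x = grad \<phi> x + grad \<psi> x"
    by eventually_elim (intro has_partials_grad has_partials_add)
  show "(\<lambda>x. \<phi> x + \<psi> x) \<in> QLip0 Q v \<Omega>"
    unfolding QLip0_iff
  proof (intro conjI)
    show "grad (\<lambda>x. \<phi> x + \<psi> x) \<in> QL2 Q \<Omega>"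
    proof (rule QL2_cong_AE)
      show "(\<lambda>x. grad \<phi> x + grad \<psi> x) \<in> QL2 Q \<Omega>" using \<phi> \<psi> by (intro QL2_add) (auto simp: QLip0_iff)
      show "AE x in M. grad \<phi> x + grad \<psi> x = grad (\<lambda>x. \<phi> x + \<psi> x) x" using * by eventually_elim simp
    qed
  qed (use \<phi> \<psi> in \<open>auto simp: QLip0_iff intro: Lip0_add L2_add\<close>)
qed

text \<open>
  Where \<open>\<phi>\<close> has partial derivatives this is the ordinary chain rule; the bounded function \<open>\<phi>\<close> meets only a compact
  range of \<open>T'\<close>, so the composition is again Lipschitz with gradient in \<open>QL2\<close>.
\<close>
lemma QLip0_compose:
  assumes \<phi>: "\<phi> \<in> QLip0 Q v \<Omega>"
    and T: "\<And>s. (T has_real_derivative T' s) (at s)" "continuous_on UNIV T'" "T 0 = 0"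
  shows "(\<lambda>x. T (\<phi> x)) \<in> QLip0 Q v \<Omega>"
    and "AE x in M. grad (\<lambda>x. T (\<phi> x)) x = T' (\<phi> x) *\<^sub>R grad \<phi> x"
proof -
  have [measurable]: "\<phi> \<in> borel_measurable M" using \<phi> by (simp add: QLip0_iff L2_def)
  have [measurable]: "T' \<in> borel_measurable borel" using T(2) by (rule borel_measurable_continuous_onI)
  have "AE x in M. has_partials \<phi> x (grad \<phi> x)"
    using Lip0_has_partials_AE[OF \<Omega>_open] \<phi> by (auto simp: QLip0_iff)
  then show *: "AE x in M. grad (\<lambda>x. T (\<phi> x)) x = T' (\<phi> x) *\<^sub>R grad \<phi> x"
    by eventually_elim (intro has_partials_grad has_partials_chain T(1))
  have lip: "(\<lambda>x. T (\<phi> x)) \<in> Lip0 \<Omega>"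
    using \<phi> by (intro Lip0_compose[OF _ \<Omega>_bounded T]) (auto simp: QLip0_iff)
  obtain b where b: "\<And>x. x \<in> \<Omega> \<Longrightarrow> \<bar>\<phi> x\<bar> \<le> b" using QLip0_bounded[OF \<phi>] by blast
  have "bounded (T' ` {-b..b})"
    by (intro compact_imp_bounded compact_continuous_image continuous_on_subset[OF T(2)]) auto
  then obtain c where "\<And>s. s \<in> {-b..b} \<Longrightarrow> norm (T' s) \<le> c" unfolding bounded_iff by blast
  then have c: "\<bar>T' (\<phi> x)\<bar> \<le> c" if "x \<in> \<Omega>" for x using b[OF that] by (simp add: abs_le_iff minus_le_iff)
  show "(\<lambda>x. T (\<phi> x)) \<in> QLip0 Q v \<Omega>"
    unfolding QLip0_iff
  proof (intro conjI)
    show "grad (\<lambda>x. T (\<phi> x)) \<in> QL2 Q \<Omega>"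
    proof (rule QL2_cong_AE)
      show "(\<lambda>x. T' (\<phi> x) *\<^sub>R grad \<phi> x) \<in> QL2 Q \<Omega>"
        using \<phi> c by (intro QL2_mult[of _ _ c]) (auto simp: QLip0_iff)
      show "AE x in M. T' (\<phi> x) *\<^sub>R grad \<phi> x = grad (\<lambda>x. T (\<phi> x)) x" using * by eventually_elim simp
    qed
    obtain d where d: "\<And>x. x \<in> \<Omega> \<Longrightarrow> \<bar>T (\<phi> x)\<bar> \<le> d" using Lip0_bounded[OF \<Omega>_bounded lip] by blast
    interpret finite_measure \<nu> by (rule finite_\<nu>)
    have one: "(\<lambda>x. 1) \<in> L2" by (simp add: L2_def)
    show "(\<lambda>x. T (\<phi> x)) \<in> L2"
      by (rule L2_dominated[OF Lip0_measurable[OF \<Omega>_open lip] one, of d]) (simp add: d)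
  qed (rule lip)
qed

lemma QLip0_scale:
  assumes \<phi>: "\<phi> \<in> QLip0 Q v \<Omega>"
  shows "(\<lambda>x. c * \<phi> x) \<in> QLip0 Q v \<Omega>" "AE x in M. grad (\<lambda>x. c * \<phi> x) x = c *\<^sub>R grad \<phi> x"
  using QLip0_compose[OF \<phi>, of "\<lambda>s. c * s" "\<lambda>s. c"] by (auto intro!: derivative_eq_intros)

lemma QLip0_zero: "(\<lambda>x. 0) \<in> QLip0 Q v \<Omega>"
proof -
  have "grad (\<lambda>x. 0) = (\<lambda>x. 0 :: real ^ 'n)" by (auto simp: grad_def vec_eq_iff fun_eq_iff)
  then show ?thesis
    by (auto simp: QLip0_iff Lip0_def L2_def QL2_iff qf_linear support_on_def intro!: exI[of _ 0] lipschitz_onI)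
qed

text \<open>
  Membership in terms of squared distances, for which the elementary bound \<open>(a + b)\<^sup>2 \<le> 2 a\<^sup>2 + 2 b\<^sup>2\<close> replaces the triangle
  inequality.
\<close>
lemma QH0_iff:
  "(u, Du) \<in> QH0 Q v \<Omega> \<longleftrightarrow> u \<in> L2 \<and> Du \<in> QL2 Q \<Omega> \<and>
     (\<forall>\<epsilon>>0. \<exists>\<phi>\<in>QLip0 Q v \<Omega>. (LINT x|\<nu>. (u x - \<phi> x)\<^sup>2) < \<epsilon> \<and>
        energy (\<lambda>x. Du x - grad \<phi> x) < \<epsilon>)" (is "?L \<longleftrightarrow> ?R")
proof -
  have norm: "QH_norm Q v \<Omega> (\<lambda>x. u x - \<phi> x) (\<lambda>x. Du x - grad \<phi> x) =
      sqrt (LINT x|\<nu>. (u x - \<phi> x)\<^sup>2) + sqrt (energy (\<lambda>x. Du x - grad \<phi> x))"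
    if "u \<in> L2" "\<phi> \<in> QLip0 Q v \<Omega>" for \<phi>
  proof -
    have "(\<lambda>x. u x - \<phi> x) \<in> borel_measurable M" using that by (auto simp: QLip0_iff L2_def)
    then show ?thesis by (simp add: QH_norm_def QL2_norm_eq weighted_L2_norm)
  qed
  note pos = ipQ_nonneg
  show ?thesis
  proof
    assume L: ?L
    then have L': "u \<in> L2" "Du \<in> QL2 Q \<Omega>" by (auto simp: QH0_def QH_closure_def weighted_L2)
    moreover have "\<exists>\<phi>\<in>QLip0 Q v \<Omega>. (LINT x|\<nu>. (u x - \<phi> x)\<^sup>2) < \<epsilon> \<and>
        energy (\<lambda>x. Du x - grad \<phi> x) < \<epsilon>" if \<epsilon>: "\<epsilon> > 0" for \<epsilon>
    proof -
      obtain \<phi> where \<phi>: "\<phi> \<in> QLip0 Q v \<Omega>"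
        "QH_norm Q v \<Omega> (\<lambda>x. u x - \<phi> x) (\<lambda>x. Du x - grad \<phi> x) < sqrt \<epsilon>"
        using L \<epsilon> unfolding QH0_def QH_closure_def by (auto dest!: spec[of _ "sqrt \<epsilon>"])
      have "sqrt (LINT x|\<nu>. (u x - \<phi> x)\<^sup>2) < sqrt \<epsilon>"
        "sqrt (energy (\<lambda>x. Du x - grad \<phi> x)) < sqrt \<epsilon>"
        using \<phi> pos[of "\<lambda>x. Du x - grad \<phi> x"] unfolding norm[OF L'(1) \<phi>(1)]
        by (smt (verit) real_sqrt_ge_zero integral_nonneg_AE zero_le_power2 always_eventually)+
      then show ?thesis using \<phi>(1) by auto
    qed
    ultimately show ?R by blast
  next
    assume R: ?R
    have "\<exists>\<phi>\<in>QLip0 Q v \<Omega>. QH_norm Q v \<Omega> (\<lambda>x. u x - \<phi> x) (\<lambda>x. Du x - grad \<phi> x) < \<epsilon>" if \<epsilon>: "\<epsilon> > 0" for \<epsilon>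
    proof -
      have "(\<epsilon> / 2)\<^sup>2 > 0" using \<epsilon> by simp
      then obtain \<phi> where \<phi>: "\<phi> \<in> QLip0 Q v \<Omega>" "(LINT x|\<nu>. (u x - \<phi> x)\<^sup>2) < (\<epsilon> / 2)\<^sup>2"
        "energy (\<lambda>x. Du x - grad \<phi> x) < (\<epsilon> / 2)\<^sup>2" using R by blast
      have "sqrt (LINT x|\<nu>. (u x - \<phi> x)\<^sup>2) < \<epsilon> / 2"
        "sqrt (energy (\<lambda>x. Du x - grad \<phi> x)) < \<epsilon> / 2"
        using \<phi>(2,3) \<epsilon> by (auto intro!: real_less_lsqrt simp del: less_divide_eq_numeral1)
      then show ?thesis using R \<phi>(1) by (intro bexI[of _ \<phi>]) (simp add: norm)
    qed
    then show ?L using R by (auto simp: QH0_def QH_closure_def weighted_L2)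
  qed
qed

lemma ipQ_add_le:
  assumes "a \<in> QL2 Q \<Omega>" "b \<in> QL2 Q \<Omega>"
  shows "energy (\<lambda>x. a x + b x) \<le> 2 * energy a + 2 * energy b"
proof -
  have "energy (\<lambda>x. a x + b x) \<le> (LINT x|M. 2 * qf x (a x) (a x) + 2 * qf x (b x) (b x))"
    unfolding ipQ_def
  proof (rule integral_mono)
    fix x assume "x \<in> space M"
    then have x: "x \<in> \<Omega>" by simp
    show "qf x (a x + b x) (a x + b x) \<le> 2 * qf x (a x) (a x) + 2 * qf x (b x) (b x)"
      using qf_nonneg[OF x, of "a x - b x"] by (simp add: qf_linear)
  qed (use assms QL2_add[OF assms] in \<open>auto simp: QL2_iff\<close>)
  then show ?thesis using assms by (simp add: ipQ_def QL2_iff)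
qed

lemma QLip0_in_QH0: "\<phi> \<in> QLip0 Q v \<Omega> \<Longrightarrow> (\<phi>, grad \<phi>) \<in> QH0 Q v \<Omega>"
  unfolding QH0_iff by (auto simp: QLip0_iff ipQ_def qf_linear(7,8) intro!: bexI[of _ \<phi>])

lemma QH0_subset_QH: "QH0 Q v \<Omega> \<subseteq> QH Q v \<Omega>"
proof -
  have "QLip0 Q v \<Omega> \<subseteq> QLip_loc Q v \<Omega>"
    unfolding QLip0_def QLip_loc_def Lip0_def Lip_loc_def by (auto intro: lipschitz_on_subset)
  then show ?thesis unfolding QH0_def QH_def QH_closure_def by blast
qed

lemma subspace_QH0: "subspace (QH0 Q v \<Omega>)"
proof (rule subspaceI)
  have "grad (\<lambda>x. 0) = (\<lambda>x. 0 :: real ^ 'n)" by (auto simp: grad_def vec_eq_iff fun_eq_iff)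
  then show "0 \<in> QH0 Q v \<Omega>" using QLip0_in_QH0[OF QLip0_zero] by (simp add: zero_prod_def zero_fun_def)
next
  fix y z assume "y \<in> QH0 Q v \<Omega>" "z \<in> QH0 Q v \<Omega>"
  then obtain u Du w Dw where yz: "y = (u, Du)" "z = (w, Dw)" "(u, Du) \<in> QH0 Q v \<Omega>" "(w, Dw) \<in> QH0 Q v \<Omega>"
    by (metis surj_pair)
  note u = yz(3)[unfolded QH0_iff] and w = yz(4)[unfolded QH0_iff]
  have "(\<lambda>x. u x + w x, \<lambda>x. Du x + Dw x) \<in> QH0 Q v \<Omega>"
    unfolding QH0_iff
  proof (intro conjI allI impI)
    fix \<epsilon> :: real assume "\<epsilon> > 0"
    then have "\<epsilon> / 4 > 0" by simp
    then obtain \<phi> \<psi> where \<phi>: "\<phi> \<in> QLip0 Q v \<Omega>" "(LINT x|\<nu>. (u x - \<phi> x)\<^sup>2) < \<epsilon> / 4"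
        "energy (\<lambda>x. Du x - grad \<phi> x) < \<epsilon> / 4"
      and \<psi>: "\<psi> \<in> QLip0 Q v \<Omega>" "(LINT x|\<nu>. (w x - \<psi> x)\<^sup>2) < \<epsilon> / 4"
        "energy (\<lambda>x. Dw x - grad \<psi> x) < \<epsilon> / 4" using u w by meson
    have L: "(\<lambda>x. u x - \<phi> x) \<in> L2" "(\<lambda>x. w x - \<psi> x) \<in> L2"
      using u w \<phi>(1) \<psi>(1) by (auto simp: QLip0_iff intro: L2_diff)
    have D: "(\<lambda>x. Du x - grad \<phi> x) \<in> QL2 Q \<Omega>" "(\<lambda>x. Dw x - grad \<psi> x) \<in> QL2 Q \<Omega>"
      using u w \<phi>(1) \<psi>(1) by (auto simp: QLip0_iff intro: QL2_diff)
    have "(LINT x|\<nu>. (u x + w x - (\<phi> x + \<psi> x))\<^sup>2) < \<epsilon>"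
      using L2_dist_add_le[OF L] \<phi>(2) \<psi>(2) by (simp add: algebra_simps)
    moreover have "energy (\<lambda>x. Du x + Dw x - grad (\<lambda>x. \<phi> x + \<psi> x) x) < \<epsilon>"
    proof -
      have ae: "AE x in M. Du x + Dw x - grad (\<lambda>x. \<phi> x + \<psi> x) x = (Du x - grad \<phi> x) + (Dw x - grad \<psi> x)"
        using QLip0_add(2)[OF \<phi>(1) \<psi>(1)] by eventually_elim simp
      have [measurable]: "grad (\<lambda>x. \<phi> x + \<psi> x) \<in> borel_measurable M" "grad \<phi> \<in> borel_measurable M"
        "grad \<psi> \<in> borel_measurable M" "Du \<in> borel_measurable M" "Dw \<in> borel_measurable M"
        using QLip0_add(1)[OF \<phi>(1) \<psi>(1)] \<phi>(1) \<psi>(1) u w by (auto simp: QLip0_iff QL2_iff)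
      have "energy (\<lambda>x. Du x + Dw x - grad (\<lambda>x. \<phi> x + \<psi> x) x)
          = energy (\<lambda>x. (Du x - grad \<phi> x) + (Dw x - grad \<psi> x))"
        by (rule ipQ_cong_AE[OF _ _ _ _ ae ae]) measurable
      then show ?thesis using ipQ_add_le[OF D] \<phi>(3) \<psi>(3) by simp
    qed
    ultimately show "\<exists>\<phi>\<in>QLip0 Q v \<Omega>. (LINT x|\<nu>. (u x + w x - \<phi> x)\<^sup>2) < \<epsilon> \<and>
        energy (\<lambda>x. Du x + Dw x - grad \<phi> x) < \<epsilon>"
      using QLip0_add(1)[OF \<phi>(1) \<psi>(1)] by (intro bexI[of _ "\<lambda>x. \<phi> x + \<psi> x"] conjI)
  qed (use u w L2_add QL2_add in auto)
  then show "y + z \<in> QH0 Q v \<Omega>" by (simp add: yz plus_fun_def)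
next
  fix c :: real and y assume "y \<in> QH0 Q v \<Omega>"
  then obtain u Du where y: "y = (u, Du)" "(u, Du) \<in> QH0 Q v \<Omega>" by (metis surj_pair)
  note u = y(2)[unfolded QH0_iff]
  have "(\<lambda>x. c * u x, \<lambda>x. c *\<^sub>R Du x) \<in> QH0 Q v \<Omega>"
    unfolding QH0_iff
  proof (intro conjI allI impI)
    fix \<epsilon> :: real assume "\<epsilon> > 0"
    then have "\<epsilon> / (c\<^sup>2 + 1) > 0" by (simp add: add_nonneg_pos)
    then obtain \<phi> where \<phi>: "\<phi> \<in> QLip0 Q v \<Omega>" "(LINT x|\<nu>. (u x - \<phi> x)\<^sup>2) < \<epsilon> / (c\<^sup>2 + 1)"
        "energy (\<lambda>x. Du x - grad \<phi> x) < \<epsilon> / (c\<^sup>2 + 1)" using u by meson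
    have small: "c\<^sup>2 * r < \<epsilon>" if "r < \<epsilon> / (c\<^sup>2 + 1)" "0 \<le> r" for r
    proof -
      have "c\<^sup>2 * r \<le> (c\<^sup>2 + 1) * r" using that(2) by (simp add: algebra_simps)
      also have "\<dots> < \<epsilon>" using that(1) by (simp add: pos_less_divide_eq add_nonneg_pos mult.commute)
      finally show ?thesis .
    qed
    have "(LINT x|\<nu>. (c * u x - c * \<phi> x)\<^sup>2) < \<epsilon>"
    proof -
      have "(LINT x|\<nu>. (c * u x - c * \<phi> x)\<^sup>2) = c\<^sup>2 * (LINT x|\<nu>. (u x - \<phi> x)\<^sup>2)"
        by (simp add: power_mult_distrib flip: right_diff_distrib)
      then show ?thesis using small[OF \<phi>(2)] by simp
    qed
    moreover have "energy (\<lambda>x. c *\<^sub>R Du x - grad (\<lambda>x. c * \<phi> x) x) < \<epsilon>"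
    proof -
      have ae: "AE x in M. c *\<^sub>R Du x - grad (\<lambda>x. c * \<phi> x) x = c *\<^sub>R (Du x - grad \<phi> x)"
        using QLip0_scale(2)[OF \<phi>(1), of c] by eventually_elim (simp add: scaleR_diff_right)
      have [measurable]: "grad (\<lambda>x. c * \<phi> x) \<in> borel_measurable M" "grad \<phi> \<in> borel_measurable M"
        "Du \<in> borel_measurable M"
        using QLip0_scale(1)[OF \<phi>(1), of c] \<phi>(1) u by (auto simp: QLip0_iff QL2_iff)
      have "energy (\<lambda>x. c *\<^sub>R Du x - grad (\<lambda>x. c * \<phi> x) x)
          = energy (\<lambda>x. c *\<^sub>R (Du x - grad \<phi> x))"
        by (rule ipQ_cong_AE[OF _ _ _ _ ae ae]) measurable
      also have "\<dots> = c\<^sup>2 * energy (\<lambda>x. Du x - grad \<phi> x)"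
        by (simp add: ipQ_def qf_linear(5,6) power2_eq_square mult.assoc)
      finally show ?thesis
        using small[OF \<phi>(3) ipQ_nonneg] by simp
    qed
    ultimately show "\<exists>\<phi>\<in>QLip0 Q v \<Omega>. (LINT x|\<nu>. (c * u x - \<phi> x)\<^sup>2) < \<epsilon> \<and>
        energy (\<lambda>x. c *\<^sub>R Du x - grad \<phi> x) < \<epsilon>"
      using QLip0_scale(1)[OF \<phi>(1)] by (intro bexI[of _ "\<lambda>x. c * \<phi> x"] conjI)
  qed (use u L2_scale QL2_scale in auto)
  then show "c *\<^sub>R y \<in> QH0 Q v \<Omega>" by (simp add: y scaleR_fun_def)
qed

end

section \<open>The Sobolev inequality, multipliers and completeness\<close>

locale degenerate_sobolev = degenerate_space \<Omega> v Q
  for \<Omega> :: "(real ^ 'n) set" and v :: "real ^ 'n \<Rightarrow> real" and Q :: "real ^ 'n \<Rightarrow> real ^ 'n ^ 'n" +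
  fixes \<sigma> C :: real
  assumes \<sigma>: "\<sigma> > 1" and C_nonneg: "C \<ge> 0"
    and sobolev: "\<And>\<phi>. \<phi> \<in> QLip0 Q v \<Omega> \<Longrightarrow> weighted_Lp_norm (2 * \<sigma>) v \<Omega> \<phi> \<le> C * QL2_norm Q \<Omega> (grad \<phi>)"
begin

text \<open>The conjugate exponent of \<open>\<sigma>\<close>.\<close>
definition \<sigma>' :: real where "\<sigma>' = \<sigma> / (\<sigma> - 1)"

lemma \<sigma>': "\<sigma>' > 1" "1 / \<sigma> + 1 / \<sigma>' = 1"
  using \<sigma> by (auto simp: \<sigma>'_def field_simps)

lemma sobolev_power:
  assumes \<phi>: "\<phi> \<in> QLip0 Q v \<Omega>"
  shows "integrable \<nu> (\<lambda>x. \<bar>\<phi> x\<bar> powr (2 * \<sigma>))"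
    and "(LINT x|\<nu>. \<bar>\<phi> x\<bar> powr (2 * \<sigma>)) powr (1 / \<sigma>) \<le> C\<^sup>2 * energy (grad \<phi>)"
proof -
  interpret finite_measure \<nu> by (rule finite_\<nu>)
  have [measurable]: "\<phi> \<in> borel_measurable M" using \<phi> by (simp add: QLip0_iff L2_def)
  obtain b where b: "b \<ge> 0" "\<And>x. x \<in> \<Omega> \<Longrightarrow> \<bar>\<phi> x\<bar> \<le> b" using QLip0_bounded[OF \<phi>] by blast
  show "integrable \<nu> (\<lambda>x. \<bar>\<phi> x\<bar> powr (2 * \<sigma>))"
  proof (rule integrable_const_bound)
    show "AE x in \<nu>. norm (\<bar>\<phi> x\<bar> powr (2 * \<sigma>)) \<le> b powr (2 * \<sigma>)"
      by (rule AE_I2) (use b(2) \<sigma> in \<open>auto intro!: powr_mono2\<close>)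
  qed measurable
  define S where "S = (LINT x|\<nu>. \<bar>\<phi> x\<bar> powr (2 * \<sigma>))"
  have "S powr (1 / (2 * \<sigma>)) \<le> C * sqrt (energy (grad \<phi>))"
    using sobolev[OF \<phi>] by (simp add: weighted_Lp_norm_eq QL2_norm_eq S_def)
  then have "(S powr (1 / (2 * \<sigma>)))\<^sup>2 \<le> (C * sqrt (energy (grad \<phi>)))\<^sup>2"
    by (intro power_mono) auto
  also have "(S powr (1 / (2 * \<sigma>)))\<^sup>2 = S powr (1 / \<sigma>)"
  proof -
    have "1 / \<sigma> = 1 / (2 * \<sigma>) + 1 / (2 * \<sigma>)" using \<sigma> by (simp add: field_simps)
    then show ?thesis by (simp only: power2_eq_square powr_add)
  qed
  finally show "S powr (1 / \<sigma>) \<le> C\<^sup>2 * energy (grad \<phi>)"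
    by (simp add: power_mult_distrib ipQ_nonneg)
qed

text \<open>
  By Hoelder's inequality, functions in \<open>L\<^bsup>2\<sigma>'\<^esup>(\<nu>)\<close> multiply \<open>L\<^bsup>2\<sigma>\<^esup>(\<nu>)\<close>, and therefore \<open>QH\<^sub>0\<close>, into \<open>L\<^sup>2(\<nu>)\<close>; the number
  \<open>multiplier_bound\<close> is the resulting bound for the square of the operator norm.
\<close>
definition multiplier :: "(real ^ 'n \<Rightarrow> real) \<Rightarrow> bool" where
  "multiplier b \<longleftrightarrow> b \<in> borel_measurable M \<and> integrable \<nu> (\<lambda>x. \<bar>b x\<bar> powr (2 * \<sigma>'))"

definition multiplier_bound :: "(real ^ 'n \<Rightarrow> real) \<Rightarrow> real" where
  "multiplier_bound b = C\<^sup>2 * (LINT x|\<nu>. \<bar>b x\<bar> powr (2 * \<sigma>')) powr (1 / \<sigma>')"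

lemma multiplier_bound_nonneg: "0 \<le> multiplier_bound b" by (simp add: multiplier_bound_def)

lemma sq_powr: "\<bar>(a::real)\<^sup>2\<bar> powr s = \<bar>a\<bar> powr (2 * s)"
proof -
  have "\<bar>a\<^sup>2\<bar> = \<bar>a\<bar> powr 2" by simp
  then show ?thesis by (simp only: powr_powr)
qed

lemma multiplier_QLip0:
  assumes b: "multiplier b" and \<phi>: "\<phi> \<in> QLip0 Q v \<Omega>"
  shows "integrable \<nu> (\<lambda>x. (b x)\<^sup>2 * (\<phi> x)\<^sup>2)"
    and "(LINT x|\<nu>. (b x)\<^sup>2 * (\<phi> x)\<^sup>2) \<le> multiplier_bound b * energy (grad \<phi>)"
proof -
  have m: "(\<lambda>x. (b x)\<^sup>2) \<in> borel_measurable \<nu>" "(\<lambda>x. (\<phi> x)\<^sup>2) \<in> borel_measurable \<nu>"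
    using b \<phi> by (auto simp: multiplier_def QLip0_iff L2_def)
  have i: "integrable \<nu> (\<lambda>x. \<bar>(b x)\<^sup>2\<bar> powr \<sigma>')" "integrable \<nu> (\<lambda>x. \<bar>(\<phi> x)\<^sup>2\<bar> powr \<sigma>)"
    using b sobolev_power(1)[OF \<phi>] by (simp_all only: sq_powr multiplier_def)
  have s: "1 / \<sigma>' + 1 / \<sigma> = 1" using \<sigma>'(2) by simp
  note H = Holder_integral[OF \<sigma>'(1) \<sigma> s m i]
  show "integrable \<nu> (\<lambda>x. (b x)\<^sup>2 * (\<phi> x)\<^sup>2)" by (rule H(1))
  have "(LINT x|\<nu>. (b x)\<^sup>2 * (\<phi> x)\<^sup>2)
      \<le> (LINT x|\<nu>. \<bar>b x\<bar> powr (2 * \<sigma>')) powr (1 / \<sigma>') * (LINT x|\<nu>. \<bar>\<phi> x\<bar> powr (2 * \<sigma>)) powr (1 / \<sigma>)"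
    using H(2) unfolding sq_powr by simp
  also have "\<dots> \<le> (LINT x|\<nu>. \<bar>b x\<bar> powr (2 * \<sigma>')) powr (1 / \<sigma>') * (C\<^sup>2 * energy (grad \<phi>))"
    by (intro mult_left_mono sobolev_power(2)[OF \<phi>]) simp
  finally show "(LINT x|\<nu>. (b x)\<^sup>2 * (\<phi> x)\<^sup>2) \<le> multiplier_bound b * energy (grad \<phi>)"
    by (simp add: multiplier_bound_def mult_ac)
qed

text \<open>
  The convergence of the energies of the approximating gradients is what allows inequalities for Lipschitz functions
  to be passed to \<open>QH0\<close> by Fatou's lemma.
\<close>
lemma QH0_sequence:
  assumes u: "(u, Du) \<in> QH0 Q v \<Omega>"
  obtains \<phi> where "\<And>n. \<phi> n \<in> QLip0 Q v \<Omega>" "(\<lambda>n. LINT x|\<nu>. (\<phi> n x - u x)\<^sup>2) \<longlonglongrightarrow> 0"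
    "(\<lambda>n. energy (grad (\<phi> n))) \<longlonglongrightarrow> energy Du"
proof -
  note u' = u[unfolded QH0_iff]
  have "\<forall>n. \<exists>\<phi>. \<phi> \<in> QLip0 Q v \<Omega> \<and> (LINT x|\<nu>. (u x - \<phi> x)\<^sup>2) < 1 / real (Suc n) \<and>
        energy (\<lambda>x. Du x - grad \<phi> x) < 1 / real (Suc n)"
  proof
    fix n
    have "0 < 1 / real (Suc n)" by simp
    with u' show "\<exists>\<phi>. \<phi> \<in> QLip0 Q v \<Omega> \<and> (LINT x|\<nu>. (u x - \<phi> x)\<^sup>2) < 1 / real (Suc n) \<and>
        energy (\<lambda>x. Du x - grad \<phi> x) < 1 / real (Suc n)" by blast
  qed
  from choice[OF this] obtain \<phi> where \<phi>: "\<And>n. \<phi> n \<in> QLip0 Q v \<Omega>" "\<And>n. (LINT x|\<nu>. (u x - \<phi> n x)\<^sup>2) < 1 / real (Suc n)"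
    "\<And>n. energy (\<lambda>x. Du x - grad (\<phi> n) x) < 1 / real (Suc n)" by blast
  have r0: "(\<lambda>n. 1 / real (Suc n)) \<longlonglongrightarrow> 0" using LIMSEQ_Suc[OF lim_1_over_n] by simp
  have l2: "(\<lambda>n. LINT x|\<nu>. (\<phi> n x - u x)\<^sup>2) \<longlonglongrightarrow> 0"
    by (rule Lim_null_comparison[OF always_eventually r0])
       (use \<phi>(2) in \<open>auto simp: power2_commute[of "\<phi> _ _"] simp del: of_nat_Suc intro: less_imp_le\<close>)
  have D: "Du \<in> QL2 Q \<Omega>" "grad (\<phi> n) \<in> QL2 Q \<Omega>" for n using u' \<phi>(1) by (auto simp: QLip0_iff)
  have nm: "\<bar>QL.nm (grad (\<phi> n)) - QL.nm Du\<bar> \<le> sqrt (1 / real (Suc n))" for n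
  proof -
    have "QL.nm (Du - grad (\<phi> n)) \<le> sqrt (1 / real (Suc n))"
      using \<phi>(3)[of n] unfolding QL.nm_def fun_diff_def by simp
    moreover have "QL.nm Du \<le> QL.nm (Du - grad (\<phi> n)) + QL.nm (grad (\<phi> n))"
      using QL.nm_triangle[of "Du - grad (\<phi> n)" "grad (\<phi> n)"] D by simp
    moreover have "QL.nm (grad (\<phi> n)) \<le> QL.nm (grad (\<phi> n) - Du) + QL.nm Du"
      using QL.nm_triangle[of "grad (\<phi> n) - Du" Du] D by simp
    moreover have "QL.nm (grad (\<phi> n) - Du) = QL.nm (Du - grad (\<phi> n))" using D by (rule QL.nm_minus[rotated])
    ultimately show ?thesis by linarith
  qed
  have "(\<lambda>n. QL.nm (grad (\<phi> n)) - QL.nm Du) \<longlonglongrightarrow> 0"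
  proof (rule Lim_null_comparison)
    show "(\<lambda>n. sqrt (1 / real (Suc n))) \<longlonglongrightarrow> 0" using tendsto_real_sqrt[OF r0] by simp
    show "\<forall>\<^sub>F n in sequentially. norm (QL.nm (grad (\<phi> n)) - QL.nm Du) \<le> sqrt (1 / real (Suc n))"
      using nm by (intro always_eventually) simp
  qed
  then have "(\<lambda>n. QL.nm (grad (\<phi> n))) \<longlonglongrightarrow> QL.nm Du" by (simp add: LIM_zero_iff)
  then have "(\<lambda>n. (QL.nm (grad (\<phi> n)))\<^sup>2) \<longlonglongrightarrow> (QL.nm Du)\<^sup>2" by (intro tendsto_intros)
  then have "(\<lambda>n. energy (grad (\<phi> n))) \<longlonglongrightarrow> energy Du" using D by (simp add: QL.nm_sq)
  with \<phi>(1) l2 show ?thesis by (rule that)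
qed

lemma multiplier_QH0:
  assumes b: "multiplier b" and u: "(u, Du) \<in> QH0 Q v \<Omega>"
  shows "(\<lambda>x. b x * u x) \<in> L2" and "(LINT x|\<nu>. (b x * u x)\<^sup>2) \<le> multiplier_bound b * energy Du"
proof -
  obtain \<phi> where \<phi>: "\<And>n. \<phi> n \<in> QLip0 Q v \<Omega>" "(\<lambda>n. LINT x|\<nu>. (\<phi> n x - u x)\<^sup>2) \<longlonglongrightarrow> 0"
    "(\<lambda>n. energy (grad (\<phi> n))) \<longlonglongrightarrow> energy Du" using QH0_sequence[OF u] by blast
  have m: "u \<in> borel_measurable \<nu>" "(\<lambda>x. (b x)\<^sup>2) \<in> borel_measurable \<nu>"
    using b u by (auto simp: QH0_iff L2_def multiplier_def)
  have u2: "u \<in> L2" using u by (simp add: QH0_iff)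
  have i: "integrable \<nu> (\<lambda>x. (\<phi> n x - u x)\<^sup>2)" for n
    using L2_diff[OF _ u2, of "\<phi> n"] \<phi>(1)[of n] by (simp add: QLip0_iff L2_def)
  have a: "(\<lambda>n. multiplier_bound b * energy (grad (\<phi> n))) \<longlonglongrightarrow> multiplier_bound b * energy Du"
    by (intro tendsto_intros \<phi>(3))
  note F = Fatou_L2[OF m i \<phi>(2) zero_le_power2 multiplier_QLip0[OF b \<phi>(1)] a]
  show "(\<lambda>x. b x * u x) \<in> L2" using F(1) b u2 by (auto simp: L2_def multiplier_def power_mult_distrib)
  show "(LINT x|\<nu>. (b x * u x)\<^sup>2) \<le> multiplier_bound b * energy Du" using F(2) by (simp add: power_mult_distrib)
qed

lemma multiplier_const: "multiplier (\<lambda>x. c)"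
proof -
  interpret finite_measure \<nu> by (rule finite_\<nu>)
  show ?thesis by (simp add: multiplier_def)
qed

text \<open>
  The constant function \<open>1\<close> is a multiplier since \<open>\<nu>\<close> is finite; so the energy controls the full norm of \<open>QH0\<close>.
\<close>
lemma L2_bound_QH0:
  assumes "(u, Du) \<in> QH0 Q v \<Omega>"
  shows "(LINT x|\<nu>. (u x)\<^sup>2) \<le> multiplier_bound (\<lambda>x. 1) * energy Du"
  using multiplier_QH0(2)[OF multiplier_const[of 1] assms] by simp

abbreviation X :: "((real ^ 'n \<Rightarrow> real) \<times> (real ^ 'n \<Rightarrow> real ^ 'n)) set" where "X \<equiv> QH0 Q v \<Omega>"

text \<open>
  The zero-order part of the norm is omitted: it is controlled by the energy.
\<close>
definition ipX :: "(real ^ 'n \<Rightarrow> real) \<times> (real ^ 'n \<Rightarrow> real ^ 'n) \<Rightarrow> (real ^ 'n \<Rightarrow> real) \<times> (real ^ 'n \<Rightarrow> real ^ 'n) \<Rightarrow> real" where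
  "ipX y z = ipQ (snd y) (snd z)"

lemma X_QL2: "z \<in> X \<Longrightarrow> snd z \<in> QL2 Q \<Omega>" and X_L2: "z \<in> X \<Longrightarrow> fst z \<in> L2"
  using QH0_iff[of "fst z" "snd z"] by auto

sublocale XI: semi_inner X ipX
proof
  show "subspace X" by (rule subspace_QH0)
  show "ipX (x + y) z = ipX x z + ipX y z" if "x \<in> X" "y \<in> X" "z \<in> X" for x y z
    using that by (simp add: ipX_def QL.ip_add X_QL2)
  show "ipX (c *\<^sub>R x) y = c * ipX x y" if "x \<in> X" "y \<in> X" for c x y
    using that by (simp add: ipX_def QL.ip_scale X_QL2)
  show "ipX x y = ipX y x" if "x \<in> X" "y \<in> X" for x y
    using that by (simp add: ipX_def QL.ip_sym X_QL2)
  show "0 \<le> ipX x x" for x by (simp add: ipX_def ipQ_nonneg)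
qed

lemma XI_nm: "XI.nm z = sqrt (energy (snd z))" by (simp add: XI.nm_def ipX_def)

text \<open>
  Along a rapidly convergent subsequence the gradients converge in \<open>QL2\<close> and, by the \<open>L\<^sup>2\<close> bound, the functions
  converge in \<open>L\<^sup>2(\<nu>)\<close>, each by the pointwise Riesz-Fischer theorem; here invertibility of \<open>Q\<close> makes the limit of the
  gradients a function.
\<close>
lemma X_complete:
  assumes s: "\<And>n. s n \<in> X"
    and Cauchy: "\<And>e. e > 0 \<Longrightarrow> \<exists>N. \<forall>m\<ge>N. \<forall>n\<ge>N. XI.nm (s m - s n) < e"
  shows "\<exists>y\<in>X. (\<lambda>n. XI.nm (s n - y)) \<longlonglongrightarrow> 0"
proof -
  have "\<exists>N. \<forall>m\<ge>N. \<forall>n\<ge>N. XI.nm (s m - s n) < 1 / 2 ^ k" for k by (rule Cauchy) simp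
  then obtain N where N: "\<And>k m n. m \<ge> N k \<Longrightarrow> n \<ge> N k \<Longrightarrow> XI.nm (s m - s n) < 1 / 2 ^ k" by metis
  \<comment> \<open>The sum is a monotone sequence of indices above \<open>N\<close>.\<close>
  define r where "r k = (\<Sum>i\<le>k. N i)" for k
  have r: "N k \<le> r m" if "k \<le> m" for k m
    unfolding r_def using that by (intro member_le_sum) auto
  define u where "u k = fst (s (r k))" for k
  define D where "D k = snd (s (r k))" for k
  have uD: "(u k, D k) \<in> X" for k using s by (simp add: u_def D_def)
  have u_L2: "u k \<in> L2" and D_QL2: "D k \<in> QL2 Q \<Omega>" for k using uD by (auto simp: QH0_iff)
  have D_bound: "energy (\<lambda>x. D m x - D n x) \<le> 1 / 4 ^ n" if "n \<le> m" for m n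
  proof -
    have "XI.nm (s (r m) - s (r n)) < 1 / 2 ^ n" using r that by (intro N) auto
    then have "(XI.nm (s (r m) - s (r n)))\<^sup>2 \<le> (1 / 2 ^ n)\<^sup>2"
      by (intro power_mono) (auto simp: XI_nm ipQ_nonneg)
    also have "(1 / 2 ^ n)\<^sup>2 = (1 / 4 ^ n :: real)" by (simp add: power_divide power2_eq_square flip: power_mult_distrib)
    finally show ?thesis by (simp add: XI_nm ipQ_nonneg D_def fun_diff_def)
  qed
  have u_bound: "(LINT x|\<nu>. (u m x - u n x)\<^sup>2) \<le> multiplier_bound (\<lambda>x. 1) / 4 ^ n" if "n \<le> m" for m n
  proof -
    have "(u m - u n, D m - D n) \<in> X" using XI.closed(2)[OF uD uD, of m n] by simp
    then have "(LINT x|\<nu>. (u m x - u n x)\<^sup>2) \<le> multiplier_bound (\<lambda>x. 1) * energy (D m - D n)"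
      using L2_bound_QH0 by fastforce
    also have "\<dots> \<le> multiplier_bound (\<lambda>x. 1) * (1 / 4 ^ n)"
      using D_bound[OF that] multiplier_bound_nonneg by (intro mult_left_mono) (auto simp: fun_diff_def)
    finally show ?thesis by simp
  qed
  obtain yD where yD: "yD \<in> borel_measurable M" "\<And>n. integrable M (\<lambda>x. qf x (yD x - D n x) (yD x - D n x))"
    "\<And>n. (LINT x|M. qf x (yD x - D n x) (yD x - D n x)) \<le> 1 / 4 ^ n"
  proof (rule Riesz_Fischer_pointwise[where z = D and M = M and N = "\<lambda>x w. qf x w w" and C = 1])
    show "D n \<in> borel_measurable M" for n using D_QL2 by (simp add: QL2_iff)
    show "(\<lambda>x. qf x (w x) (w x)) \<in> borel_measurable M" if "w \<in> borel_measurable M" for w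
      using that by measurable
    show "0 \<le> qf x w w" if "x \<in> space M" for x w using that by (simp add: qf_nonneg)
    show "continuous_on UNIV (\<lambda>w. qf x w w)" for x
      unfolding qf_def by (intro continuous_intros linear_continuous_on matrix_vector_mul_bounded_linear)
    show "AE x in M. \<exists>c>0. \<forall>w. c * (norm w)\<^sup>2 \<le> qf x w w"
    proof -
      have "AE x in M. invertible (Q x)" using Q by (simp add: matrix_function_on_def)
      then show ?thesis using AE_space
      proof eventually_elim
        case (elim x)
        then obtain c where "c > 0" "\<And>w. c * (norm w)\<^sup>2 \<le> w \<bullet> (Q x *v w)"
          using psd_invertible_coercive[OF Q_psd] by auto
        then show ?case by (auto simp: qf_def)
      qed
    qed
    show "integrable M (\<lambda>x. qf x (D m x - D n x) (D m x - D n x))" for m n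
      using QL2_diff[OF D_QL2 D_QL2] by (simp add: QL2_iff)
    show "(LINT x|M. qf x (D m x - D n x) (D m x - D n x)) \<le> 1 / 4 ^ n" if "n \<le> m" for m n
      using D_bound[OF that] by (simp add: ipQ_def)
  qed (rule that)
  obtain yu where yu: "yu \<in> borel_measurable \<nu>" "\<And>n. integrable \<nu> (\<lambda>x. (yu x - u n x)\<^sup>2)"
    "\<And>n. (LINT x|\<nu>. (yu x - u n x)\<^sup>2) \<le> multiplier_bound (\<lambda>x. 1) / 4 ^ n"
  proof (rule Riesz_Fischer_pointwise[where z = u and M = \<nu> and N = "\<lambda>x a. a\<^sup>2"])
    show "u n \<in> borel_measurable \<nu>" for n using u_L2 by (simp add: L2_def)
    show "AE x in \<nu>. \<exists>c>0. \<forall>w. c * (norm w)\<^sup>2 \<le> (w::real)\<^sup>2" by (auto intro!: AE_I2 exI[of _ 1])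
    show "integrable \<nu> (\<lambda>x. (u m x - u n x)\<^sup>2)" for m n
      using L2_diff[OF u_L2 u_L2] by (simp add: L2_def)
  qed (use u_bound in \<open>auto intro!: continuous_intros\<close>)
  have yuL: "(\<lambda>x. yu x - u n x) \<in> L2" for n using yu u_L2[of n] by (auto simp: L2_def)
  have yDL: "(\<lambda>x. yD x - D n x) \<in> QL2 Q \<Omega>" for n using yD D_QL2[of n] by (auto simp: QL2_iff)
  have yL2: "yu \<in> L2" using L2_add[OF yuL[of 0] u_L2[of 0]] by simp
  have yQL2: "yD \<in> QL2 Q \<Omega>" using QL2_add[OF yDL[of 0] D_QL2[of 0]] by simp
  have geo: "(\<lambda>n. c / b ^ n) \<longlonglongrightarrow> 0" if "b > 1" for c b :: real
    using LIMSEQ_divide_realpow_zero[OF that] by simp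
  have "(yu, yD) \<in> X" unfolding QH0_iff
  proof (intro conjI allI impI yL2 yQL2)
    fix \<epsilon> :: real assume \<epsilon>: "\<epsilon> > 0"
    have "\<forall>\<^sub>F n in sequentially. multiplier_bound (\<lambda>x. 1) / 4 ^ n < \<epsilon> / 4 \<and> 1 / 4 ^ n < \<epsilon> / 4"
      using \<epsilon> order_tendstoD(2)[OF geo[of 4 "multiplier_bound (\<lambda>x. 1)"], of "\<epsilon> / 4"] order_tendstoD(2)[OF geo[of 4 1], of "\<epsilon> / 4"]
      by (intro eventually_conj) auto
    then obtain n where n: "multiplier_bound (\<lambda>x. 1) / 4 ^ n < \<epsilon> / 4" "1 / 4 ^ n < \<epsilon> / 4"
      using eventually_happens'[OF sequentially_bot] by blast
    have "\<epsilon> / 4 > 0" using \<epsilon> by simp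
    then obtain \<phi> where \<phi>: "\<phi> \<in> QLip0 Q v \<Omega>" "(LINT x|\<nu>. (u n x - \<phi> x)\<^sup>2) < \<epsilon> / 4"
        "energy (\<lambda>x. D n x - grad \<phi> x) < \<epsilon> / 4"
      using uD[of n] unfolding QH0_iff by meson
    have L: "(\<lambda>x. u n x - \<phi> x) \<in> L2" "(\<lambda>x. D n x - grad \<phi> x) \<in> QL2 Q \<Omega>"
      using \<phi>(1) u_L2 D_QL2 by (auto simp: QLip0_iff intro: L2_diff QL2_diff)
    have "(LINT x|\<nu>. (yu x - \<phi> x)\<^sup>2) < \<epsilon>"
    proof -
      have "(LINT x|\<nu>. (yu x - \<phi> x)\<^sup>2) \<le> 2 * (LINT x|\<nu>. (yu x - u n x)\<^sup>2) + 2 * (LINT x|\<nu>. (u n x - \<phi> x)\<^sup>2)"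
        using L2_dist_add_le[OF yuL[of n] L(1)] by simp
      then show ?thesis using yu(3)[of n] \<phi>(2) n(1) by linarith
    qed
    moreover have "energy (\<lambda>x. yD x - grad \<phi> x) < \<epsilon>"
    proof -
      have "energy (\<lambda>x. yD x - grad \<phi> x) \<le>
          2 * energy (\<lambda>x. yD x - D n x) + 2 * energy (\<lambda>x. D n x - grad \<phi> x)"
        using ipQ_add_le[OF yDL[of n] L(2)] by simp
      moreover have "energy (\<lambda>x. yD x - D n x) \<le> 1 / 4 ^ n" using yD(3) by (simp add: ipQ_def)
      ultimately show ?thesis using \<phi>(3) n(2) by linarith
    qed
    ultimately show "\<exists>\<phi>\<in>QLip0 Q v \<Omega>. (LINT x|\<nu>. (yu x - \<phi> x)\<^sup>2) < \<epsilon> \<and>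
        energy (\<lambda>x. yD x - grad \<phi> x) < \<epsilon>" using \<phi>(1) by blast
  qed
  moreover have "(\<lambda>n. XI.nm (s n - (yu, yD))) \<longlonglongrightarrow> 0"
  proof (rule LIMSEQ_I)
    fix e :: real assume e: "e > 0"
    obtain k where k: "1 / 2 ^ k < e / 2"
      using order_tendstoD(2)[OF geo[of 2 1], of "e / 2"] e
      by (auto simp: eventually_sequentially)
    have tail: "XI.nm (s (r k) - (yu, yD)) \<le> 1 / 2 ^ k"
    proof -
      have "XI.nm (s (r k) - (yu, yD)) = XI.nm ((yu, yD) - s (r k))"
        using s \<open>(yu, yD) \<in> X\<close> by (rule XI.nm_minus)
      also have "\<dots> = sqrt (LINT x|M. qf x (yD x - D k x) (yD x - D k x))"
        by (simp add: XI_nm ipQ_def D_def)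
      also have "\<dots> \<le> sqrt (1 / 4 ^ k)" using yD(3)[of k] by (rule real_sqrt_le_mono)
      also have "\<dots> = 1 / 2 ^ k" by (simp add: real_sqrt_divide real_sqrt_power)
      finally show ?thesis .
    qed
    have "norm (XI.nm (s n - (yu, yD)) - 0) < e" if "n \<ge> r k" for n
    proof -
      have "XI.nm (s n - y) = XI.nm ((s n - s (r k)) + (s (r k) - y))" for y by simp
      then have "XI.nm (s n - (yu, yD)) = XI.nm ((s n - s (r k)) + (s (r k) - (yu, yD)))" .
      also have "\<dots> \<le> XI.nm (s n - s (r k)) + XI.nm (s (r k) - (yu, yD))"
        using s \<open>(yu, yD) \<in> X\<close> by (intro XI.nm_triangle) auto
      also have "XI.nm (s n - s (r k)) < 1 / 2 ^ k" using r[of k k] that by (intro N) auto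
      finally have "XI.nm (s n - (yu, yD)) < e" using tail k by linarith
      then show ?thesis by (simp add: XI_nm ipQ_nonneg)
    qed
    then show "\<exists>no. \<forall>n\<ge>no. norm (XI.nm (s n - (yu, yD)) - 0) < e" by blast
  qed
  ultimately show ?thesis by blast
qed

sublocale XH: semi_hilbert X ipX
  by unfold_locales (rule X_complete)

end

section \<open>Bounded bilinear forms\<close>

context degenerate_sobolev
begin

text \<open>
  All lower-order terms are integrals of products of two such operators: multiplication by a coefficient and
  application of a vector field.
\<close>
definition L2_operator :: "((real ^ 'n \<Rightarrow> real) \<times> (real ^ 'n \<Rightarrow> real ^ 'n) \<Rightarrow> real ^ 'n \<Rightarrow> real) \<Rightarrow> bool" where
  "L2_operator A \<longleftrightarrow> (\<forall>z\<in>X. A z \<in> L2) \<and> (\<forall>y z x. A (y + z) x = A y x + A z x) \<and>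
     (\<forall>c z x. A (c *\<^sub>R z) x = c * A z x) \<and> (\<exists>k\<ge>0. \<forall>z\<in>X. (LINT x|\<nu>. (A z x)\<^sup>2) \<le> k * ipX z z)"

lemma L2_operatorD:
  assumes "L2_operator A"
  shows "A (y + z) x = A y x + A z x" "A (c *\<^sub>R z) x = c * A z x" "z \<in> X \<Longrightarrow> A z \<in> L2"
  using assms unfolding L2_operator_def by blast+

definition bounded_form :: "((real ^ 'n \<Rightarrow> real) \<times> (real ^ 'n \<Rightarrow> real ^ 'n) \<Rightarrow>
    (real ^ 'n \<Rightarrow> real) \<times> (real ^ 'n \<Rightarrow> real ^ 'n) \<Rightarrow> real) \<Rightarrow> bool" where
  "bounded_form B \<longleftrightarrow> (\<forall>x\<in>X. \<forall>y\<in>X. \<forall>z\<in>X. B (x + y) z = B x z + B y z \<and> B z (x + y) = B z x + B z y) \<and>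
     (\<forall>c. \<forall>x\<in>X. \<forall>y\<in>X. B (c *\<^sub>R x) y = c * B x y \<and> B x (c *\<^sub>R y) = c * B x y) \<and>
     (\<exists>k\<ge>0. \<forall>x\<in>X. \<forall>y\<in>X. \<bar>B x y\<bar> \<le> k * XI.nm x * XI.nm y)"

lemma L2_product:
  assumes "f \<in> L2" "g \<in> L2"
  shows "integrable \<nu> (\<lambda>x. f x * g x)"
    and "(LINT x|\<nu>. \<bar>f x * g x\<bar>) \<le> sqrt (LINT x|\<nu>. (f x)\<^sup>2) * sqrt (LINT x|\<nu>. (g x)\<^sup>2)"
  using Cauchy_Schwarz_integral[of f \<nu> g] assms by (auto simp: L2_def)

lemma L2_product_abs_le:
  assumes "f \<in> L2" "g \<in> L2"
  shows "\<bar>LINT x|\<nu>. f x * g x\<bar> \<le> sqrt (LINT x|\<nu>. (f x)\<^sup>2) * sqrt (LINT x|\<nu>. (g x)\<^sup>2)"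
  using integral_abs_bound[of \<nu> "\<lambda>x. f x * g x"] L2_product(2)[OF assms] by linarith

lemma L2_operator_sqrt_bound:
  assumes "L2_operator A"
  obtains k where "k \<ge> 0" "\<And>z. z \<in> X \<Longrightarrow> sqrt (LINT x|\<nu>. (A z x)\<^sup>2) \<le> k * XI.nm z"
proof -
  obtain k where k: "k \<ge> 0" "\<And>z. z \<in> X \<Longrightarrow> (LINT x|\<nu>. (A z x)\<^sup>2) \<le> k * ipX z z"
    using assms by (auto simp: L2_operator_def)
  have "sqrt (LINT x|\<nu>. (A z x)\<^sup>2) \<le> sqrt k * XI.nm z" if "z \<in> X" for z
    using real_sqrt_le_mono[OF k(2)[OF that]] by (simp add: real_sqrt_mult XI.nm_def)
  then show ?thesis using k(1) that[of "sqrt k"] by simp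
qed

lemma bounded_form_L2_operator:
  assumes A: "L2_operator A" and A': "L2_operator A'"
  shows "bounded_form (\<lambda>y z. LINT x|\<nu>. A y x * A' z x)"
proof -
  obtain k where k: "k \<ge> 0" "\<And>z. z \<in> X \<Longrightarrow> sqrt (LINT x|\<nu>. (A z x)\<^sup>2) \<le> k * XI.nm z"
    using L2_operator_sqrt_bound[OF A] by blast
  obtain k' where k': "k' \<ge> 0" "\<And>z. z \<in> X \<Longrightarrow> sqrt (LINT x|\<nu>. (A' z x)\<^sup>2) \<le> k' * XI.nm z"
    using L2_operator_sqrt_bound[OF A'] by blast
  have int: "integrable \<nu> (\<lambda>x. A y x * A' z x)" if "y \<in> X" "z \<in> X" for y z
    using L2_product(1) A A' that by (auto simp: L2_operator_def)
  have lin: "A (y + z) x = A y x + A z x" "A' (y + z) x = A' y x + A' z x"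
     "A (c *\<^sub>R z) x = c * A z x" "A' (c *\<^sub>R z) x = c * A' z x" for y z x c
    using A A' by (simp_all only: L2_operatorD)
  have "\<bar>LINT x|\<nu>. A y x * A' z x\<bar> \<le> (k * k') * XI.nm y * XI.nm z" if "y \<in> X" "z \<in> X" for y z
  proof -
    have "\<bar>LINT x|\<nu>. A y x * A' z x\<bar> \<le> sqrt (LINT x|\<nu>. (A y x)\<^sup>2) * sqrt (LINT x|\<nu>. (A' z x)\<^sup>2)"
      using A A' that by (intro L2_product_abs_le) (auto simp: L2_operator_def)
    also have "\<dots> \<le> (k * XI.nm y) * (k' * XI.nm z)"
      using k k' that XI.nm_nonneg by (intro mult_mono) auto
    finally show ?thesis by (simp add: mult_ac)
  qed
  moreover have "k * k' \<ge> 0" using k(1) k'(1) by simp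
  ultimately show ?thesis unfolding bounded_form_def
    by (auto simp: lin int distrib_left distrib_right mult.assoc mult.left_commute[of _ _ "A' _ _"] mult.left_commute)
qed

lemma bounded_form_add:
  assumes B: "bounded_form B" and B': "bounded_form B'"
  shows "bounded_form (\<lambda>y z. B y z + B' y z)"
proof -
  obtain k where k: "k \<ge> 0" "\<And>y z. y \<in> X \<Longrightarrow> z \<in> X \<Longrightarrow> \<bar>B y z\<bar> \<le> k * XI.nm y * XI.nm z"
    using B by (auto simp: bounded_form_def)
  obtain k' where k': "k' \<ge> 0" "\<And>y z. y \<in> X \<Longrightarrow> z \<in> X \<Longrightarrow> \<bar>B' y z\<bar> \<le> k' * XI.nm y * XI.nm z"
    using B' by (auto simp: bounded_form_def)
  have "\<bar>B y z + B' y z\<bar> \<le> (k + k') * XI.nm y * XI.nm z" if "y \<in> X" "z \<in> X" for y z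
    using k(2)[OF that] k'(2)[OF that] by (simp add: algebra_simps)
  moreover have "k + k' \<ge> 0" using k(1) k'(1) by simp
  ultimately have "\<exists>k\<ge>0. \<forall>y\<in>X. \<forall>z\<in>X. \<bar>B y z + B' y z\<bar> \<le> k * XI.nm y * XI.nm z" by blast
  moreover have "B (x + y) z + B' (x + y) z = B x z + B' x z + (B y z + B' y z) \<and>
      B z (x + y) + B' z (x + y) = B z x + B' z x + (B z y + B' z y)" if "x \<in> X" "y \<in> X" "z \<in> X" for x y z
    using B B' that by (simp add: bounded_form_def)
  moreover have "B (c *\<^sub>R x) y + B' (c *\<^sub>R x) y = c * (B x y + B' x y) \<and>
      B x (c *\<^sub>R y) + B' x (c *\<^sub>R y) = c * (B x y + B' x y)" if "x \<in> X" "y \<in> X" for c x y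
    using B B' that by (simp add: bounded_form_def distrib_left)
  ultimately show ?thesis unfolding bounded_form_def by blast
qed

lemma bounded_form_sum:
  assumes "finite I" "\<And>i. i \<in> I \<Longrightarrow> bounded_form (B i)"
  shows "bounded_form (\<lambda>y z. \<Sum>i\<in>I. B i y z)"
  using assms
proof (induction I rule: finite_induct)
  case empty
  show ?case by (auto simp: bounded_form_def)
next
  case (insert i I)
  then show ?case using bounded_form_add[of "B i" "\<lambda>y z. \<Sum>i\<in>I. B i y z"] by simp
qed

lemma L2_operator_multiplier:
  assumes b: "multiplier b"
  shows "L2_operator (\<lambda>z x. b x * fst z x)"
proof -
  have "\<exists>k\<ge>0. \<forall>z\<in>X. (LINT x|\<nu>. (b x * fst z x)\<^sup>2) \<le> k * ipX z z"
    using multiplier_QH0(2)[OF b] multiplier_bound_nonneg[of b] by (auto simp: ipX_def intro!: exI[of _ "multiplier_bound b"])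
  moreover have "(\<lambda>x. b x * fst z x) \<in> L2" if "z \<in> X" for z
    using multiplier_QH0(1)[OF b, of "fst z" "snd z"] that by simp
  ultimately show ?thesis by (simp add: L2_operator_def distrib_left mult.left_commute)
qed

text \<open>Here the zero-order part of the norm in the definition of a subunit field is replaced by the energy.\<close>
lemma L2_operator_subunit:
  assumes V: "degenerate_subunit Q v \<Omega> V"
  shows "L2_operator (\<lambda>z x. V x \<bullet> snd z x)"
proof -
  obtain c where c: "\<And>u Du. (u, Du) \<in> QH Q v \<Omega> \<Longrightarrow> (\<lambda>x. V x \<bullet> Du x) \<in> L2"
    "\<And>u Du. (u, Du) \<in> QH Q v \<Omega> \<Longrightarrow> weighted_Lp_norm 2 v \<Omega> (\<lambda>x. V x \<bullet> Du x) \<le> c * QH_norm Q v \<Omega> u Du"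
    using V unfolding degenerate_subunit_def weighted_L2 by (auto split: prod.splits)
  define k where "k = \<bar>c\<bar> * (sqrt (multiplier_bound (\<lambda>x. 1)) + 1)"
  have k: "k \<ge> 0" using multiplier_bound_nonneg by (simp add: k_def)
  have "(LINT x|\<nu>. (V x \<bullet> snd z x)\<^sup>2) \<le> k\<^sup>2 * ipX z z" if z: "z \<in> X" for z
  proof -
    obtain u Du where z': "z = (u, Du)" by (metis surj_pair)
    have uX: "(u, Du) \<in> X" using z z' by simp
    then have uQ: "(u, Du) \<in> QH Q v \<Omega>" using QH0_subset_QH by blast
    have u: "u \<in> L2" using uX by (simp add: QH0_iff)
    have n0: "QH_norm Q v \<Omega> u Du = sqrt (LINT x|\<nu>. (u x)\<^sup>2) + sqrt (energy Du)"
      using u by (simp add: QH_norm_def QL2_norm_eq weighted_L2_norm L2_def)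
    have "sqrt (LINT x|\<nu>. (u x)\<^sup>2) \<le> sqrt (multiplier_bound (\<lambda>x. 1)) * sqrt (energy Du)"
      using real_sqrt_le_mono[OF L2_bound_QH0[OF uX]] by (simp add: real_sqrt_mult)
    then have n1: "QH_norm Q v \<Omega> u Du \<le> (sqrt (multiplier_bound (\<lambda>x. 1)) + 1) * sqrt (energy Du)"
      unfolding n0 by (simp add: algebra_simps)
    have n2: "0 \<le> QH_norm Q v \<Omega> u Du" unfolding n0 by (simp add: ipQ_nonneg)
    have "sqrt (LINT x|\<nu>. (V x \<bullet> Du x)\<^sup>2) \<le> c * QH_norm Q v \<Omega> u Du"
      using c(2)[OF uQ] c(1)[OF uQ] by (simp add: weighted_L2_norm L2_def)
    also have "\<dots> \<le> \<bar>c\<bar> * QH_norm Q v \<Omega> u Du" using n2 by (intro mult_right_mono) auto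
    also have "\<dots> \<le> \<bar>c\<bar> * ((sqrt (multiplier_bound (\<lambda>x. 1)) + 1) * sqrt (energy Du))" using n1 by (intro mult_left_mono) auto
    also have "\<dots> = k * sqrt (energy Du)" by (simp add: k_def)
    finally have "(sqrt (LINT x|\<nu>. (V x \<bullet> Du x)\<^sup>2))\<^sup>2 \<le> (k * sqrt (energy Du))\<^sup>2"
      by (intro power_mono) auto
    then show ?thesis by (simp add: z' ipX_def power_mult_distrib ipQ_nonneg)
  qed
  moreover have "(\<lambda>x. V x \<bullet> snd z x) \<in> L2" if "z \<in> X" for z
    using c(1)[of "fst z" "snd z"] that QH0_subset_QH by auto
  moreover have "k\<^sup>2 \<ge> 0" by simp
  ultimately have "\<exists>k\<ge>0. \<forall>z\<in>X. (LINT x|\<nu>. (V x \<bullet> snd z x)\<^sup>2) \<le> k * ipX z z" by blast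
  then show ?thesis using \<open>\<And>z. z \<in> X \<Longrightarrow> (\<lambda>x. V x \<bullet> snd z x) \<in> L2\<close>
    by (simp add: L2_operator_def inner_add_right)
qed

lemma bounded_functional_L2_operator:
  assumes A: "L2_operator A" and f: "f \<in> L2"
  shows "XH.bounded_functional (\<lambda>z. LINT x|\<nu>. f x * A z x)"
proof -
  obtain k where k: "k \<ge> 0" "\<And>z. z \<in> X \<Longrightarrow> sqrt (LINT x|\<nu>. (A z x)\<^sup>2) \<le> k * XI.nm z"
    using L2_operator_sqrt_bound[OF A] by blast
  have AL: "A z \<in> L2" if "z \<in> X" for z using A that by (simp add: L2_operator_def)
  show ?thesis
  proof (rule XH.bounded_functionalI)
    fix z assume z: "z \<in> X"
    have "\<bar>LINT x|\<nu>. f x * A z x\<bar> \<le> sqrt (LINT x|\<nu>. (f x)\<^sup>2) * sqrt (LINT x|\<nu>. (A z x)\<^sup>2)"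
      using f AL[OF z] by (rule L2_product_abs_le)
    also have "\<dots> \<le> sqrt (LINT x|\<nu>. (f x)\<^sup>2) * (k * XI.nm z)"
      using k(2)[OF z] by (intro mult_left_mono) auto
    finally show "\<bar>LINT x|\<nu>. f x * A z x\<bar> \<le> (sqrt (LINT x|\<nu>. (f x)\<^sup>2) * k) * XI.nm z" by simp
  next
    fix y z assume "y \<in> X" "z \<in> X"
    then have "integrable \<nu> (\<lambda>x. f x * A y x)" "integrable \<nu> (\<lambda>x. f x * A z x)"
      using L2_product(1)[OF f AL] by auto
    then show "(LINT x|\<nu>. f x * A (y + z) x) = (LINT x|\<nu>. f x * A y x) + (LINT x|\<nu>. f x * A z x)"
      by (simp add: L2_operatorD[OF A] distrib_left)
  next
    show "(LINT x|\<nu>. f x * A (c *\<^sub>R z) x) = c * (LINT x|\<nu>. f x * A z x)" for c z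
      by (simp add: L2_operatorD[OF A] mult.left_commute)
  qed
qed

lemma multiplier_if_Lq:
  assumes b: "b \<in> borel_measurable M" and q: "q \<ge> 2 * \<sigma>'" and int: "integrable \<nu> (\<lambda>x. \<bar>b x\<bar> powr q)"
  shows "multiplier b"
proof -
  interpret finite_measure \<nu> by (rule finite_\<nu>)
  have "integrable \<nu> (\<lambda>x. \<bar>b x\<bar> powr (2 * \<sigma>'))"
  proof (rule Bochner_Integration.integrable_bound)
    show "integrable \<nu> (\<lambda>x. 1 + \<bar>b x\<bar> powr q)" using int by simp
    have "\<bar>b x\<bar> powr (2 * \<sigma>') \<le> 1 + \<bar>b x\<bar> powr q" for x
    proof (cases "\<bar>b x\<bar> \<ge> 1")
      case True
      then have "\<bar>b x\<bar> powr (2 * \<sigma>') \<le> \<bar>b x\<bar> powr q" using q by (intro powr_mono) auto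
      then show ?thesis by simp
    next
      case False
      then have "\<bar>b x\<bar> powr (2 * \<sigma>') \<le> 1 powr (2 * \<sigma>')" using \<sigma>' by (intro powr_mono2) auto
      then show ?thesis by (simp add: add_increasing2)
    qed
    then show "AE x in \<nu>. norm (\<bar>b x\<bar> powr (2 * \<sigma>')) \<le> norm (1 + \<bar>b x\<bar> powr q)"
      by (intro always_eventually) (simp add: add_nonneg_nonneg)
  qed (use b in auto)
  then show ?thesis using b by (simp add: multiplier_def)
qed

lemma multiplier_mono:
  assumes b: "multiplier b" and a: "a \<in> borel_measurable M" and le: "\<And>x. \<bar>a x\<bar> \<le> \<bar>b x\<bar>"
  shows "multiplier a"
proof -
  have "integrable \<nu> (\<lambda>x. \<bar>a x\<bar> powr (2 * \<sigma>'))"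
  proof (rule Bochner_Integration.integrable_bound)
    show "integrable \<nu> (\<lambda>x. \<bar>b x\<bar> powr (2 * \<sigma>'))" using b by (simp add: multiplier_def)
    show "AE x in \<nu>. norm (\<bar>a x\<bar> powr (2 * \<sigma>')) \<le> norm (\<bar>b x\<bar> powr (2 * \<sigma>'))"
      using le \<sigma>' by (intro always_eventually) (auto intro!: powr_mono2)
  qed (use a in auto)
  then show ?thesis using a by (simp add: multiplier_def)
qed

lemma bounded_form_cong:
  assumes "bounded_form B" "\<And>y z. y \<in> X \<Longrightarrow> z \<in> X \<Longrightarrow> B' y z = B y z"
  shows "bounded_form B'"
proof -
  have eq: "B' y z = B y z" if "y \<in> X" "z \<in> X" for y z using assms(2) that .
  show ?thesis
    using assms(1) unfolding bounded_form_def
    by (simp add: eq XI.closed del: split_paired_All split_paired_Ex)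
qed

lemma bounded_form_swap: "bounded_form B \<Longrightarrow> bounded_form (\<lambda>y z. B z y)"
proof -
  assume B: "bounded_form B"
  then obtain k where k: "k \<ge> 0" "\<And>y z. y \<in> X \<Longrightarrow> z \<in> X \<Longrightarrow> \<bar>B y z\<bar> \<le> k * XI.nm y * XI.nm z"
    unfolding bounded_form_def by blast
  have "\<bar>B z y\<bar> \<le> k * XI.nm y * XI.nm z" if "y \<in> X" "z \<in> X" for y z
    using k(2)[OF that(2,1)] by (simp only: mult.assoc mult.commute[of "XI.nm y"])
  then have "\<exists>k\<ge>0. \<forall>y\<in>X. \<forall>z\<in>X. \<bar>B z y\<bar> \<le> k * XI.nm y * XI.nm z" using k(1) by blast
  then show ?thesis using B unfolding bounded_form_def by blast
qed

lemma fields_dot_integral: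
  assumes H: "\<And>i. (\<lambda>x. H x $ i * f x) \<in> L2" and R: "\<And>i. (\<lambda>x. R i x \<bullet> D x) \<in> L2"
  shows "integrable \<nu> (\<lambda>x. fields_dot H R D x * f x)"
    and "(LINT x|\<nu>. fields_dot H R D x * f x) = (\<Sum>i\<in>UNIV. LINT x|\<nu>. (R i x \<bullet> D x) * (H x $ i * f x))"
proof -
  have eq: "(\<lambda>x. fields_dot H R D x * f x) = (\<lambda>x. \<Sum>i\<in>UNIV. (R i x \<bullet> D x) * (H x $ i * f x))"
    by (simp add: fields_dot_def sum_distrib_left mult_ac)
  have int: "integrable \<nu> (\<lambda>x. (R i x \<bullet> D x) * (H x $ i * f x))" for i
    using L2_product(1)[OF R H] .
  show "integrable \<nu> (\<lambda>x. fields_dot H R D x * f x)" unfolding eq using int by simp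
  show "(LINT x|\<nu>. fields_dot H R D x * f x) = (\<Sum>i\<in>UNIV. LINT x|\<nu>. (R i x \<bullet> D x) * (H x $ i * f x))"
    unfolding eq using int by simp
qed

lemma multiplier_component:
  assumes "multiplier (\<lambda>x. norm (H x))" "H \<in> borel_measurable M"
  shows "multiplier (\<lambda>x. H x $ i)"
proof (rule multiplier_mono[OF assms(1)])
  show "(\<lambda>x. H x $ i) \<in> borel_measurable M"
    using assms(2) by (simp add: cart_eq_inner_axis)
qed (simp add: component_le_norm_cart)

lemma bounded_form_fields_dot:
  assumes H: "multiplier (\<lambda>x. norm (H x))" "H \<in> borel_measurable M"
    and R: "\<And>i. degenerate_subunit Q v \<Omega> (R i)"
  shows "bounded_form (\<lambda>y z. LINT x|\<nu>. fields_dot H R (snd y) x * fst z x)"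
proof -
  note lH = L2_operator_multiplier[OF multiplier_component[OF H]]
  note lR = L2_operator_subunit[OF R]
  have "bounded_form (\<lambda>y z. \<Sum>i\<in>UNIV. LINT x|\<nu>. (R i x \<bullet> snd y x) * (H x $ i * fst z x))"
    using bounded_form_L2_operator[OF lR lH] by (intro bounded_form_sum) auto
  then show ?thesis
    by (rule bounded_form_cong) (rule fields_dot_integral(2)[OF L2_operatorD(3)[OF lH] L2_operatorD(3)[OF lR]])
qed

text \<open>The dense subset of \<open>QH0\<close> on which the a priori estimate is proved.\<close>
definition test_pairs :: "((real ^ 'n \<Rightarrow> real) \<times> (real ^ 'n \<Rightarrow> real ^ 'n)) set" where
  "test_pairs = (\<lambda>\<phi>. (\<phi>, grad \<phi>)) ` QLip0 Q v \<Omega>"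

lemma test_pairs_sub: "test_pairs \<subseteq> X" using QLip0_in_QH0 by (auto simp: test_pairs_def)

lemma test_pairs_dense:
  assumes z: "z \<in> X" and e: "e > 0"
  shows "\<exists>d\<in>test_pairs. XI.nm (z - d) < e"
proof -
  obtain u Du where z': "z = (u, Du)" by (metis surj_pair)
  have "e\<^sup>2 > 0" using e by simp
  then obtain \<phi> where \<phi>: "\<phi> \<in> QLip0 Q v \<Omega>" "energy (\<lambda>x. Du x - grad \<phi> x) < e\<^sup>2"
    using z unfolding z' QH0_iff by meson
  then have "XI.nm (z - (\<phi>, grad \<phi>)) < e"
    using e by (simp add: z' XI_nm fun_diff_def real_less_lsqrt)
  then show ?thesis using \<phi>(1) by (auto simp: test_pairs_def)
qed

end

section \<open>The a priori estimate\<close>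

locale degenerate_operator = degenerate_sobolev \<Omega> v Q \<sigma> C
  for \<Omega> :: "(real ^ 'n) set" and v :: "real ^ 'n \<Rightarrow> real" and Q :: "real ^ 'n \<Rightarrow> real ^ 'n ^ 'n"
    and \<sigma> C :: real +
  fixes H G :: "real ^ 'n \<Rightarrow> real ^ 'N" and R S :: "'N \<Rightarrow> real ^ 'n \<Rightarrow> real ^ 'n" and F :: "real ^ 'n \<Rightarrow> real"
  assumes H: "H \<in> weighted_Lp 2 v \<Omega>" and G: "G \<in> weighted_Lp 2 v \<Omega>" and F: "F \<in> weighted_Lp 2 v \<Omega>"
    and H_multiplier: "multiplier (\<lambda>x. norm (H x))" and G_multiplier: "multiplier (\<lambda>x. norm (G x))"
    and F_multiplier: "multiplier (\<lambda>x. sqrt \<bar>F x\<bar>)"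
    and R: "\<And>i. degenerate_subunit Q v \<Omega> (R i)" and S: "\<And>i. degenerate_subunit Q v \<Omega> (S i)"
    and sign: "\<And>\<phi>. \<phi> \<in> QLip0 Q v \<Omega> \<Longrightarrow> (\<forall>x\<in>\<Omega>. 0 \<le> \<phi> x) \<Longrightarrow>
           0 \<le> (LINT x|lebesgue_on \<Omega>. (fields_dot G S (grad \<phi>) x + F x * \<phi> x) * v x)"
begin

lemma H_meas [measurable]: "H \<in> borel_measurable M" and G_meas [measurable]: "G \<in> borel_measurable M"
  and F_meas [measurable]: "F \<in> borel_measurable M"
  using H G F by (auto simp: weighted_Lp_def)

text \<open>The three lower-order integrals of the weak equation, as a form in the solution \<open>y\<close> and the test pair \<open>z\<close>.\<close>
definition lower_order :: "(real ^ 'n \<Rightarrow> real) \<times> (real ^ 'n \<Rightarrow> real ^ 'n) \<Rightarrow>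
    (real ^ 'n \<Rightarrow> real) \<times> (real ^ 'n \<Rightarrow> real ^ 'n) \<Rightarrow> real" where
  "lower_order y z = (LINT x|\<nu>. fields_dot H R (snd y) x * fst z x)
     + (LINT x|\<nu>. fields_dot G S (snd z) x * fst y x) + (LINT x|\<nu>. F x * fst y x * fst z x)"

text \<open>
  For the term with \<open>F\<close>, one factor \<open>\<surd>|F|\<close> is given to each of the two functions; this explains the exponent \<open>q/2\<close>
  for \<open>F\<close>.
\<close>
lemma bounded_form_lower_order: "bounded_form lower_order"
proof -
  have sF: "multiplier (\<lambda>x. sgn (F x) * sqrt \<bar>F x\<bar>)"
    by (rule multiplier_mono[OF F_multiplier]) (auto simp: abs_mult abs_sgn_eq)
  have F_eq: "F x = (sgn (F x) * sqrt \<bar>F x\<bar>) * sqrt \<bar>F x\<bar>" for x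
    by (simp add: mult.assoc sgn_mult_abs)
  have "bounded_form (\<lambda>y z. LINT x|\<nu>. (sgn (F x) * sqrt \<bar>F x\<bar>) * fst y x * (sqrt \<bar>F x\<bar> * fst z x))"
    by (rule bounded_form_L2_operator[OF L2_operator_multiplier[OF sF] L2_operator_multiplier[OF F_multiplier]])
  moreover have "(sgn (F x) * sqrt \<bar>F x\<bar>) * a * (sqrt \<bar>F x\<bar> * b) = F x * a * b" for x a b
    by (subst (3) F_eq) (simp add: mult_ac)
  ultimately have "bounded_form (\<lambda>y z. LINT x|\<nu>. F x * fst y x * fst z x)" by (simp only:)
  then show ?thesis unfolding lower_order_def[abs_def]
    by (intro bounded_form_add bounded_form_fields_dot[OF H_multiplier H_meas R]
        bounded_form_swap[OF bounded_form_fields_dot[OF G_multiplier G_meas S]])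
qed

text \<open>The maximum, unlike the sum, satisfies \<open>h\<^sup>p \<le> |H|\<^sup>p + |G|\<^sup>p\<close> with constant one for every exponent.\<close>
definition HG_max :: "real ^ 'n \<Rightarrow> real" where "HG_max x = max (norm (H x)) (norm (G x))"

lemma HG_max_meas [measurable]: "HG_max \<in> borel_measurable M" unfolding HG_max_def by measurable

lemma HG_max_bounds: "\<bar>H x $ i\<bar> \<le> HG_max x" "\<bar>G x $ i\<bar> \<le> HG_max x" "0 \<le> HG_max x"
  using component_le_norm_cart[of "H x" i] component_le_norm_cart[of "G x" i] norm_ge_zero[of "H x"]
  unfolding HG_max_def by linarith+

lemma HG_max_multiplier: "multiplier HG_max"
proof -
  have "integrable \<nu> (\<lambda>x. \<bar>HG_max x\<bar> powr (2 * \<sigma>'))"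
  proof (rule Bochner_Integration.integrable_bound)
    show "integrable \<nu> (\<lambda>x. \<bar>norm (H x)\<bar> powr (2 * \<sigma>') + \<bar>norm (G x)\<bar> powr (2 * \<sigma>'))"
      using H_multiplier G_multiplier unfolding multiplier_def by (intro Bochner_Integration.integrable_add) auto
    show "AE x in \<nu>. norm (\<bar>HG_max x\<bar> powr (2 * \<sigma>')) \<le> norm (\<bar>norm (H x)\<bar> powr (2 * \<sigma>') + \<bar>norm (G x)\<bar> powr (2 * \<sigma>'))"
      by (intro always_eventually allI) (auto simp: HG_max_def max_def)
  qed measurable
  then show ?thesis by (simp add: multiplier_def)
qed

lemma HG_max_L2: "HG_max \<in> L2"
proof -
  have "integrable \<nu> (\<lambda>x. (HG_max x)\<^sup>2)"
  proof (rule Bochner_Integration.integrable_bound)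
    show "integrable \<nu> (\<lambda>x. (norm (H x))\<^sup>2 + (norm (G x))\<^sup>2)"
      using H G unfolding weighted_Lp_iff by (intro Bochner_Integration.integrable_add) auto
    show "AE x in \<nu>. norm ((HG_max x)\<^sup>2) \<le> norm ((norm (H x))\<^sup>2 + (norm (G x))\<^sup>2)"
      by (intro always_eventually allI) (auto simp: HG_max_def max_def)
  qed measurable
  then show ?thesis by (simp add: L2_def)
qed

lemma components_L2: "(\<lambda>x. H x $ i) \<in> L2" "(\<lambda>x. G x $ i) \<in> L2" and F_L2: "F \<in> L2"
proof -
  have m: "(\<lambda>x. H x $ i) \<in> borel_measurable M" "(\<lambda>x. G x $ i) \<in> borel_measurable M"
    by (simp_all add: cart_eq_inner_axis)
  show "(\<lambda>x. H x $ i) \<in> L2" "(\<lambda>x. G x $ i) \<in> L2"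
    using HG_max_bounds m by (auto intro!: L2_dominated[OF _ HG_max_L2, of _ 1])
  show "F \<in> L2" using F by (simp add: weighted_L2)
qed

text \<open>The constant \<open>A\<close> of the estimate: the vector fields are bounded from the energy space to \<open>L\<^sup>2(\<nu>)\<close>.\<close>
lemma field_constant:
  obtains A0 where "A0 \<ge> 0" "\<And>z. z \<in> X \<Longrightarrow>
    (\<Sum>i\<in>UNIV. sqrt (LINT x|\<nu>. (R i x \<bullet> snd z x)\<^sup>2) + sqrt (LINT x|\<nu>. (S i x \<bullet> snd z x)\<^sup>2)) \<le> A0 * XI.nm z"
proof -
  have choose: "\<exists>k. \<forall>i. 0 \<le> k i \<and> (\<forall>z\<in>X. sqrt (LINT x|\<nu>. (V i x \<bullet> snd z x)\<^sup>2) \<le> k i * XI.nm z)"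
    if V: "\<And>i. degenerate_subunit Q v \<Omega> (V i)" for V :: "'N \<Rightarrow> real ^ 'n \<Rightarrow> real ^ 'n"
  proof (rule choice, rule allI)
    fix i
    obtain k where "k \<ge> 0" "\<And>z. z \<in> X \<Longrightarrow> sqrt (LINT x|\<nu>. (V i x \<bullet> snd z x)\<^sup>2) \<le> k * XI.nm z"
      using L2_operator_sqrt_bound[OF L2_operator_subunit[OF V[of i]]] by blast
    then show "\<exists>k. 0 \<le> k \<and> (\<forall>z\<in>X. sqrt (LINT x|\<nu>. (V i x \<bullet> snd z x)\<^sup>2) \<le> k * XI.nm z)" by blast
  qed
  from choose[of R, OF R] obtain kR where kR': "\<forall>i. 0 \<le> kR i \<and>
    (\<forall>z\<in>X. sqrt (LINT x|\<nu>. (R i x \<bullet> snd z x)\<^sup>2) \<le> kR i * XI.nm z)" by (elim exE)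
  have kR: "kR i \<ge> 0" "z \<in> X \<Longrightarrow> sqrt (LINT x|\<nu>. (R i x \<bullet> snd z x)\<^sup>2) \<le> kR i * XI.nm z" for i z
    using spec[OF kR', of i] by (simp_all only: Ball_def)
  from choose[of S, OF S] obtain kS where kS': "\<forall>i. 0 \<le> kS i \<and>
    (\<forall>z\<in>X. sqrt (LINT x|\<nu>. (S i x \<bullet> snd z x)\<^sup>2) \<le> kS i * XI.nm z)" by (elim exE)
  have kS: "kS i \<ge> 0" "z \<in> X \<Longrightarrow> sqrt (LINT x|\<nu>. (S i x \<bullet> snd z x)\<^sup>2) \<le> kS i * XI.nm z" for i z
    using spec[OF kS', of i] by (simp_all only: Ball_def)
  have "(\<Sum>i\<in>UNIV. sqrt (LINT x|\<nu>. (R i x \<bullet> snd z x)\<^sup>2) + sqrt (LINT x|\<nu>. (S i x \<bullet> snd z x)\<^sup>2))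
      \<le> (\<Sum>i\<in>UNIV. kR i + kS i) * XI.nm z" if "z \<in> X" for z
    unfolding sum_distrib_right distrib_right using kR(2)[OF that] kS(2)[OF that]
    by (intro sum_mono add_mono) auto
  moreover have "(\<Sum>i\<in>UNIV. kR i + kS i) \<ge> 0" using kR(1) kS(1) by (intro sum_nonneg add_nonneg_nonneg) auto
  ultimately show ?thesis using that by blast
qed

text \<open>
  The pair \<open>(\<phi>, grad \<phi>)\<close> is the approximate solution of the adjoint problem, and \<open>T \<phi>\<close> is the test function.  The
  factorization \<open>T' = \<psi>\<^sup>2\<close> distributes the derivative: one factor \<open>\<psi>\<close> makes \<open>R\<^sub>i (T \<phi>)\<close> into \<open>R\<^sub>i (\<Psi> \<phi>)\<close>, whose norm is controlled by
  that of \<open>grad (\<Psi> \<phi>)\<close>, and the other stays with \<open>\<phi>\<close>.  The principal term is exactly the energy \<open>p\<^sup>2\<close> of \<open>\<Psi> \<phi>\<close>; the bound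
  \<open>|\<psi>| \<le> 1\<close> ensures that \<open>T \<phi>\<close> has at most this energy, so that a factor \<open>p\<close> can be cancelled.
\<close>
lemma test_inequality:
  assumes \<phi>: "\<phi> \<in> QLip0 Q v \<Omega>" and t: "0 \<le> t" "t \<le> 1" and m: "m \<ge> 0"
    and bound: "\<And>u. u \<in> test_pairs \<Longrightarrow> \<bar>ipX u (\<phi>, grad \<phi>) + t * lower_order u (\<phi>, grad \<phi>)\<bar> \<le> m * XI.nm u"
    and A0: "A0 \<ge> 0" "\<And>z. z \<in> X \<Longrightarrow>
      (\<Sum>i\<in>UNIV. sqrt (LINT x|\<nu>. (R i x \<bullet> snd z x)\<^sup>2) + sqrt (LINT x|\<nu>. (S i x \<bullet> snd z x)\<^sup>2)) \<le> A0 * XI.nm z"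
    and T: "\<And>s. (T has_real_derivative (\<psi> s)\<^sup>2) (at s)" "T 0 = 0" "\<And>s. 0 \<le> s * T s"
    and \<Psi>: "\<And>s. (\<Psi> has_real_derivative \<psi> s) (at s)" "\<Psi> 0 = 0"
    and \<psi>: "continuous_on UNIV \<psi>" "\<And>s. \<bar>\<psi> s\<bar> \<le> 1"
  shows "XI.nm (\<lambda>x. \<Psi> (\<phi> x), grad (\<lambda>x. \<Psi> (\<phi> x))) \<le> m + A0 * sqrt (LINT x|\<nu>. (HG_max x * (\<phi> x * \<psi> (\<phi> x)))\<^sup>2)"
proof -
  have [measurable]: "\<psi> \<in> borel_measurable borel" using \<psi>(1) by (rule borel_measurable_continuous_onI)
  have T_cont: "continuous_on UNIV T" using T(1) by (auto intro: continuous_at_imp_continuous_on DERIV_isCont)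
  have [measurable]: "T \<in> borel_measurable borel" using T_cont by (rule borel_measurable_continuous_onI)
  have \<phi>L [measurable]: "\<phi> \<in> borel_measurable M" using \<phi> by (simp add: QLip0_iff L2_def)
  define \<tau> where "\<tau> x = T (\<phi> x)" for x
  define \<eta> where "\<eta> x = \<Psi> (\<phi> x)" for x
  define \<theta> where "\<theta> x = \<phi> x * T (\<phi> x)" for x
  have \<tau>: "\<tau> \<in> QLip0 Q v \<Omega>" "AE x in M. grad \<tau> x = (\<psi> (\<phi> x))\<^sup>2 *\<^sub>R grad \<phi> x"
    unfolding \<tau>_def using QLip0_compose[OF \<phi>, of T "\<lambda>s. (\<psi> s)\<^sup>2"] T \<psi>(1) by (auto intro: continuous_intros)
  have \<eta>: "\<eta> \<in> QLip0 Q v \<Omega>" "AE x in M. grad \<eta> x = \<psi> (\<phi> x) *\<^sub>R grad \<phi> x"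
    unfolding \<eta>_def using QLip0_compose[OF \<phi>, of \<Psi> \<psi>] \<Psi> \<psi>(1) by auto
  have \<theta>: "\<theta> \<in> QLip0 Q v \<Omega>" "AE x in M. grad \<theta> x = (T (\<phi> x) + \<phi> x * (\<psi> (\<phi> x))\<^sup>2) *\<^sub>R grad \<phi> x"
  proof -
    have d: "((\<lambda>s. s * T s) has_real_derivative (T s + s * (\<psi> s)\<^sup>2)) (at s)" for s
      using DERIV_mult[OF DERIV_ident T(1)[of s]] by (simp add: add.commute mult.commute)
    have c: "continuous_on UNIV (\<lambda>s. T s + s * (\<psi> s)\<^sup>2)" by (intro continuous_intros T_cont \<psi>(1))
    show "\<theta> \<in> QLip0 Q v \<Omega>" "AE x in M. grad \<theta> x = (T (\<phi> x) + \<phi> x * (\<psi> (\<phi> x))\<^sup>2) *\<^sub>R grad \<phi> x"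
      unfolding \<theta>_def using QLip0_compose[OF \<phi> d c] by auto
  qed
  note inX = QLip0_in_QH0[OF \<phi>] QLip0_in_QH0[OF \<tau>(1)] QLip0_in_QH0[OF \<eta>(1)] QLip0_in_QH0[OF \<theta>(1)]
  have grads [measurable]: "grad \<phi> \<in> borel_measurable M" "grad \<tau> \<in> borel_measurable M"
    "grad \<eta> \<in> borel_measurable M" "grad \<theta> \<in> borel_measurable M"
    using \<phi> \<tau>(1) \<eta>(1) \<theta>(1) by (auto simp: QLip0_iff QL2_iff)
  define p where "p = XI.nm (\<eta>, grad \<eta>)"
  have p0: "p \<ge> 0" unfolding p_def using XI.nm_nonneg inX by blast
  have p2: "p\<^sup>2 = energy (grad \<eta>)" unfolding p_def XI_nm by (simp add: ipQ_nonneg)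
  have ip_eq: "ipX (\<tau>, grad \<tau>) (\<phi>, grad \<phi>) = p\<^sup>2"
    unfolding p2 ipX_def ipQ_def snd_conv
  proof (rule integral_cong_AE)
    show "AE x in M. qf x (grad \<tau> x) (grad \<phi> x) = qf x (grad \<eta> x) (grad \<eta> x)"
      using \<tau>(2) \<eta>(2) by eventually_elim (simp add: qf_linear power2_eq_square)
  qed measurable
  have nm_le: "XI.nm (\<tau>, grad \<tau>) \<le> p"
    unfolding p_def XI_nm snd_conv ipQ_def
  proof (intro real_sqrt_le_mono integral_mono_AE)
    show "AE x in M. qf x (grad \<tau> x) (grad \<tau> x) \<le> qf x (grad \<eta> x) (grad \<eta> x)"
      using \<tau>(2) \<eta>(2) AE_space
    proof eventually_elim
      case (elim x)
      have "(\<psi> (\<phi> x))\<^sup>2 \<le> 1" using \<psi>(2)[of "\<phi> x"] by (simp add: abs_le_square_iff[of _ 1, simplified])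
      then have "(\<psi> (\<phi> x))\<^sup>2 * ((\<psi> (\<phi> x))\<^sup>2 * qf x (grad \<phi> x) (grad \<phi> x)) \<le> 1 * ((\<psi> (\<phi> x))\<^sup>2 * qf x (grad \<phi> x) (grad \<phi> x))"
        using elim(3) by (intro mult_right_mono) (auto simp: qf_nonneg)
      then show ?case using elim by (simp add: qf_linear power2_eq_square mult.assoc)
    qed
  qed (use \<tau>(1) \<eta>(1) in \<open>auto simp: QLip0_iff QL2_iff\<close>)
  define Nb where "Nb = sqrt (LINT x|\<nu>. (HG_max x * (\<phi> x * \<psi> (\<phi> x)))\<^sup>2)"
  have HG_max\<phi>: "(\<lambda>x. HG_max x * \<phi> x) \<in> L2" using multiplier_QH0(1)[OF HG_max_multiplier inX(1)] .
  have psi_le: "\<bar>a * \<psi> a\<bar> \<le> \<bar>a\<bar>" for a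
    using mult_left_mono[OF \<psi>(2)[of a], of "\<bar>a\<bar>"] by (simp add: abs_mult)
  have HG_psi_L2: "(\<lambda>x. HG_max x * (\<phi> x * \<psi> (\<phi> x))) \<in> L2"
    by (rule L2_dominated[OF _ HG_max\<phi>, of _ 1])
       (use psi_le HG_max_bounds(3) in \<open>auto simp: abs_mult intro!: mult_left_mono\<close>)
  have HL: "(\<lambda>x. H x $ i * (\<phi> x * \<psi> (\<phi> x))) \<in> L2" and GL: "(\<lambda>x. G x $ i * (\<phi> x * \<psi> (\<phi> x))) \<in> L2"
    and HN: "sqrt (LINT x|\<nu>. (H x $ i * (\<phi> x * \<psi> (\<phi> x)))\<^sup>2) \<le> Nb"
    and GN: "sqrt (LINT x|\<nu>. (G x $ i * (\<phi> x * \<psi> (\<phi> x)))\<^sup>2) \<le> Nb" for i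
  proof -
    have mH: "(\<lambda>x. H x $ i) \<in> borel_measurable M" "(\<lambda>x. G x $ i) \<in> borel_measurable M"
      using components_L2 by (auto simp: L2_def)
    have leH: "\<bar>H x $ i * (\<phi> x * \<psi> (\<phi> x))\<bar> \<le> \<bar>HG_max x * (\<phi> x * \<psi> (\<phi> x))\<bar>"
      and leG: "\<bar>G x $ i * (\<phi> x * \<psi> (\<phi> x))\<bar> \<le> \<bar>HG_max x * (\<phi> x * \<psi> (\<phi> x))\<bar>" for x
      using mult_right_mono[OF HG_max_bounds(1)[of x i], of "\<bar>\<phi> x * \<psi> (\<phi> x)\<bar>"]
        mult_right_mono[OF HG_max_bounds(2)[of x i], of "\<bar>\<phi> x * \<psi> (\<phi> x)\<bar>"] HG_max_bounds(3)[of x]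
      by (simp_all add: abs_mult)
    have HL': "(\<lambda>x. H x $ i * (\<phi> x * \<psi> (\<phi> x))) \<in> L2"
      by (rule L2_dominated[OF _ HG_psi_L2, of _ 1]) (use mH leH in simp_all)
    have GL': "(\<lambda>x. G x $ i * (\<phi> x * \<psi> (\<phi> x))) \<in> L2"
      by (rule L2_dominated[OF _ HG_psi_L2, of _ 1]) (use mH leG in simp_all)
    show "(\<lambda>x. H x $ i * (\<phi> x * \<psi> (\<phi> x))) \<in> L2" "(\<lambda>x. G x $ i * (\<phi> x * \<psi> (\<phi> x))) \<in> L2"
      by (rule HL' GL')+
    show "sqrt (LINT x|\<nu>. (H x $ i * (\<phi> x * \<psi> (\<phi> x)))\<^sup>2) \<le> Nb"
      unfolding Nb_def by (intro real_sqrt_le_mono integral_mono)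
        (use HL' HG_psi_L2 leH in \<open>auto simp: L2_def abs_le_square_iff\<close>)
    show "sqrt (LINT x|\<nu>. (G x $ i * (\<phi> x * \<psi> (\<phi> x)))\<^sup>2) \<le> Nb"
      unfolding Nb_def by (intro real_sqrt_le_mono integral_mono)
        (use GL' HG_psi_L2 leG in \<open>auto simp: L2_def abs_le_square_iff\<close>)
  qed
  have RL: "(\<lambda>x. R i x \<bullet> D x) \<in> L2" and SL: "(\<lambda>x. S i x \<bullet> D x) \<in> L2" if "(u, D) \<in> X" for u D i
    using L2_operatorD(3)[OF L2_operator_subunit[OF R[of i]] that] L2_operatorD(3)[OF L2_operator_subunit[OF S[of i]] that] by auto
  have HX: "(\<lambda>x. H x $ i * u x) \<in> L2" and GX: "(\<lambda>x. G x $ i * u x) \<in> L2" if "(u, D) \<in> X" for u D i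
    using multiplier_QH0(1)[OF multiplier_component[OF H_multiplier H_meas] that]
      multiplier_QH0(1)[OF multiplier_component[OF G_multiplier G_meas] that] by auto
  define E1 where "E1 i = (LINT x|\<nu>. (R i x \<bullet> grad \<eta> x) * (H x $ i * (\<phi> x * \<psi> (\<phi> x))))" for i
  define E2 where "E2 i = (LINT x|\<nu>. (S i x \<bullet> grad \<eta> x) * (G x $ i * (\<phi> x * \<psi> (\<phi> x))))" for i
  have K1: "(LINT x|\<nu>. fields_dot H R (grad \<tau>) x * \<phi> x) = (\<Sum>i\<in>UNIV. E1 i)"
  proof -
    have "(LINT x|\<nu>. (R i x \<bullet> grad \<tau> x) * (H x $ i * \<phi> x)) = E1 i" for i
      unfolding E1_def
    proof (rule integral_cong_AE)
      show "AE x in \<nu>. (R i x \<bullet> grad \<tau> x) * (H x $ i * \<phi> x) = (R i x \<bullet> grad \<eta> x) * (H x $ i * (\<phi> x * \<psi> (\<phi> x)))"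
        unfolding AE_\<nu> using \<tau>(2) \<eta>(2) by eventually_elim (simp add: power2_eq_square)
    qed (intro borel_measurable_integrable L2_product(1) RL[OF inX(2)] RL[OF inX(3)] HX[OF inX(1)] HL)+
    then show ?thesis using fields_dot_integral(2)[OF HX[OF inX(1)] RL[OF inX(2)]] by simp
  qed
  \<comment> \<open>The sign condition is applied to \<open>\<theta> = \<phi> T \<phi>\<close>, whose gradient is \<open>T \<phi> grad \<phi> + \<phi> grad (T \<phi>)\<close>.\<close>
  have K23: "(LINT x|\<nu>. fields_dot G S (grad \<phi>) x * \<tau> x) + (LINT x|\<nu>. F x * \<tau> x * \<phi> x) \<ge> - (\<Sum>i\<in>UNIV. E2 i)"
  proof -
    have mS: "(\<lambda>x. fields_dot G S (grad \<theta>) x * 1) \<in> borel_measurable M" and iS: "integrable \<nu> (\<lambda>x. fields_dot G S (grad \<theta>) x * 1)"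
      and eS: "(LINT x|\<nu>. fields_dot G S (grad \<theta>) x * 1) = (\<Sum>i\<in>UNIV. LINT x|\<nu>. (S i x \<bullet> grad \<theta> x) * (G x $ i * 1))"
      using fields_dot_integral[of G "\<lambda>x. 1" S "grad \<theta>"] components_L2(2) SL[OF inX(4)] by (auto dest: borel_measurable_integrable)
    have \<theta>L: "\<theta> \<in> L2" using \<theta>(1) by (simp add: QLip0_iff)
    have iF: "integrable \<nu> (\<lambda>x. F x * \<theta> x)" using L2_product(1)[OF F_L2 \<theta>L] .
    have "0 \<le> (LINT x|lebesgue_on \<Omega>. (fields_dot G S (grad \<theta>) x + F x * \<theta> x) * v x)"
      using \<theta>(1) T(3) by (intro sign) (auto simp: \<theta>_def)
    also have "\<dots> = (LINT x|\<nu>. fields_dot G S (grad \<theta>) x + F x * \<theta> x)"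
      using mS \<theta>L F_L2 by (intro integral_\<nu>[symmetric]) (auto simp: L2_def)
    also have "\<dots> = (LINT x|\<nu>. fields_dot G S (grad \<theta>) x) + (LINT x|\<nu>. F x * \<theta> x)"
      using iS iF by simp
    also have "(LINT x|\<nu>. fields_dot G S (grad \<theta>) x)
        = (\<Sum>i\<in>UNIV. LINT x|\<nu>. (S i x \<bullet> grad \<theta> x) * G x $ i)" using eS by simp
    also have "\<dots> = (\<Sum>i\<in>UNIV. (LINT x|\<nu>. (S i x \<bullet> grad \<phi> x) * (G x $ i * \<tau> x)) + E2 i)"
    proof (rule sum.cong[OF refl])
      fix i
      have i1: "integrable \<nu> (\<lambda>x. (S i x \<bullet> grad \<phi> x) * (G x $ i * \<tau> x))"
        using L2_product(1)[OF SL[OF inX(1)] GX[OF inX(2)]] .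
      have i2: "integrable \<nu> (\<lambda>x. (S i x \<bullet> grad \<eta> x) * (G x $ i * (\<phi> x * \<psi> (\<phi> x))))"
        using L2_product(1)[OF SL[OF inX(3)] GL] .
      have "(LINT x|\<nu>. (S i x \<bullet> grad \<theta> x) * G x $ i) =
         (LINT x|\<nu>. (S i x \<bullet> grad \<phi> x) * (G x $ i * \<tau> x) + (S i x \<bullet> grad \<eta> x) * (G x $ i * (\<phi> x * \<psi> (\<phi> x))))"
      proof (rule integral_cong_AE)
        show "AE x in \<nu>. (S i x \<bullet> grad \<theta> x) * G x $ i =
            (S i x \<bullet> grad \<phi> x) * (G x $ i * \<tau> x) + (S i x \<bullet> grad \<eta> x) * (G x $ i * (\<phi> x * \<psi> (\<phi> x)))"
          unfolding AE_\<nu> using \<theta>(2) \<eta>(2)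
          by eventually_elim (simp add: power2_eq_square \<tau>_def algebra_simps)
      qed (intro borel_measurable_integrable Bochner_Integration.integrable_add i1 i2
          L2_product(1) SL[OF inX(4)] components_L2(2))+
      also have "\<dots> = (LINT x|\<nu>. (S i x \<bullet> grad \<phi> x) * (G x $ i * \<tau> x)) + E2 i"
        unfolding E2_def using i1 i2 by simp
      finally show "(LINT x|\<nu>. (S i x \<bullet> grad \<theta> x) * G x $ i)
          = (LINT x|\<nu>. (S i x \<bullet> grad \<phi> x) * (G x $ i * \<tau> x)) + E2 i" .
    qed
    also have "\<dots> = (LINT x|\<nu>. fields_dot G S (grad \<phi>) x * \<tau> x) + (\<Sum>i\<in>UNIV. E2 i)"
      using fields_dot_integral(2)[OF GX[OF inX(2)] SL[OF inX(1)]] by (simp add: sum.distrib)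
    finally show ?thesis by (simp add: \<theta>_def \<tau>_def mult_ac)
  qed
  have E_bound: "\<bar>E1 i\<bar> + \<bar>E2 i\<bar> \<le> (sqrt (LINT x|\<nu>. (R i x \<bullet> grad \<eta> x)\<^sup>2) + sqrt (LINT x|\<nu>. (S i x \<bullet> grad \<eta> x)\<^sup>2)) * Nb" for i
  proof -
    have "\<bar>E1 i\<bar> \<le> sqrt (LINT x|\<nu>. (R i x \<bullet> grad \<eta> x)\<^sup>2) * Nb"
      unfolding E1_def using L2_product_abs_le[OF RL[OF inX(3), of i] HL[of i]] HN[of i]
      by (elim order_trans) (intro mult_left_mono, auto)
    moreover have "\<bar>E2 i\<bar> \<le> sqrt (LINT x|\<nu>. (S i x \<bullet> grad \<eta> x)\<^sup>2) * Nb"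
      unfolding E2_def using L2_product_abs_le[OF SL[OF inX(3), of i] GL[of i]] GN[of i]
      by (elim order_trans) (intro mult_left_mono, auto)
    ultimately show ?thesis by (simp add: distrib_right)
  qed
  have Nb0: "Nb \<ge> 0" by (simp add: Nb_def)
  have err: "(\<Sum>i\<in>UNIV. \<bar>E1 i\<bar> + \<bar>E2 i\<bar>) \<le> A0 * p * Nb"
  proof -
    have "(\<Sum>i\<in>UNIV. \<bar>E1 i\<bar> + \<bar>E2 i\<bar>) \<le>
       (\<Sum>i\<in>UNIV. sqrt (LINT x|\<nu>. (R i x \<bullet> grad \<eta> x)\<^sup>2) + sqrt (LINT x|\<nu>. (S i x \<bullet> grad \<eta> x)\<^sup>2)) * Nb"
      unfolding sum_distrib_right by (intro sum_mono E_bound)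
    also have "\<dots> \<le> (A0 * p) * Nb" using A0(2)[OF inX(3)] Nb0 unfolding p_def by (intro mult_right_mono) auto
    finally show ?thesis .
  qed
  have K_lower: "lower_order (\<tau>, grad \<tau>) (\<phi>, grad \<phi>) \<ge> - (A0 * p * Nb)"
  proof -
    have "lower_order (\<tau>, grad \<tau>) (\<phi>, grad \<phi>) \<ge> (\<Sum>i\<in>UNIV. E1 i) - (\<Sum>i\<in>UNIV. E2 i)"
      using K1 K23 by (simp add: lower_order_def)
    moreover have "(\<Sum>i\<in>UNIV. E1 i) - (\<Sum>i\<in>UNIV. E2 i) \<ge> - (\<Sum>i\<in>UNIV. \<bar>E1 i\<bar> + \<bar>E2 i\<bar>)"
    proof -
      have "- (\<Sum>i\<in>UNIV. \<bar>E1 i\<bar> + \<bar>E2 i\<bar>) = (\<Sum>i\<in>UNIV. - (\<bar>E1 i\<bar> + \<bar>E2 i\<bar>))" by (rule sum_negf[symmetric])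
      also have "\<dots> \<le> (\<Sum>i\<in>UNIV. E1 i - E2 i)" by (intro sum_mono) linarith
      finally show ?thesis by (simp add: sum_subtractf)
    qed
    ultimately show ?thesis using err by linarith
  qed
  have "p\<^sup>2 \<le> m * p + A0 * p * Nb"
  proof -
    have "(\<tau>, grad \<tau>) \<in> test_pairs" using \<tau>(1) by (auto simp: test_pairs_def)
    then have "p\<^sup>2 + t * lower_order (\<tau>, grad \<tau>) (\<phi>, grad \<phi>) \<le> m * XI.nm (\<tau>, grad \<tau>)"
      using bound[of "(\<tau>, grad \<tau>)"] ip_eq by simp
    also have "\<dots> \<le> m * p" using nm_le m by (rule mult_left_mono)
    finally have *: "p\<^sup>2 + t * lower_order (\<tau>, grad \<tau>) (\<phi>, grad \<phi>) \<le> m * p" .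
    have e0: "0 \<le> A0 * p * Nb" using A0(1) p0 Nb0 by simp
    have "t * lower_order (\<tau>, grad \<tau>) (\<phi>, grad \<phi>) \<ge> t * - (A0 * p * Nb)" using K_lower t(1) by (rule mult_left_mono)
    moreover have "t * (A0 * p * Nb) \<le> 1 * (A0 * p * Nb)" using t(2) e0 by (rule mult_right_mono)
    ultimately show ?thesis using * by simp
  qed
  then have "p * p \<le> p * (m + A0 * Nb)" by (simp add: power2_eq_square algebra_simps)
  then have "p \<le> m + A0 * Nb"
    using p0 m A0(1) Nb0 by (cases "p = 0") (auto simp: mult_le_cancel_left_pos add_nonneg_nonneg)
  then show ?thesis by (simp add: p_def Nb_def \<eta>_def[abs_def])
qed

text \<open>
  The constants are chosen in this order: \<open>\<eta>\<close>, such that the coefficient \<open>h = max |H| |G|\<close> restricted to a set on which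
  \<open>\<integral> h\<^bsup>2\<sigma>'\<^esup> d\<nu> < \<eta>\<close> contributes at most half of the left side; \<open>\<delta>\<close>, such that this holds on every set of measure less than
  \<open>\<delta>\<close>; and \<open>k = sinh y\<close>, such that the logarithmic estimate makes \<open>{|w| \<ge> km}\<close> smaller than \<open>\<delta>\<close>.  None depends on \<open>t\<close>, \<open>m\<close>
  or \<open>w\<close>.
\<close>
theorem apriori_estimate:
  obtains C0 where "C0 \<ge> 0" "\<And>t m w. 0 \<le> t \<Longrightarrow> t \<le> 1 \<Longrightarrow> m > 0 \<Longrightarrow> w \<in> test_pairs \<Longrightarrow>
    (\<And>u. u \<in> test_pairs \<Longrightarrow> \<bar>ipX u w + t * lower_order u w\<bar> \<le> m * XI.nm u) \<Longrightarrow> XI.nm w \<le> C0 * m"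
proof -
  interpret fm: finite_measure \<nu> by (rule finite_\<nu>)
  obtain A0 where A0: "A0 \<ge> 0" "\<And>z. z \<in> X \<Longrightarrow>
    (\<Sum>i\<in>UNIV. sqrt (LINT x|\<nu>. (R i x \<bullet> snd z x)\<^sup>2) + sqrt (LINT x|\<nu>. (S i x \<bullet> snd z x)\<^sup>2)) \<le> A0 * XI.nm z"
    using field_constant by blast
  define B2 where "B2 = sqrt (LINT x|\<nu>. (HG_max x)\<^sup>2)"
  have B2: "B2 \<ge> 0" by (simp add: B2_def)
  define P where "P = 1 + A0 * B2"
  define ms where "ms = multiplier_bound (\<lambda>x. 1)"
  have ms: "ms \<ge> 0" by (simp add: ms_def multiplier_bound_nonneg)
  define c where "c = 4 * (A0\<^sup>2 * C\<^sup>2 + 1)"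
  have c: "c > 0" by (simp add: c_def add_nonneg_pos)
  define \<eta> where "\<eta> = (1 / c) powr \<sigma>'"
  have \<eta>: "\<eta> > 0" using c by (simp add: \<eta>_def)
  obtain \<delta> where \<delta>: "\<delta> > 0" "\<And>A. A \<in> sets \<nu> \<Longrightarrow> measure \<nu> A < \<delta> \<Longrightarrow>
      (LINT x|\<nu>. indicator A x * \<bar>HG_max x\<bar> powr (2 * \<sigma>')) < \<eta>"
    using integrable_absolutely_continuous[of \<nu> "\<lambda>x. \<bar>HG_max x\<bar> powr (2 * \<sigma>')" \<eta>] HG_max_multiplier \<eta> finite_\<nu>
    by (auto simp: multiplier_def)
  \<comment> \<open>Chebyshev's inequality for \<open>arsinh\<close> bounds the measure of \<open>{|w| \<ge> m sinh y}\<close> by \<open>ms P\<^sup>2 / y\<^sup>2\<close>.\<close>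
  define y where "y = sqrt (ms * P\<^sup>2 / \<delta>) + 1"
  have y1: "y \<ge> 1" using ms \<delta>(1) by (simp add: y_def)
  have y2: "ms * P\<^sup>2 < y\<^sup>2 * \<delta>"
  proof -
    have "(sqrt (ms * P\<^sup>2 / \<delta>))\<^sup>2 < y\<^sup>2"
      unfolding y_def using ms \<delta>(1) by (intro power_strict_mono) auto
    then show ?thesis using ms \<delta>(1) by (simp add: field_simps)
  qed
  define k where "k = sinh y"
  have k: "k > 0" using y1 by (simp add: k_def)
  define C0 where "C0 = 2 * (1 + A0 * (k * B2))"
  have "C0 \<ge> 0" using A0(1) k B2 by (simp add: C0_def)
  moreover have "XI.nm w \<le> C0 * m" if t: "0 \<le> t" "t \<le> 1" and m: "m > 0" and w: "w \<in> test_pairs"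
    and bound: "\<And>u. u \<in> test_pairs \<Longrightarrow> \<bar>ipX u w + t * lower_order u w\<bar> \<le> m * XI.nm u" for t m w
  proof -
    obtain \<phi> where \<phi>: "\<phi> \<in> QLip0 Q v \<Omega>" "w = (\<phi>, grad \<phi>)" using w by (auto simp: test_pairs_def)
    have \<phi>L [measurable]: "\<phi> \<in> borel_measurable M" using \<phi> by (simp add: QLip0_iff L2_def)
    note test = test_inequality[OF \<phi>(1) t less_imp_le[OF m] bound[unfolded \<phi>(2)] A0]
    \<comment> \<open>First test function: \<open>|s \<psi> s| \<le> m\<close> removes \<open>\<phi>\<close> from the error term.\<close>
    define \<psi> where "\<psi> s = 1 / sqrt ((s / m)\<^sup>2 + 1)" for s
    have psi_sq: "(\<psi> s)\<^sup>2 = inverse (1 + (s / m)\<^sup>2)" for s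
      by (simp add: \<psi>_def power_divide inverse_eq_divide add.commute)
    have sqrt_ge: "sqrt (a\<^sup>2 + 1) \<ge> 1" "sqrt (a\<^sup>2 + 1) \<ge> \<bar>a\<bar>" for a :: real
      by (auto intro: real_le_rsqrt)
    have arsinh_QLip: "(\<lambda>x. m * arsinh (\<phi> x / m)) \<in> QLip0 Q v \<Omega>"
    and log: "XI.nm (\<lambda>x. m * arsinh (\<phi> x / m), grad (\<lambda>x. m * arsinh (\<phi> x / m))) \<le>
        m + A0 * sqrt (LINT x|\<nu>. (HG_max x * (\<phi> x * \<psi> (\<phi> x)))\<^sup>2)"
    proof -
      have d1: "((\<lambda>s. m * arctan (s / m)) has_real_derivative (\<psi> s)\<^sup>2) (at s)" for s
        using m unfolding psi_sq by (auto intro!: derivative_eq_intros simp: power_divide)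
      have d2: "((\<lambda>s. m * arsinh (s / m)) has_real_derivative \<psi> s) (at s)" for s
      proof -
        have "((\<lambda>s. arsinh (s / m)) has_real_derivative 1 / sqrt ((s / m)\<^sup>2 + 1) * (1 / m)) (at s)"
          by (rule DERIV_chain2[OF arsinh_real_has_field_derivative]) (use m in \<open>auto intro!: derivative_eq_intros\<close>)
        from DERIV_cmult[OF this, of m] show ?thesis using m by (simp add: \<psi>_def)
      qed
      have c1: "continuous_on UNIV \<psi>" unfolding \<psi>_def
        by (intro continuous_intros) (use m in \<open>auto simp: add_nonneg_eq_0_iff\<close>)
      have a1: "0 \<le> s * (m * arctan (s / m))" for s
      proof (cases "s \<ge> 0")
        case True
        then show ?thesis using m by (intro mult_nonneg_nonneg) auto
      next
        case False
        then have "s / m \<le> 0" using m by (simp add: divide_le_0_iff)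
        then show ?thesis using m False by (intro mult_nonpos_nonpos mult_nonneg_nonpos) auto
      qed
      have b1: "\<bar>\<psi> s\<bar> \<le> 1" for s using frac_le[of 1 1 1 "sqrt ((s / m)\<^sup>2 + 1)"] sqrt_ge(1)[of "s / m"] by (simp add: \<psi>_def)
      show "(\<lambda>x. m * arsinh (\<phi> x / m)) \<in> QLip0 Q v \<Omega>"
        by (rule QLip0_compose(1)[OF \<phi>(1) d2 c1]) simp
      show "XI.nm (\<lambda>x. m * arsinh (\<phi> x / m), grad (\<lambda>x. m * arsinh (\<phi> x / m))) \<le>
        m + A0 * sqrt (LINT x|\<nu>. (HG_max x * (\<phi> x * \<psi> (\<phi> x)))\<^sup>2)"
        by (rule test[OF _ _ d1 _ a1 d2 _ c1 b1]) auto
    qed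
    have "sqrt (LINT x|\<nu>. (HG_max x * (\<phi> x * \<psi> (\<phi> x)))\<^sup>2) \<le> m * B2"
    proof -
      have le: "(HG_max x * (\<phi> x * \<psi> (\<phi> x)))\<^sup>2 \<le> m\<^sup>2 * (HG_max x)\<^sup>2" for x
      proof -
        have "\<bar>\<phi> x / m\<bar> * \<bar>\<psi> (\<phi> x)\<bar> \<le> 1"
        proof -
          have "\<bar>a\<bar> * \<bar>1 / r\<bar> \<le> 1" if "1 \<le> r" "\<bar>a\<bar> \<le> r" for a r :: real
            using that by simp
          from this[OF sqrt_ge] show ?thesis unfolding \<psi>_def .
        qed
        then have "\<bar>\<phi> x * \<psi> (\<phi> x)\<bar> \<le> m" using m by (simp add: abs_mult field_simps)
        then have "(\<phi> x * \<psi> (\<phi> x))\<^sup>2 \<le> m\<^sup>2" using m by (intro abs_le_square_iff[THEN iffD1]) simp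
        then have "(HG_max x)\<^sup>2 * (\<phi> x * \<psi> (\<phi> x))\<^sup>2 \<le> (HG_max x)\<^sup>2 * m\<^sup>2" by (intro mult_left_mono) auto
        then show ?thesis by (simp add: power_mult_distrib mult.commute)
      qed
      have "(LINT x|\<nu>. (HG_max x * (\<phi> x * \<psi> (\<phi> x)))\<^sup>2) \<le> (LINT x|\<nu>. m\<^sup>2 * (HG_max x)\<^sup>2)"
        by (rule integral_mono_AE') (use HG_max_L2 le in \<open>auto simp: L2_def\<close>)
      also have "\<dots> = (m * B2)\<^sup>2" by (simp add: B2_def power_mult_distrib)
      finally have "sqrt (LINT x|\<nu>. (HG_max x * (\<phi> x * \<psi> (\<phi> x)))\<^sup>2) \<le> sqrt ((m * B2)\<^sup>2)" by (rule real_sqrt_le_mono)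
      then show ?thesis using m B2 by simp
    qed
    then have "A0 * sqrt (LINT x|\<nu>. (HG_max x * (\<phi> x * \<psi> (\<phi> x)))\<^sup>2) \<le> A0 * (m * B2)"
      using A0(1) by (rule mult_left_mono)
    then have log': "XI.nm (\<lambda>x. m * arsinh (\<phi> x / m), grad (\<lambda>x. m * arsinh (\<phi> x / m))) \<le> m * P"
      using log by (simp add: P_def algebra_simps)
    have int_log: "(LINT x|\<nu>. (m * arsinh (\<phi> x / m))\<^sup>2) \<le> ms * (m * P)\<^sup>2"
    proof -
      have "(LINT x|\<nu>. (m * arsinh (\<phi> x / m))\<^sup>2)
          \<le> ms * (XI.nm (\<lambda>x. m * arsinh (\<phi> x / m), grad (\<lambda>x. m * arsinh (\<phi> x / m))))\<^sup>2"
        using L2_bound_QH0[OF QLip0_in_QH0[OF arsinh_QLip]] by (simp add: ms_def XI_nm ipQ_nonneg)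
      also have "\<dots> \<le> ms * (m * P)\<^sup>2"
        using log' ms by (intro mult_left_mono power_mono) (auto simp: XI_nm ipQ_nonneg)
      finally show ?thesis .
    qed
    define A where "A = {x\<in>space M. k * m \<le> \<bar>\<phi> x\<bar>}"
    have A [measurable]: "A \<in> sets M" unfolding A_def by measurable
    have "y\<^sup>2 * m\<^sup>2 * measure \<nu> A \<le> ms * (m * P)\<^sup>2"
    proof -
      have "y\<^sup>2 * m\<^sup>2 * measure \<nu> A = (LINT x|\<nu>. y\<^sup>2 * m\<^sup>2 * indicator A x)"
      proof -
        have "A \<inter> \<Omega> = A" by (auto simp: A_def)
        then show ?thesis using A by simp
      qed
      also have "\<dots> \<le> (LINT x|\<nu>. (m * arsinh (\<phi> x / m))\<^sup>2)"
      proof (rule integral_mono)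
        show "integrable \<nu> (\<lambda>x. y\<^sup>2 * m\<^sup>2 * indicat_real A x)"
          using A by (intro integrable_mult_right integrable_real_indicator) (auto simp: fm.emeasure_finite less_top[symmetric])
        show "integrable \<nu> (\<lambda>x. (m * arsinh (\<phi> x / m))\<^sup>2)"
          using arsinh_QLip by (simp add: QLip0_iff L2_def)
        fix x
        show "y\<^sup>2 * m\<^sup>2 * indicat_real A x \<le> (m * arsinh (\<phi> x / m))\<^sup>2"
        proof (cases "x \<in> A")
          case True
          then have "k \<le> \<bar>\<phi> x\<bar> / m" using m by (simp add: A_def field_simps)
          then have "arsinh k \<le> arsinh (\<bar>\<phi> x\<bar> / m)" using arsinh_less_iff_real by (meson not_le)
          then have "y \<le> arsinh (\<bar>\<phi> x\<bar> / m)" by (simp add: k_def arsinh_sinh_real)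
          also have "arsinh (\<bar>\<phi> x\<bar> / m) \<le> \<bar>arsinh (\<phi> x / m)\<bar>"
            by (cases "\<phi> x \<ge> 0") auto
          finally have "\<bar>y\<bar> \<le> \<bar>arsinh (\<phi> x / m)\<bar>" using y1 by simp
          then have "y\<^sup>2 \<le> (arsinh (\<phi> x / m))\<^sup>2" by (simp add: abs_le_square_iff)
          then have "y\<^sup>2 * m\<^sup>2 \<le> (arsinh (\<phi> x / m))\<^sup>2 * m\<^sup>2" by (intro mult_right_mono) auto
          then show ?thesis using True by (simp add: power_mult_distrib mult.commute)
        qed auto
      qed
      finally show ?thesis using int_log by linarith
    qed
    then have "y\<^sup>2 * measure \<nu> A \<le> ms * P\<^sup>2" using m by (simp add: power_mult_distrib mult_ac)
    then have "y\<^sup>2 * measure \<nu> A < y\<^sup>2 * \<delta>" using y2 by linarith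
    then have "measure \<nu> A < \<delta>" using y1 by simp
    then have I_less: "(LINT x|\<nu>. indicator A x * \<bar>HG_max x\<bar> powr (2 * \<sigma>')) < \<eta>" using \<delta>(2) A by simp
    \<comment> \<open>Second test function \<open>T s = s\<close>: the part of the coefficient that lives on the superlevel set is absorbed.\<close>
    define a where "a x = indicator A x * HG_max x" for x
    have a_mult: "multiplier a" unfolding a_def
      by (rule multiplier_mono[OF HG_max_multiplier]) (auto simp: indicator_def)
    have small: "A0 * sqrt (multiplier_bound a) \<le> 1 / 2"
    proof -
      have "(\<lambda>x. \<bar>a x\<bar> powr (2 * \<sigma>')) = (\<lambda>x. indicator A x * \<bar>HG_max x\<bar> powr (2 * \<sigma>'))"
        by (auto simp: a_def indicator_def)
      then have "(LINT x|\<nu>. \<bar>a x\<bar> powr (2 * \<sigma>')) powr (1 / \<sigma>') \<le> \<eta> powr (1 / \<sigma>')"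
        using I_less \<sigma>' by (intro powr_mono2) auto
      also have "\<eta> powr (1 / \<sigma>') = 1 / c" using c \<sigma>' by (simp add: \<eta>_def powr_powr)
      finally have "multiplier_bound a \<le> C\<^sup>2 * (1 / c)" unfolding multiplier_bound_def by (intro mult_left_mono) auto
      then have "A0\<^sup>2 * multiplier_bound a \<le> A0\<^sup>2 * (C\<^sup>2 * (1 / c))" by (intro mult_left_mono) auto
      also have "\<dots> \<le> (1 / 2)\<^sup>2" using c by (simp add: c_def divide_simps power2_eq_square algebra_simps)
      finally have "sqrt (A0\<^sup>2 * multiplier_bound a) \<le> sqrt ((1 / 2)\<^sup>2)" by (rule real_sqrt_le_mono)
      then show ?thesis using A0(1) by (simp add: real_sqrt_mult)
    qed
    define p where "p = XI.nm w"
    have p0: "p \<ge> 0" by (simp add: p_def XI_nm ipQ_nonneg)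
    have id: "p \<le> m + A0 * sqrt (LINT x|\<nu>. (HG_max x * \<phi> x)\<^sup>2)"
      using test[of "\<lambda>s. s" "\<lambda>s. 1" "\<lambda>s. s"] by (simp add: p_def \<phi>(2))
    have "sqrt (LINT x|\<nu>. (HG_max x * \<phi> x)\<^sup>2) \<le> sqrt (multiplier_bound a) * p + k * m * B2"
    proof -
      have wX: "(\<phi>, grad \<phi>) \<in> X" using QLip0_in_QH0[OF \<phi>(1)] .
      have aL: "(\<lambda>x. a x * \<phi> x) \<in> L2" "(LINT x|\<nu>. (a x * \<phi> x)\<^sup>2) \<le> multiplier_bound a * energy (grad \<phi>)"
        using multiplier_QH0[OF a_mult wX] by auto
      have bL: "(\<lambda>x. HG_max x * \<phi> x) \<in> L2" using multiplier_QH0(1)[OF HG_max_multiplier wX] .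
      have "(LINT x|\<nu>. (HG_max x * \<phi> x)\<^sup>2) \<le> (LINT x|\<nu>. (a x * \<phi> x)\<^sup>2 + (k * m)\<^sup>2 * (HG_max x)\<^sup>2)"
      proof (rule integral_mono)
        fix x assume "x \<in> space \<nu>"
        show "(HG_max x * \<phi> x)\<^sup>2 \<le> (a x * \<phi> x)\<^sup>2 + (k * m)\<^sup>2 * (HG_max x)\<^sup>2"
        proof (cases "x \<in> A")
          case False
          then have "\<bar>\<phi> x\<bar> \<le> k * m" using \<open>x \<in> space \<nu>\<close> by (simp add: A_def)
          then have "(\<phi> x)\<^sup>2 \<le> (k * m)\<^sup>2" using k m by (intro abs_le_square_iff[THEN iffD1]) simp
          then have "(HG_max x)\<^sup>2 * (\<phi> x)\<^sup>2 \<le> (HG_max x)\<^sup>2 * (k * m)\<^sup>2" by (intro mult_left_mono) auto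
          then show ?thesis using False by (simp add: a_def power_mult_distrib mult.commute)
        qed (simp add: a_def)
      qed (use aL bL HG_max_L2 in \<open>auto simp: L2_def\<close>)
      also have "\<dots> = (LINT x|\<nu>. (a x * \<phi> x)\<^sup>2) + (k * m)\<^sup>2 * B2\<^sup>2"
        using aL HG_max_L2 by (simp add: L2_def B2_def)
      also have "\<dots> \<le> multiplier_bound a * p\<^sup>2 + (k * m)\<^sup>2 * B2\<^sup>2"
        using aL(2) by (simp add: p_def \<phi>(2) XI_nm ipQ_nonneg)
      finally have "sqrt (LINT x|\<nu>. (HG_max x * \<phi> x)\<^sup>2) \<le> sqrt (multiplier_bound a * p\<^sup>2 + (k * m)\<^sup>2 * B2\<^sup>2)"
        by (rule real_sqrt_le_mono)
      also have "\<dots> \<le> sqrt (multiplier_bound a * p\<^sup>2) + sqrt ((k * m)\<^sup>2 * B2\<^sup>2)"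
        by (intro sqrt_add_le_add_sqrt) (auto simp: multiplier_bound_nonneg)
      also have "\<dots> = sqrt (multiplier_bound a) * p + k * m * B2"
        using p0 k m B2 by (simp add: real_sqrt_mult)
      finally show ?thesis .
    qed
    then have "A0 * sqrt (LINT x|\<nu>. (HG_max x * \<phi> x)\<^sup>2) \<le> A0 * (sqrt (multiplier_bound a) * p + k * m * B2)"
      using A0(1) by (rule mult_left_mono)
    also have "\<dots> = (A0 * sqrt (multiplier_bound a)) * p + A0 * (k * m * B2)" by (simp add: algebra_simps)
    also have "\<dots> \<le> 1 / 2 * p + A0 * (k * m * B2)"
      using mult_right_mono[OF small p0] by (rule add_right_mono)
    finally have fin: "A0 * sqrt (LINT x|\<nu>. (HG_max x * \<phi> x)\<^sup>2) \<le> 1 / 2 * p + A0 * (k * m * B2)" .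
    have "p \<le> 2 * (m + e)" if "r \<le> 1 / 2 * p + e" "p \<le> m + r" for r e
      using that by simp
    from this[OF fin id] have "p \<le> 2 * (m + A0 * (k * m * B2))" .
    then show ?thesis by (simp add: p_def C0_def algebra_simps)
  qed
  ultimately show ?thesis using that by blast
qed

section \<open>Existence and uniqueness\<close>

lemma weak_form_eq:
  assumes u: "(u, Du) \<in> X" and \<phi>: "\<phi> \<in> QLip0 Q v \<Omega>"
  shows "(LINT x|M. (Q x *v Du x) \<bullet> grad \<phi> x)
        + (LINT x|M. fields_dot H R Du x * \<phi> x * v x)
        + (LINT x|M. u x * fields_dot G S (grad \<phi>) x * v x)
        + (LINT x|M. F x * u x * \<phi> x * v x)
      = ipX (u, Du) (\<phi>, grad \<phi>) + lower_order (u, Du) (\<phi>, grad \<phi>)"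
proof -
  have \<phi>X: "(\<phi>, grad \<phi>) \<in> X" using QLip0_in_QH0[OF \<phi>] .
  note lH = L2_operatorD(3)[OF L2_operator_multiplier[OF multiplier_component[OF H_multiplier H_meas]]]
  note lG = L2_operatorD(3)[OF L2_operator_multiplier[OF multiplier_component[OF G_multiplier G_meas]]]
  note lR = L2_operatorD(3)[OF L2_operator_subunit[OF R]] and lS = L2_operatorD(3)[OF L2_operator_subunit[OF S]]
  have m1: "(\<lambda>x. fields_dot H R Du x * \<phi> x) \<in> borel_measurable M"
    using fields_dot_integral(1)[of H \<phi> R Du] lH[OF \<phi>X] lR[OF u] by (auto dest!: borel_measurable_integrable)
  have m2: "(\<lambda>x. fields_dot G S (grad \<phi>) x * u x) \<in> borel_measurable M"
    using fields_dot_integral(1)[of G u S "grad \<phi>"] lG[OF u] lS[OF \<phi>X] by (auto dest!: borel_measurable_integrable)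
  have m3: "(\<lambda>x. F x * u x * \<phi> x) \<in> borel_measurable M"
    using u \<phi> by (auto simp: QH0_iff QLip0_iff L2_def)
  have "(LINT x|M. (Q x *v Du x) \<bullet> grad \<phi> x) = ipQ (grad \<phi>) Du"
    by (simp add: ipQ_def qf_def inner_commute)
  also have "\<dots> = ipX (u, Du) (\<phi>, grad \<phi>)"
    using QL.ip_sym u \<phi> by (auto simp: ipX_def QH0_iff QLip0_iff)
  finally show ?thesis
    using integral_\<nu>[OF m1] integral_\<nu>[OF m2] integral_\<nu>[OF m3]
    by (simp add: lower_order_def mult.commute[of "u _"])
qed

text \<open>
  Two solutions differ by an element of norm zero.  Its gradient vanishes almost everywhere because \<open>Q\<close> is invertible,
  and then so does the function, by the \<open>L\<^sup>2\<close> bound.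
\<close>
theorem unique_weak_solution:
  fixes f :: "real ^ 'n \<Rightarrow> real" and g :: "real ^ 'n \<Rightarrow> real ^ 'N" and T :: "'N \<Rightarrow> real ^ 'n \<Rightarrow> real ^ 'n"
  assumes f: "f \<in> weighted_Lp 2 v \<Omega>" and g: "g \<in> weighted_Lp 2 v \<Omega>"
    and T: "\<And>i. degenerate_subunit Q v \<Omega> (T i)"
  shows "\<exists>u Du. degenerate_weak_solution \<Omega> v Q H R G S F f g T u Du \<and>
           (\<forall>u' Du'. degenerate_weak_solution \<Omega> v Q H R G S F f g T u' Du' \<longrightarrow>
              (AE x in lebesgue_on \<Omega>. u' x = u x) \<and> (AE x in lebesgue_on \<Omega>. Du' x = Du x))"
proof -
  obtain C0 where C0: "C0 \<ge> 0" "\<And>t m w. 0 \<le> t \<Longrightarrow> t \<le> 1 \<Longrightarrow> m > 0 \<Longrightarrow> w \<in> test_pairs \<Longrightarrow>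
    (\<And>u. u \<in> test_pairs \<Longrightarrow> \<bar>ipX u w + t * lower_order u w\<bar> \<le> m * XI.nm u) \<Longrightarrow> XI.nm w \<le> C0 * m"
    using apriori_estimate by blast
  obtain k where k: "k \<ge> 0" "\<And>y z. y \<in> X \<Longrightarrow> z \<in> X \<Longrightarrow> \<bar>lower_order y z\<bar> \<le> k * XI.nm y * XI.nm z"
    using bounded_form_lower_order unfolding bounded_form_def by blast
  interpret pf: perturbed_form X ipX lower_order k C0 test_pairs
    by unfold_locales
       (use bounded_form_lower_order k C0 test_pairs_sub test_pairs_dense in \<open>simp_all add: bounded_form_def del: split_paired_All split_paired_Ex\<close>)
  define l where "l z = (LINT x|\<nu>. f x * fst z x) + 1 * (\<Sum>i\<in>UNIV. LINT x|\<nu>. g x $ i * (T i x \<bullet> snd z x))" for z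
  have f2: "f \<in> L2" using f by (simp add: weighted_L2)
  have gm: "g \<in> borel_measurable M" using g by (simp add: weighted_Lp_def)
  have g2: "(\<lambda>x. g x $ i) \<in> L2" for i
  proof -
    have "integrable \<nu> (\<lambda>x. (norm (g x))\<^sup>2)" using g by (simp add: weighted_Lp_iff)
    then have n: "(\<lambda>x. norm (g x)) \<in> L2" using gm by (simp add: L2_def)
    have m: "(\<lambda>x. g x $ i) \<in> borel_measurable M" using gm by (simp add: cart_eq_inner_axis)
    show ?thesis by (rule L2_dominated[OF m n, of 1]) (simp add: component_le_norm_cart)
  qed
  have lT: "L2_operator (\<lambda>z x. T i x \<bullet> snd z x)" for i by (rule L2_operator_subunit[OF T])
  have l1: "L2_operator (\<lambda>z x. fst z x)" using L2_operator_multiplier[OF multiplier_const[of 1]] by simp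
  have l: "XH.bounded_functional l"
    unfolding l_def[abs_def]
    by (intro XH.bounded_functional_lincomb XH.bounded_functional_sum bounded_functional_L2_operator l1 lT f2 g2) auto
  have rhs: "(LINT x|M. f x * \<phi> x * v x) + (LINT x|M. fields_dot g T (grad \<phi>) x * v x) = l (\<phi>, grad \<phi>)"
    if \<phi>: "\<phi> \<in> QLip0 Q v \<Omega>" for \<phi>
  proof -
    have \<phi>X: "(\<phi>, grad \<phi>) \<in> X" using QLip0_in_QH0[OF \<phi>] .
    have m1: "(\<lambda>x. f x * \<phi> x) \<in> borel_measurable M"
      using f2 \<phi> by (auto simp: L2_def QLip0_iff)
    have g1: "(\<lambda>x. g x $ i * 1) \<in> L2" for i using g2 by simp
    have T1: "(\<lambda>x. T i x \<bullet> grad \<phi> x) \<in> L2" for i using L2_operatorD(3)[OF lT \<phi>X] by simp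
    note fd = fields_dot_integral[of g "\<lambda>x. 1" T "grad \<phi>", OF g1 T1]
    have m2: "fields_dot g T (grad \<phi>) \<in> borel_measurable M"
      using borel_measurable_integrable[OF fd(1)] by simp
    show ?thesis
      using integral_\<nu>[OF m1] integral_\<nu>[OF m2] fd(2) by (simp add: l_def mult.commute[of "g _ $ _"])
  qed
  have weak_iff: "degenerate_weak_solution \<Omega> v Q H R G S F f g T u Du \<longleftrightarrow>
      (u, Du) \<in> X \<and> (\<forall>w\<in>test_pairs. ipX (u, Du) w + lower_order (u, Du) w = l w)" for u Du
  proof (cases "(u, Du) \<in> X")
    case True
    then show ?thesis
      unfolding degenerate_weak_solution_def using weak_form_eq[OF True] rhs by (simp add: test_pairs_def)
  qed (simp add: degenerate_weak_solution_def)
  obtain z where z: "z \<in> X" "\<And>w. w \<in> X \<Longrightarrow> ipX z w + lower_order z w = l w"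
    using pf.exists_solution[OF l] by blast
  obtain u Du where uDu: "z = (u, Du)" by (metis surj_pair)
  have sol: "degenerate_weak_solution \<Omega> v Q H R G S F f g T u Du"
    unfolding weak_iff using z test_pairs_sub uDu by auto
  have "(AE x in M. u' x = u x) \<and> (AE x in M. Du' x = Du x)"
    if sol': "degenerate_weak_solution \<Omega> v Q H R G S F f g T u' Du'" for u' Du'
  proof -
    have X': "(u', Du') \<in> X" and X0: "(u, Du) \<in> X" using sol sol' by (simp_all add: weak_iff)
    define d where "d = (u', Du') - (u, Du)"
    have dX: "d \<in> X" unfolding d_def using X' X0 by (rule XI.closed(2))
    have "ipX d w + lower_order d w = 0" if w: "w \<in> test_pairs" for w
    proof -
      have wX: "w \<in> X" using w test_pairs_sub by auto
      have "lower_order (u', Du') w = lower_order (d + (u, Du)) w" by (simp add: d_def)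
      also have "\<dots> = lower_order d w + lower_order (u, Du) w" using dX X0 wX by (rule pf.K_add)
      finally have "lower_order (u', Du') w = lower_order d w + lower_order (u, Du) w" .
      moreover have "ipX d w = ipX (u', Du') w - ipX (u, Du) w"
        unfolding d_def using X' X0 wX by (rule XI.ip_diff)
      moreover have "ipX (u', Du') w + lower_order (u', Du') w = l w" "ipX (u, Du) w + lower_order (u, Du) w = l w"
        using sol sol' w unfolding weak_iff by blast+
      ultimately show ?thesis by linarith
    qed
    then have "XI.nm d = 0" by (rule pf.unique_solution[OF dX])
    then have ip0: "energy (snd d) = 0" by (simp add: XI_nm)
    have Dd: "snd d \<in> QL2 Q \<Omega>" and ud: "fst d \<in> L2" using X_QL2 X_L2 dX by auto
    have "AE x in M. qf x (snd d x) (snd d x) = 0"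
    proof -
      have "AE x in M. 0 \<le> qf x (snd d x) (snd d x)" by (rule AE_I2) (simp add: qf_nonneg)
      then show ?thesis
        using integral_nonneg_eq_0_iff_AE[of M "\<lambda>x. qf x (snd d x) (snd d x)"] Dd ip0
        by (simp add: QL2_iff ipQ_def)
    qed
    moreover have "AE x in M. invertible (Q x)" using Q by (simp add: matrix_function_on_def)
    ultimately have "AE x in M. snd d x = 0" using AE_space
    proof eventually_elim
      case (elim x)
      then obtain c where "c > 0" "\<And>w. c * (norm w)\<^sup>2 \<le> w \<bullet> (Q x *v w)"
        using psd_invertible_coercive[OF Q_psd] by auto
      then have "c * (norm (snd d x))\<^sup>2 \<le> 0" using elim(1) by (metis qf_def)
      then have "(norm (snd d x))\<^sup>2 \<le> 0" using \<open>c > 0\<close> by (simp add: mult_le_0_iff)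
      then show ?case by simp
    qed
    then have "AE x in M. Du' x = Du x" by eventually_elim (simp add: d_def)
    moreover have "(LINT x|\<nu>. (fst d x)\<^sup>2) = 0"
    proof -
      have "(LINT x|\<nu>. (fst d x)\<^sup>2) \<le> multiplier_bound (\<lambda>x. 1) * energy (snd d)"
        using L2_bound_QH0[of "fst d" "snd d"] dX by simp
      moreover have "0 \<le> (LINT x|\<nu>. (fst d x)\<^sup>2)" by simp
      ultimately show ?thesis using ip0 by simp
    qed
    then have "AE x in \<nu>. (fst d x)\<^sup>2 = 0"
      using integral_nonneg_eq_0_iff_AE[of \<nu> "\<lambda>x. (fst d x)\<^sup>2"] ud by (simp add: L2_def)
    then have "AE x in M. u' x = u x" unfolding AE_\<nu> by eventually_elim (simp add: d_def)
    ultimately show ?thesis by blast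
  qed
  with sol show ?thesis by blast
qed

end

theorem theorem3p3:
  fixes \<Omega> :: "(real ^ 'n) set"
    and v :: "real ^ 'n \<Rightarrow> real"
    and Q :: "real ^ 'n \<Rightarrow> real ^ 'n ^ 'n"
    and f F :: "real ^ 'n \<Rightarrow> real"
    and G H g :: "real ^ 'n \<Rightarrow> real ^ 'N"
    and R S T :: "'N \<Rightarrow> real ^ 'n \<Rightarrow> real ^ 'n"
    and \<rho> :: "real ^ 'n \<Rightarrow> real ^ 'n \<Rightarrow> real"
    and k \<sigma> q :: real
  assumes "bounded \<Omega>" and "connected \<Omega>" and "open \<Omega>"
    and "weight_on \<Omega> v" and "integrable (lebesgue_on \<Omega>) v"
    and "matrix_function_on \<Omega> Q"
    and "k > 0" and "AE x in lebesgue_on \<Omega>. matrix_op_norm (Q x) \<le> k * v x"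
    and "f \<in> weighted_Lp 2 v \<Omega>" and "F \<in> weighted_Lp 2 v \<Omega>"
    and "G \<in> weighted_Lp 2 v \<Omega>" and "H \<in> weighted_Lp 2 v \<Omega>" and "g \<in> weighted_Lp 2 v \<Omega>"
    and "\<And>i. degenerate_subunit Q v \<Omega> (R i)"
    and "\<And>i. degenerate_subunit Q v \<Omega> (S i)"
    and "\<And>i. degenerate_subunit Q v \<Omega> (T i)"
    and "\<And>\<phi>. \<phi> \<in> QLip0 Q v \<Omega> \<Longrightarrow> (\<forall>x\<in>\<Omega>. 0 \<le> \<phi> x) \<Longrightarrow>
           0 \<le> (LINT x|lebesgue_on \<Omega>. (fields_dot G S (grad \<phi>) x + F x * \<phi> x) * v x)"
    and "\<sigma> > 1"
    and "\<exists>C. \<forall>\<phi>\<in>QLip0 Q v \<Omega>. weighted_Lp_norm (2 * \<sigma>) v \<Omega> \<phi> \<le> C * QL2_norm Q \<Omega> (grad \<phi>)"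
    and "admissible_quasimetric \<Omega> \<rho>"
    and "local_Poincare Q v \<Omega> \<rho>"
    and "q > 2 * (\<sigma> / (\<sigma> - 1))"
    and "H \<in> weighted_Lp q v \<Omega>" and "G \<in> weighted_Lp q v \<Omega>" and "F \<in> weighted_Lp (q / 2) v \<Omega>"
  shows "\<exists>u Du. degenerate_weak_solution \<Omega> v Q H R G S F f g T u Du \<and>
           (\<forall>u' Du'. degenerate_weak_solution \<Omega> v Q H R G S F f g T u' Du' \<longrightarrow>
              (AE x in lebesgue_on \<Omega>. u' x = u x) \<and> (AE x in lebesgue_on \<Omega>. Du' x = Du x))"
proof -
  obtain C where C: "\<forall>\<phi>\<in>QLip0 Q v \<Omega>. weighted_Lp_norm (2 * \<sigma>) v \<Omega> \<phi> \<le> C * QL2_norm Q \<Omega> (grad \<phi>)"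
    using assms(19) by blast
  interpret degenerate_space \<Omega> v Q by unfold_locales (fact assms)+
  interpret degenerate_sobolev \<Omega> v Q \<sigma> "\<bar>C\<bar>"
  proof unfold_locales
    fix \<phi> assume "\<phi> \<in> QLip0 Q v \<Omega>"
    then have "weighted_Lp_norm (2 * \<sigma>) v \<Omega> \<phi> \<le> C * QL2_norm Q \<Omega> (grad \<phi>)" using C by blast
    also have "\<dots> \<le> \<bar>C\<bar> * QL2_norm Q \<Omega> (grad \<phi>)"
      by (intro mult_right_mono) (auto simp: QL2_norm_eq ipQ_nonneg)
    finally show "weighted_Lp_norm (2 * \<sigma>) v \<Omega> \<phi> \<le> \<bar>C\<bar> * QL2_norm Q \<Omega> (grad \<phi>)" .
  qed (use assms(18) in auto)
  have q: "q \<ge> 2 * \<sigma>'" using assms(22) by (simp add: \<sigma>'_def)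
  have "multiplier (\<lambda>x. norm (H x))" "multiplier (\<lambda>x. norm (G x))"
    using assms(23,24) unfolding weighted_Lp_iff by (auto intro!: multiplier_if_Lq[OF _ q])
  moreover have "multiplier (\<lambda>x. sqrt \<bar>F x\<bar>)"
  proof (rule multiplier_if_Lq[OF _ q])
    have "\<bar>sqrt \<bar>F x\<bar>\<bar> powr q = norm (F x) powr (q / 2)" for x
      using sq_powr[of "sqrt \<bar>F x\<bar>" "q / 2"] by simp
    then show "integrable \<nu> (\<lambda>x. \<bar>sqrt \<bar>F x\<bar>\<bar> powr q)" using assms(25) unfolding weighted_Lp_iff by simp
    have "F \<in> borel_measurable M" using assms(10) by (simp add: weighted_Lp_def)
    then show "(\<lambda>x. sqrt \<bar>F x\<bar>) \<in> borel_measurable M" by measurable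
  qed
  ultimately interpret degenerate_operator \<Omega> v Q \<sigma> "\<bar>C\<bar>" H G R S F
    using assms by unfold_locales auto
  show ?thesis by (rule unique_weak_solution[OF assms(9,13,16)])
qed

end
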